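(* Let $f_m(z)=\sum_{k=-m}^m a_k z^{-k}$ be a Laurent polynomial with $m\ge 1$, real coefficients $a_k$ and $a_{\pm m}\neq 0$. Suppose that the set $\mathbf{Z}(f_m)$ is spanned by a $C^1$ polar curve $p(\mathbb{T})$, i.e. $\mathbf{Z}(f_m)=p(\mathbb{T})$, and suppose that the separation assumption holds: for every $\lambda\in\mathbb{R}$ with $|z_m(\lambda)|=|z_{m+1}(\lambda)|$ one has $$|z_{m-1}(\lambda)|<|z_m(\lambda)|=|z_{m+1}(\lambda)|<|z_{m+2}(\lambda)|.$$ Then $$\mathrm{DoS}\bigl(\mathbf{T}_n(f_m)\bigr)=\mathrm{DoS}\bigl(\mathbf{T}_n(f_m\circ p)\bigr).$$
   Context: For a bounded function $a$ on the unit circle $\mathbb{T}$, $\mathbf{T}_n(a)$ is the $n\times n$ Toeplitz matrix with $(i,j)$ entry $c_{i-j}$, where $c_k=\frac{1}{2\pi}\int_{-\pi}^{\pi}a(e^{\mathrm{i}\theta})e^{\mathrm{i}k\theta}\,d\theta$ (so $a(z)=\sum_k c_k z^{-k}$; for $a=f_m$, $c_k=a_k$ for $|k|\le m$ and $c_k=0$ otherwise). The function $f_m\circ p$ is $e^{\mathrm{i}\theta}\mapsto f_m(p(e^{\mathrm{i}\theta}))$. The density of states $\mathrm{DoS}(\mathbf{A}_n)$ of a sequence of $n\times n$ matrices $\mathbf{A}_n$ with eigenvalues $\lambda_{1,n},\dots,\lambda_{n,n}$ (with algebraic multiplicity) is the weak limit, as $n\to\infty$, of the empirical measures $\mu_n=\frac1n\sum_{k=1}^n\delta_{\lambda_{k,n}}$.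 For $\lambda\in\mathbb{C}$, $z_1(\lambda),\dots,z_{2m}(\lambda)$ denote the roots (with multiplicity) of the polynomial $z^m(f_m(z)-\lambda)$ in $z$, sorted so that $0<|z_1(\lambda)|\le|z_2(\lambda)|\le\dots\le|z_{2m}(\lambda)|$. Inequalities involving the non-existent roots $z_0$ or $z_{2m+1}$ (when $m=1$) are regarded as vacuous. $\mathbf{Z}(f_m):=\{z_m(\lambda),z_{m+1}(\lambda)\in\mathbb{C} : |z_m(\lambda)|=|z_{m+1}(\lambda)|\text{ for some }\lambda\in\mathbb{R}\}$, i.e. the set of all middle roots over those real $\lambda$ for which these two roots have equal modulus. A $C^1$ polar curve is a set parametrised as $p(e^{\mathrm{i}\theta})=r(\theta)e^{\mathrm{i}\theta}$, $\theta\in[-\pi,\pi]$, for a continuously differentiable $r:[-\pi,\pi]\to(0,\infty)$ with $r(-\theta)=r(\theta)$ and $r'(\pi)=r'(-\pi)$; it is denoted $p(\mathbb{T})$. *)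

theory Defs
  imports
    "HOL-Probability.Probability"
    "Jordan_Normal_Form.Char_Poly"
begin

section \<open>Toeplitz matrices\<close>

text \<open>The sign in the exponent is such that the coefficient is $c_k$ in
  $a(z) = \sum_k c_k z^{-k}$. Only the values of \<open>a\<close> on the unit circle matter.\<close>

definition symbol_coeff :: "(complex \<Rightarrow> complex) \<Rightarrow> int \<Rightarrow> complex" where
  "symbol_coeff a k =
     1 / (2 * pi) * integral {-pi..pi} (\<lambda>\<theta>. a (cis \<theta>) * cis (of_int k * \<theta>))"

definition toeplitz :: "(complex \<Rightarrow> complex) \<Rightarrow> nat \<Rightarrow> complex mat" where
  "toeplitz a n = mat n n (\<lambda>(i, j). symbol_coeff a (int i - int j))"


section \<open>Density of states\<close>

text \<open>The roots of the characteristic polynomial, counted with multiplicity, are the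
  eigenvalues counted with algebraic multiplicity; for $n \ge 1$ there are $n$ of them.
  The measure on all subsets is transported to the Borel sets. For the $0 \times 0$ matrix
  the value is unspecified, which is irrelevant in the limit.\<close>

definition empirical_measure :: "complex mat \<Rightarrow> complex measure" where
  "empirical_measure A =
     distr (measure_pmf (pmf_of_multiset (proots (char_poly A)))) borel (\<lambda>x. x)"

definition weakly_converges ::
    "(nat \<Rightarrow> 'a :: topological_space measure) \<Rightarrow> 'a measure \<Rightarrow> bool" where
  "weakly_converges M \<mu> \<longleftrightarrow>
     (\<forall>g :: 'a \<Rightarrow> real. continuous_on UNIV g \<longrightarrow> bounded (range g) \<longrightarrow>
        (\<lambda>n. integral\<^sup>L (M n) g) \<longlonglongrightarrow> integral\<^sup>L \<mu> g)"

text \<open>A Borel probability measure on the complex plane is determined by the integrals of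
  bounded continuous functions, so there is at most one density of states.\<close>

definition is_DoS :: "(nat \<Rightarrow> complex mat) \<Rightarrow> complex measure \<Rightarrow> bool" where
  "is_DoS A \<mu> \<longleftrightarrow>
     prob_space \<mu> \<and> sets \<mu> = sets borel \<and>
     weakly_converges (\<lambda>n. empirical_measure (A n)) \<mu>"


section \<open>Laurent polynomials and their roots\<close>

definition laurent :: "nat \<Rightarrow> (int \<Rightarrow> real) \<Rightarrow> complex \<Rightarrow> complex" where
  "laurent m a z = (\<Sum>k = - int m..int m. of_real (a k) * z powi (- k))"

text \<open>The polynomial $z^m (f_m(z) - \xi)$ in $z$.\<close>

definition shifted_poly :: "nat \<Rightarrow> (int \<Rightarrow> real) \<Rightarrow> complex \<Rightarrow> complex poly" where
  "shifted_poly m a \<xi> =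
     (\<Sum>k = - int m..int m. monom (of_real (a k)) (nat (int m - k))) - monom \<xi> m"

text \<open>Roots of equal modulus are listed in an arbitrary but fixed order.\<close>

definition roots_by_modulus :: "complex poly \<Rightarrow> complex list" where
  "roots_by_modulus q = sort_key norm (SOME zs. mset zs = proots q)"

text \<open>The root $z_k(\xi)$, numbered from $k = 1$ to $k = 2m$.\<close>

definition ordered_root :: "nat \<Rightarrow> (int \<Rightarrow> real) \<Rightarrow> complex \<Rightarrow> nat \<Rightarrow> complex" where
  "ordered_root m a \<xi> k = roots_by_modulus (shifted_poly m a \<xi>) ! (k - 1)"

definition Z_set :: "nat \<Rightarrow> (int \<Rightarrow> real) \<Rightarrow> complex set" where
  "Z_set m a =
     (\<Union>\<xi> \<in> {\<xi> \<in> \<real>. norm (ordered_root m a \<xi> m) = norm (ordered_root m a \<xi> (m + 1))}.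
        {ordered_root m a \<xi> m, ordered_root m a \<xi> (m + 1)})"

text \<open>For $m = 1$ the roots $z_{m-1}$ and $z_{m+2}$ do not exist.\<close>

definition separated :: "nat \<Rightarrow> (int \<Rightarrow> real) \<Rightarrow> bool" where
  "separated m a \<longleftrightarrow>
     (\<forall>\<xi> \<in> \<real>. norm (ordered_root m a \<xi> m) = norm (ordered_root m a \<xi> (m + 1)) \<longrightarrow>
        (m \<ge> 2 \<longrightarrow>
           norm (ordered_root m a \<xi> (m - 1)) < norm (ordered_root m a \<xi> m) \<and>
           norm (ordered_root m a \<xi> (m + 1)) < norm (ordered_root m a \<xi> (m + 2))))"


section \<open>Polar curves\<close>

text \<open>The derivative is one-sided at the end points of the interval.\<close>

definition C1_polar_radius :: "(real \<Rightarrow> real) \<Rightarrow> bool" where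
  "C1_polar_radius r \<longleftrightarrow>
     (\<forall>\<theta> \<in> {-pi..pi}. r \<theta> > 0 \<and> r (- \<theta>) = r \<theta>) \<and>
     (\<exists>r'. (\<forall>\<theta> \<in> {-pi..pi}. (r has_real_derivative r' \<theta>) (at \<theta> within {-pi..pi})) \<and>
           continuous_on {-pi..pi} r' \<and> r' pi = r' (- pi))"

text \<open>On the unit circle this is $p(e^{i\theta}) = r(\theta) e^{i\theta}$; since \<open>Arg\<close> takes values in
  $(-\pi, \pi]$, the end point $\theta = -\pi$ is covered by $r(-\pi) = r(\pi)$.\<close>

definition polar_curve :: "(real \<Rightarrow> real) \<Rightarrow> complex \<Rightarrow> complex" where
  "polar_curve r w = of_real (r (Arg w)) * w"

end

theory Submission
  imports Defs "HOL-Complex_Analysis.Complex_Analysis" "Jordan_Normal_Form.Schur_Decomposition"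
begin

text \<open>
Write $f$ for the Laurent polynomial, $P_\xi(z) = z^m (f(z) - \xi)$, and
$p(e^{it}) = r(t) e^{it}$. Every point of the curve is a middle root of a real level, so $f$ is
real on the curve and the symbol $g(t) = f(p(e^{it}))$ is real, continuous and even. The common
density of states is the distribution of $g(t)$ for $t$ uniform on $[-\pi,\pi]$. Two facts
about each of the two matrix sequences give this: the moments of the empirical measures converge
to the moments of $g$, and the eigenvalues approach the real line. By Weierstrass' theorem they
imply weak convergence (\<open>is_DoS_from_moments\<close>); moments alone would not determine a limit in
the complex plane.

Moments. The normalised trace of $T_n(f)^k$ tends to the constant coefficient of $f^k$
(\<open>toeplitz_moment_trigsum\<close>). Cauchy's theorem turns it into the mean of $f^k$ along the curve
with respect to $dz/(iz) = (1 - i r'/r)\,dt$; since $f$ is real there, the real part is the mean of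
$g^k$ (\<open>moment_transfer\<close>). For $T_n(f \circ p)$, approximate $g$ uniformly by polynomials in
$\cos t$ and use that $T_n(b)$ has operator norm at most $\sup |b|$
(\<open>toeplitz_moment_even\<close>).

Spectra. $T_n(f \circ p)$ is Hermitian. For $T_n(f)$, an eigenvector for $\xi$ yields a multiple
$v + z^{n+m} u$ of $P_\xi$ with $\deg u, \deg v < m$. Reducing modulo the $m$ small roots shows that
$v$ is at most about $|z_m|^n$ times $u$, and reducing modulo the $m$ large roots that $u$ is at
most about $|z_{m+1}|^{-n}$ times $v$. If $|z_m(\xi)| < |z_{m+1}(\xi)|$ this is impossible for
large $n$ (\<open>no_gap_multiple\<close>). Hence the eigenvalues approach the real line once the two middle
moduli are known to differ at every non-real $\xi$ (\<open>nonreal_separation\<close>).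

Non-real levels. Being inside or outside the curve is compared with being small or large in
modulus. On the real line the two orders agree: this is clear for large $|\xi|$, and it propagates by
continuity, first over the real levels off $f(p(\mathbb{T}))$, where the middle moduli differ and
no root is on the curve, and then over the interval $f(p(\mathbb{T}))$, where the separation
assumption keeps the two middle roots away from all others (\<open>curve_sorted_real\<close>). So at a real
level no root inside has larger modulus than a root outside. At a non-real level consider pairs $(z, w)$ with
$f(z) = f(w)$, $z$ inside and $w$ outside. If $|z| \ge |w|$ for some pair, then a pair of maximal
ratio $c = z/w$ may be taken at a non-real level. By Hurwitz' theorem the equation
$f(c' w) = f(w)$ is solvable near it for $c'$ slightly larger than $c$, contradicting maximality,
unless $f(c z) = f(z)$ identically. In that case $|c| = 1$, and the separation assumption makes the
curve invariant under the rotation $c$, which is absurd since $c$ takes $w$ outside to $z$ inside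
(\<open>nonreal_inside_less_outside\<close>).
\<close>

section \<open>The roots of a level, ordered by modulus\<close>

lemma poly_shifted_poly:
  assumes "z \<noteq> 0"
  shows "poly (shifted_poly m a \<xi>) z = z ^ m * (laurent m a z - \<xi>)"
proof -
  have "z ^ nat (int m - k) = z ^ m * z powi (- k)" if "k \<in> {- int m..int m}" for k
  proof -
    have "z ^ nat (int m - k) = z powi (int m - k)"
      using that by (simp add: power_int_def)
    also have "\<dots> = z ^ m * z powi (- k)"
      using assms by (simp add: power_int_diff power_int_minus field_simps)
    finally show ?thesis .
  qed
  then have "(\<Sum>k = - int m..int m. of_real (a k) * z ^ nat (int m - k))
      = (\<Sum>k = - int m..int m. z ^ m * (of_real (a k) * z powi (- k)))"
    by (intro sum.cong refl) (simp add: mult_ac)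
  then show ?thesis
    unfolding shifted_poly_def laurent_def
    by (simp add: poly_sum poly_monom sum_distrib_left right_diff_distrib mult.commute)
qed

lemma coeff_shifted_poly:
  "coeff (shifted_poly m a \<xi>) i =
     (if i \<le> 2 * m then of_real (a (int m - int i)) else 0) - (if i = m then \<xi> else 0)"
proof -
  have "(\<Sum>k = - int m..int m. coeff (monom (complex_of_real (a k)) (nat (int m - k))) i)
     = (\<Sum>k = - int m..int m. if k = int m - int i then complex_of_real (a k) else 0)"
    by (intro sum.cong refl) (auto simp: coeff_monom)
  also have "\<dots> = (if i \<le> 2 * m then of_real (a (int m - int i)) else 0)"
    by (subst sum.delta) auto
  finally show ?thesis
    unfolding shifted_poly_def by (simp add: coeff_sum coeff_monom)
qed

lemma poly_as_sum_le:
  fixes p :: "'a::comm_semiring_1 poly"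
  assumes "degree p \<le> n"
  shows "poly p z = (\<Sum>i\<le>n. coeff p i * z ^ i)"
proof -
  have "poly p z = (\<Sum>i\<le>degree p. coeff p i * z ^ i)" by (rule poly_altdef)
  also have "\<dots> = (\<Sum>i\<le>n. coeff p i * z ^ i)"
    using assms by (intro sum.mono_neutral_left) (auto simp: coeff_eq_0)
  finally show ?thesis .
qed

locale laurent_symbol =
  fixes m :: nat and a :: "int \<Rightarrow> real"
  assumes m_pos: "m \<ge> 1" and a_top: "a (int m) \<noteq> 0" and a_bot: "a (- int m) \<noteq> 0"
begin

abbreviation "f \<equiv> laurent m a"
abbreviation "P \<equiv> shifted_poly m a"

lemma P_eq_0_iff:
  shows "poly (P \<xi>) z = 0 \<longleftrightarrow> z \<noteq> 0 \<and> f z = \<xi>"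
proof (cases "z = 0")
  case True
  have "poly (P \<xi>) 0 = of_real (a (int m))"
    using m_pos by (simp add: poly_0_coeff_0 coeff_shifted_poly)
  then show ?thesis using True a_top by simp
next
  case False then show ?thesis by (simp add: poly_shifted_poly)
qed

lemma degree_P: "degree (P \<xi>) = 2 * m"
proof (rule antisym)
  show "degree (P \<xi>) \<le> 2 * m"
    by (rule degree_le) (auto simp: coeff_shifted_poly)
  show "2 * m \<le> degree (P \<xi>)"
    using m_pos a_bot by (intro le_degree) (auto simp: coeff_shifted_poly)
qed

lemma lead_coeff_P: "lead_coeff (P \<xi>) = of_real (a (- int m))"
  using m_pos by (simp add: degree_P coeff_shifted_poly)

lemma P_nonzero: "P \<xi> \<noteq> 0"
  using degree_P[of \<xi>] m_pos by auto

definition roots :: "complex \<Rightarrow> complex list" where "roots \<xi> = roots_by_modulus (P \<xi>)"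

lemma mset_roots: "mset (roots \<xi>) = proots (P \<xi>)"
  and sorted_roots: "sorted (map norm (roots \<xi>))"
proof -
  have "\<exists>xs. mset xs = proots (P \<xi>)" by (rule ex_mset)
  then have "mset (SOME roots. mset roots = proots (P \<xi>)) = proots (P \<xi>)" by (rule someI_ex)
  then show "mset (roots \<xi>) = proots (P \<xi>)" by (simp add: roots_def roots_by_modulus_def)
  show "sorted (map norm (roots \<xi>))" by (simp add: roots_def roots_by_modulus_def)
qed

lemma length_roots: "length (roots \<xi>) = 2 * m"
  by (metis degree_P mset_roots size_mset size_proots_complex)

lemma set_roots: "z \<in> set (roots \<xi>) \<longleftrightarrow> z \<noteq> 0 \<and> f z = \<xi>"
proof -
  have "z \<in> set (roots \<xi>) \<longleftrightarrow> z \<in># proots (P \<xi>)"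
    by (metis mset_roots set_mset_mset)
  then show ?thesis using P_nonzero P_eq_0_iff by simp
qed

lemma ordered_root_eq: "ordered_root m a \<xi> k = roots \<xi> ! (k - 1)"
  by (simp add: ordered_root_def roots_def)

lemma roots_mono: "i \<le> j \<Longrightarrow> j < 2 * m \<Longrightarrow> norm (roots \<xi> ! i) \<le> norm (roots \<xi> ! j)"
  using sorted_roots[of \<xi>] by (auto simp: sorted_iff_nth_mono length_roots)

lemma P_factor: "P \<xi> = Polynomial.smult (of_real (a (- int m))) (\<Prod>w\<leftarrow>roots \<xi>. [:- w, 1:])"
proof -
  have "P \<xi> = Polynomial.smult (lead_coeff (P \<xi>)) (\<Prod>w\<in>#proots (P \<xi>). [:- w, 1:])"
    by (simp add: complex_poly_decompose_multiset)
  then show ?thesis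
    unfolding lead_coeff_P mset_roots[symmetric] by (simp add: prod_mset_prod_list flip: mset_map)
qed

definition inner_mod :: "complex \<Rightarrow> real" where "inner_mod \<xi> = norm (roots \<xi> ! (m - 1))"
definition outer_mod :: "complex \<Rightarrow> real" where "outer_mod \<xi> = norm (roots \<xi> ! m)"

lemma inner_le_outer_mod: "inner_mod \<xi> \<le> outer_mod \<xi>"
  unfolding inner_mod_def outer_mod_def using m_pos by (intro roots_mono) auto

lemma root_below_outer: assumes "w \<noteq> 0" "f w = \<xi>" "norm w < outer_mod \<xi>" shows "norm w \<le> inner_mod \<xi>"
proof -
  obtain j where j: "j < 2 * m" "w = roots \<xi> ! j" using assms set_roots[of w \<xi>] length_roots by (auto simp: in_set_conv_nth)
  have "j < m" using assms(3) roots_mono[of m j \<xi>] j unfolding outer_mod_def by (meson not_less)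
  then show ?thesis unfolding inner_mod_def j using m_pos by (intro roots_mono) auto
qed

lemma root_above_inner: assumes "w \<noteq> 0" "f w = \<xi>" "norm w > inner_mod \<xi>" shows "norm w \<ge> outer_mod \<xi>"
  using root_below_outer[OF assms(1,2)] assms(3) by force

text \<open>Cauchy's bound from the leading term; it makes the roots bounded over bounded sets of
  levels.\<close>

lemma root_bound:
  assumes "z \<noteq> 0" "f z = \<xi>"
  shows "norm z \<le> 1 + ((\<Sum>i<2*m. \<bar>a (int m - int i)\<bar>) + norm \<xi>) / \<bar>a (- int m)\<bar>"
proof (cases "norm z \<le> 1")
  case True
  then show ?thesis by (smt (verit) divide_nonneg_nonneg norm_ge_zero abs_ge_zero sum_nonneg)
next
  case False
  define S where "S = (\<Sum>i<2*m. \<bar>a (int m - int i)\<bar>) + norm \<xi>"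
  have 0: "0 = poly (P \<xi>) z" using P_eq_0_iff assms by simp
  also have "\<dots> = (\<Sum>i\<le>2*m. coeff (P \<xi>) i * z ^ i)"
    by (rule poly_as_sum_le) (simp add: degree_P)
  also have "\<dots> = (\<Sum>i<2*m. coeff (P \<xi>) i * z ^ i) + of_real (a (- int m)) * z ^ (2 * m)"
    using m_pos by (simp add: lessThan_Suc_atMost[symmetric] coeff_shifted_poly)
  finally have "of_real (a (- int m)) * z ^ (2 * m) = - (\<Sum>i<2*m. coeff (P \<xi>) i * z ^ i)"
    by (simp add: eq_neg_iff_add_eq_0 add.commute)
  then have "\<bar>a (- int m)\<bar> * norm z ^ (2 * m) = norm (\<Sum>i<2*m. coeff (P \<xi>) i * z ^ i)"
    by (metis norm_minus_cancel norm_mult norm_of_real norm_power)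
  also have "\<dots> \<le> (\<Sum>i<2*m. norm (coeff (P \<xi>) i) * norm z ^ (2 * m - 1))"
    by (intro sum_norm_le order.trans[OF eq_refl[OF norm_mult]])
       (use False in \<open>auto intro!: mult_left_mono power_increasing simp: norm_power\<close>)
  also have "\<dots> \<le> (\<Sum>i<2*m. (\<bar>a (int m - int i)\<bar> + (if i = m then norm \<xi> else 0)) * norm z ^ (2 * m - 1))"
    by (intro sum_mono mult_right_mono)
       (auto simp: coeff_shifted_poly intro!: order.trans[OF norm_triangle_ineq4])
  also have "\<dots> = S * norm z ^ (2 * m - 1)"
    using m_pos by (simp add: sum_distrib_right[symmetric] sum.distrib S_def)
  finally have "\<bar>a (- int m)\<bar> * norm z * norm z ^ (2 * m - 1) \<le> S * norm z ^ (2 * m - 1)"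
    using m_pos by (simp add: mult.assoc flip: power_Suc)
  then have "\<bar>a (- int m)\<bar> * norm z \<le> S"
    using False by (subst (asm) mult_le_cancel_right_pos) (auto intro!: zero_less_power)
  then have "norm z \<le> S / \<bar>a (- int m)\<bar>"
    using a_bot by (simp add: field_simps)
  then show ?thesis unfolding S_def by simp
qed

end

text \<open>Bolzano--Weierstrass for tuples whose length is a variable.\<close>

lemma finite_tuple_subseq:
  fixes x :: "nat \<Rightarrow> nat \<Rightarrow> complex"
  assumes "\<And>k j. j < N \<Longrightarrow> norm (x k j) \<le> B"
  shows "\<exists>\<phi> l. strict_mono (\<phi> :: nat \<Rightarrow> nat) \<and> (\<forall>j<N. (\<lambda>k. x (\<phi> k) j) \<longlonglongrightarrow> l j)"
  using assms
proof (induction N)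
  case 0 then show ?case using strict_mono_id by auto
next
  case (Suc N)
  then obtain \<phi> l where \<phi>: "strict_mono (\<phi> :: nat \<Rightarrow> nat)" "\<forall>j<N. (\<lambda>k. x (\<phi> k) j) \<longlonglongrightarrow> l j"
    by (metis less_SucI)
  have "bounded (range (\<lambda>k. x (\<phi> k) N))"
    using Suc.prems[of N] by (auto simp: bounded_iff)
  then obtain l' \<psi> where \<psi>: "strict_mono (\<psi> :: nat \<Rightarrow> nat)" "((\<lambda>k. x (\<phi> k) N) \<circ> \<psi>) \<longlonglongrightarrow> l'"
    using bounded_imp_convergent_subsequence by blast
  have "(\<lambda>k. x (\<phi> (\<psi> k)) j) \<longlonglongrightarrow> (l(N := l')) j" if "j < Suc N" for j
    using that \<psi> LIMSEQ_subseq_LIMSEQ[OF _ \<psi>(1)] \<phi>(2) by (fastforce simp: o_def less_Suc_eq)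
  then show ?case using strict_mono_o[OF \<phi>(1) \<psi>(1)] by (intro exI[of _ "\<phi> \<circ> \<psi>"] exI) auto
qed

context laurent_symbol begin

text \<open>Continuity of the roots in sequential form: by compactness a subsequence of the sorted
  root lists converges entrywise, and passing to the limit in the factorisation identifies the
  limit as a list of the roots of the limiting level. The limit is sorted as well, but it may
  order roots of equal modulus differently.\<close>

lemma roots_limit:
  assumes "x \<longlonglongrightarrow> \<xi>"
  obtains \<phi> L where "strict_mono (\<phi> :: nat \<Rightarrow> nat)" "length L = 2 * m" "set L = set (roots \<xi>)"
    "\<And>j. j < 2 * m \<Longrightarrow> (\<lambda>k. roots (x (\<phi> k)) ! j) \<longlonglongrightarrow> L ! j"
    "\<And>j. j < 2 * m \<Longrightarrow> norm (L ! j) = norm (roots \<xi> ! j)"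
    "(\<lambda>k. inner_mod (x (\<phi> k))) \<longlonglongrightarrow> inner_mod \<xi>" "(\<lambda>k. outer_mod (x (\<phi> k))) \<longlonglongrightarrow> outer_mod \<xi>"
proof -
  have "Bseq x" using assms convergent_def convergent_imp_Bseq by blast
  then obtain B where B: "\<And>k. norm (x k) \<le> B" by (auto simp: Bseq_def)
  define C where "C = 1 + ((\<Sum>i<2*m. \<bar>a (int m - int i)\<bar>) + B) / \<bar>a (- int m)\<bar>"
  have "norm (roots (x k) ! j) \<le> C" if "j < 2 * m" for k j
  proof -
    have "roots (x k) ! j \<in> set (roots (x k))" using that by (simp add: length_roots)
    then have "norm (roots (x k) ! j) \<le> 1 + ((\<Sum>i<2*m. \<bar>a (int m - int i)\<bar>) + norm (x k)) / \<bar>a (- int m)\<bar>"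
      using root_bound set_roots by blast
    also have "\<dots> \<le> C" unfolding C_def using B[of k] by (intro add_left_mono divide_right_mono) auto
    finally show ?thesis .
  qed
  from finite_tuple_subseq[of "2 * m" "\<lambda>k j. roots (x k) ! j", OF this]
  obtain \<phi> l where \<phi>: "strict_mono (\<phi> :: nat \<Rightarrow> nat)"
     and l: "\<And>j. j < 2 * m \<Longrightarrow> (\<lambda>k. roots (x (\<phi> k)) ! j) \<longlonglongrightarrow> l j" by blast
  define L where "L = map l [0..<2*m]"
  have L: "length L = 2 * m" "\<And>j. j < 2 * m \<Longrightarrow> L ! j = l j" by (auto simp: L_def)
  have lim: "(\<lambda>k. roots (x (\<phi> k)) ! j) \<longlonglongrightarrow> L ! j" if "j < 2 * m" for j using l[OF that] L that by simp
  have x\<phi>: "(\<lambda>k. x (\<phi> k)) \<longlonglongrightarrow> \<xi>" using LIMSEQ_subseq_LIMSEQ[OF assms \<phi>] by (simp add: o_def)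
  have pf: "poly (Polynomial.smult c (\<Prod>w\<leftarrow>zl. [:- w, 1:])) z = c * (\<Prod>j<2*m. (z - zl ! j))"
    if "length zl = 2 * m" for c z :: complex and zl
    using that by (simp add: poly_prod o_def prod.list_conv_set_nth atLeast0LessThan)
  have "P \<xi> = Polynomial.smult (of_real (a (- int m))) (\<Prod>w\<leftarrow>L. [:- w, 1:])"
  proof (subst poly_eq_poly_eq_iff[symmetric], rule ext)
    fix z
    have "(\<lambda>k. poly (P (x (\<phi> k))) z) \<longlonglongrightarrow> poly (P \<xi>) z"
      unfolding shifted_poly_def by (simp add: poly_monom) (intro tendsto_intros x\<phi>)
    moreover have "poly (P (x (\<phi> k))) z = of_real (a (- int m)) * (\<Prod>j<2*m. (z - roots (x (\<phi> k)) ! j))" for k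
      by (subst P_factor, rule pf) (rule length_roots)
    moreover have "(\<lambda>k. of_real (a (- int m)) * (\<Prod>j<2*m. (z - roots (x (\<phi> k)) ! j)))
        \<longlonglongrightarrow> of_real (a (- int m)) * (\<Prod>j<2*m. (z - L ! j))"
      by (intro tendsto_intros lim) auto
    ultimately have "(\<lambda>k. of_real (a (- int m)) * (\<Prod>j<2*m. (z - roots (x (\<phi> k)) ! j))) \<longlonglongrightarrow> poly (P \<xi>) z"
      "(\<lambda>k. of_real (a (- int m)) * (\<Prod>j<2*m. (z - roots (x (\<phi> k)) ! j)))
        \<longlonglongrightarrow> of_real (a (- int m)) * (\<Prod>j<2*m. (z - L ! j))" by simp_all
    then have "poly (P \<xi>) z = of_real (a (- int m)) * (\<Prod>j<2*m. (z - L ! j))" by (rule LIMSEQ_unique)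
    then show "poly (P \<xi>) z = poly (Polynomial.smult (of_real (a (- int m))) (\<Prod>w\<leftarrow>L. [:- w, 1:])) z"
      unfolding pf[OF L(1)] .
  qed
  then have "proots (P \<xi>) = proots (Polynomial.smult (of_real (a (- int m))) (\<Prod>w\<leftarrow>L. [:- w, 1:]))" by simp
  also have "\<dots> = proots (\<Prod>w\<leftarrow>L. [:- w, 1:])" using a_bot by (intro proots_smult) auto
  also have "\<dots> = mset L" 
  proof (induction L)
    case (Cons w ws)
    have "(\<Prod>w\<leftarrow>ws. [:- w, 1:]) \<noteq> 0" by (auto simp: prod_list_zero_iff)
    then show ?case using Cons.IH by (simp add: proots_mult del: mult_pCons_left)
  qed simp
  finally have ms: "mset L = mset (roots \<xi>)" using mset_roots by simp
  have "norm (L ! i) \<le> norm (L ! j)" if "i \<le> j" "j < 2 * m" for i j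
    by (rule LIMSEQ_le[OF tendsto_norm[OF lim] tendsto_norm[OF lim]])
       (use that roots_mono in auto)
  then have "sorted (map norm L)" by (auto simp: sorted_iff_nth_mono L(1))
  then have eq: "map norm L = map norm (roots \<xi>)"
  proof -
    have "sort (map norm L) = map norm (roots \<xi>)"
      by (rule properties_for_sort[OF _ sorted_roots]) (simp add: ms)
    then show ?thesis using \<open>sorted (map norm L)\<close> by (simp add: sorted_sort_id)
  qed
  have nL: "norm (L ! j) = norm (roots \<xi> ! j)" if "j < 2 * m" for j
    using arg_cong[OF eq, of "\<lambda>l. l ! j"] that L length_roots by simp
  have "(\<lambda>k. inner_mod (x (\<phi> k))) \<longlonglongrightarrow> inner_mod \<xi>" "(\<lambda>k. outer_mod (x (\<phi> k))) \<longlonglongrightarrow> outer_mod \<xi>"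
    using tendsto_norm[OF lim[of "m-1"]] tendsto_norm[OF lim[of m]] nL m_pos by (auto simp: inner_mod_def outer_mod_def)
  with \<phi> L(1) mset_eq_setD[OF ms] lim nL show ?thesis by (rule that)
qed

end


text \<open>Continuation along a connected set, with closedness and openness of the property
  phrased by sequences so that limits of root lists can be used directly.\<close>

lemma connected_sequential_induct:
  fixes S :: "'a::first_countable_topology set"
  assumes "connected S" "x0 \<in> S" "Q x0" "y \<in> S"
    and closed: "\<And>x l. (\<And>k::nat. x k \<in> S) \<Longrightarrow> l \<in> S \<Longrightarrow> x \<longlonglongrightarrow> l \<Longrightarrow> (\<And>k. Q (x k)) \<Longrightarrow> Q l"
    and open': "\<And>x l. (\<And>k::nat. x k \<in> S) \<Longrightarrow> l \<in> S \<Longrightarrow> x \<longlonglongrightarrow> l \<Longrightarrow> Q l \<Longrightarrow> \<exists>k. Q (x k)"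
  shows "Q y"
proof (rule ccontr)
  assume "\<not> Q y"
  define A where "A = {x \<in> S. Q x}"
  define B where "B = {x \<in> S. \<not> Q x}"
  have clA: "Q x" if "x \<in> closure A" "x \<in> S" for x
    using that closed unfolding closure_sequential A_def by blast
  have clB: "\<not> Q x" if "x \<in> closure B" "x \<in> S" for x
    using that open' unfolding closure_sequential B_def by blast
  have "closure A \<inter> closure B \<inter> S = {}" using clA clB by blast
  moreover have "S \<subseteq> closure A \<union> closure B"
    using closure_subset[of A] closure_subset[of B] by (auto simp: A_def B_def)
  moreover have "x0 \<in> closure A" "y \<in> closure B"
    using closure_subset[of A] closure_subset[of B] assms(2-4) \<open>\<not> Q y\<close> by (auto simp: A_def B_def)
  ultimately show False
    using assms(1,2,4) unfolding connected_closed by blast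
qed

lemma frequently_subseq:
  assumes "\<exists>\<^sub>F n in sequentially. Q n"
  obtains \<psi> :: "nat \<Rightarrow> nat" where "strict_mono \<psi>" "\<And>k. Q (\<psi> k)"
proof -
  have "infinite {n. Q n}"
    using assms unfolding cofinite_eq_sequentially[symmetric] frequently_cofinite .
  from infinite_enumerate[OF this] show ?thesis using that by auto
qed

lemma eventually_less_of_tendsto:
  fixes u v :: "'a \<Rightarrow> real"
  assumes "(u \<longlongrightarrow> c) F" "(v \<longlongrightarrow> d) F" "c < d"
  shows "\<forall>\<^sub>F k in F. u k < v k"
proof -
  have "((\<lambda>k. v k - u k) \<longlongrightarrow> d - c) F" by (intro tendsto_intros assms)
  then have "\<forall>\<^sub>F k in F. 0 < v k - u k" using assms(3) by (intro order_tendstoD(1)) auto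
  then show ?thesis by (rule eventually_mono) simp
qed

context laurent_symbol begin

lemma continuous_f: "continuous_on (- {0}) f"
  unfolding laurent_def by (intro continuous_intros) auto

lemma poly_P_prod: "poly (P \<xi>) z = of_real (a (- int m)) * (\<Prod>j<2*m. (z - roots \<xi> ! j))"
  by (subst P_factor) (simp add: poly_prod o_def prod.list_conv_set_nth atLeast0LessThan length_roots)

section \<open>Large levels\<close>

text \<open>For a large level the polynomial $P_\xi$ is close to $-\xi z^m$ on compact sets
  avoiding 0, so that $m$ roots tend to 0 and $m$ roots to infinity.\<close>

lemma roots_at_infinity:
  assumes "b > 0" "B > 0"
  obtains R where "R > 0" "\<And>\<xi>. norm \<xi> \<ge> R \<Longrightarrow> inner_mod \<xi> < b" "\<And>\<xi>. norm \<xi> \<ge> R \<Longrightarrow> outer_mod \<xi> > B"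
proof (rule ccontr)
  assume contra: "\<not> thesis"
  have "\<exists>\<xi>. norm \<xi> \<ge> real (Suc k) \<and> \<not> (inner_mod \<xi> < b \<and> outer_mod \<xi> > B)" for k
    using that[of "real (Suc k)"] contra by force
  then obtain y where y: "\<And>k. norm (y k) \<ge> real (Suc k)" "\<And>k. \<not> (inner_mod (y k) < b \<and> outer_mod (y k) > B)"
    by metis
  have "\<exists>q\<le>2 * m. \<forall>j<2 * m. norm (roots (y k) ! j) < 1 \<longleftrightarrow> j < q" for k
  proof -
    define q where "q = (LEAST j. \<not> (j < 2 * m \<and> norm (roots (y k) ! j) < 1))"
    have q: "\<not> (q < 2 * m \<and> norm (roots (y k) ! q) < 1)" "q \<le> 2 * m"
      unfolding q_def by (rule LeastI[of _ "2 * m"], simp) (rule Least_le, simp)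
    have "norm (roots (y k) ! j) < 1 \<longleftrightarrow> j < q" if "j < 2 * m" for j
    proof (cases "j < q")
      case True
      then show ?thesis using not_less_Least unfolding q_def by blast
    next
      case False
      then show ?thesis using q roots_mono[of q j "y k"] that by auto
    qed
    then show ?thesis using q(2) by blast
  qed
  then obtain p where p: "\<And>k. p k \<le> 2 * m" "\<And>k j. j < 2 * m \<Longrightarrow> norm (roots (y k) ! j) < 1 \<longleftrightarrow> j < p k"
    by metis
  have "finite (range p)" using p(1) by (intro finite_subset[of "range p" "{..2*m}"]) auto
  then obtain k0 where inf: "infinite {k. p k = p k0}"
    using pigeonhole_infinite[of UNIV p] by auto
  define q where "q = p k0"
  obtain \<phi> :: "nat \<Rightarrow> nat" where \<phi>: "strict_mono \<phi>" "\<And>k. p (\<phi> k) = q"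
    using infinite_enumerate[OF inf] unfolding q_def by auto
  define x where "x k = y (\<phi> k)" for k
  have small: "norm (roots (x k) ! j) < 1 \<longleftrightarrow> j < q" if "j < 2 * m" for j k
    using p(2)[OF that, of "\<phi> k"] \<phi>(2) by (simp add: x_def)
  have xinf: "filterlim (\<lambda>k. norm (x k)) at_top sequentially"
  proof (rule filterlim_at_top_mono[OF filterlim_real_sequentially])
    show "\<forall>\<^sub>F k in sequentially. real k \<le> norm (x k)"
    proof (rule always_eventually, rule allI)
      fix k show "real k \<le> norm (x k)"
        using y(1)[of "\<phi> k"] seq_suble[OF \<phi>(1), of k] unfolding x_def by linarith
    qed
  qed
  have gap: "\<forall>\<^sub>F k in sequentially. \<forall>z\<in>set (roots (x k)). \<not> (e \<le> norm z \<and> norm z \<le> 1 / e)" if "e > 0" for e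
  proof -
    define A where "A = cball (0::complex) (1/e) - ball 0 e"
    have "compact A" unfolding A_def by (intro compact_diff compact_cball open_ball)
    moreover have "continuous_on A f" 
      by (rule continuous_on_subset[OF continuous_f]) (use that in \<open>auto simp: A_def\<close>)
    ultimately have "compact (f ` A)" by (rule compact_continuous_image[rotated])
    then obtain C where C: "\<And>z. z \<in> A \<Longrightarrow> norm (f z) \<le> C" by (meson bounded_iff compact_imp_bounded imageI)
    have "\<forall>\<^sub>F k in sequentially. norm (x k) > C" using xinf by (simp add: filterlim_at_top_dense)
    then show ?thesis
    proof (rule eventually_mono, safe)
      fix k z assume "C < norm (x k)" "z \<in> set (roots (x k))" "e \<le> norm z" "norm z \<le> 1 / e"
      then show False using C[of z] set_roots[of z "x k"] by (auto simp: A_def)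
    qed
  qed
  have far: "\<forall>\<^sub>F k in sequentially. norm (if j < q then roots (x k) ! j else inverse (roots (x k) ! j)) < e"
    if j: "j < 2 * m" and "e > 0" for j e
  proof -
    define d where "d = min e 1"
    have d: "d > 0" "d \<le> e" "d \<le> 1" "1 \<le> 1 / d" using \<open>e > 0\<close> by (auto simp: d_def)
    show ?thesis using gap[OF d(1)]
    proof (rule eventually_mono)
      fix k assume *: "\<forall>z\<in>set (roots (x k)). \<not> (d \<le> norm z \<and> norm z \<le> 1 / d)"
      define z where "z = roots (x k) ! j"
      have gz: "norm z < d \<or> 1 / d < norm z" using * j by (auto simp: z_def length_roots not_le)
      have inv: "norm (inverse z) < d" if "1 / d < norm z"
        using less_imp_inverse_less[OF that] d by (simp add: norm_inverse)
      then show "norm (if j < q then roots (x k) ! j else inverse (roots (x k) ! j)) < e"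
        using gz inv small[OF j, of k] d(2,3) order.trans[OF d(4), of "norm z"]
        unfolding z_def[symmetric] by (cases "j < q") force+
    qed
  qed
  have lim0: "(\<lambda>k. roots (x k) ! j) \<longlonglongrightarrow> 0" if "j < q" "j < 2 * m" for j
    by (rule tendstoI) (use far[OF that(2)] that(1) in simp)
  have liminf: "(\<lambda>k. inverse (roots (x k) ! j)) \<longlonglongrightarrow> 0" if "\<not> j < q" "j < 2 * m" for j
    by (rule tendstoI) (use far[OF that(2)] that(1) in simp)
  have xinf': "filterlim (\<lambda>k. f 1 - x k) at_infinity sequentially"
  proof -
    have "filterlim (\<lambda>k. - x k) at_infinity sequentially"
      using xinf by (intro filterlim_norm_at_top_imp_at_infinity) simp
    from tendsto_add_filterlim_at_infinity[OF tendsto_const this] show ?thesis by simp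
  qed
  \<comment> \<open>To count the small roots, compare two limits of $P(2)/P(1)$: from the
    definition it is $2^m$, from the factorisation it is $2^q$, where $q$ is the number of small
    roots.\<close>
  have r1: "(\<lambda>k. poly (P (x k)) 2 / poly (P (x k)) 1) \<longlonglongrightarrow> 2 ^ m"
  proof -
    have "(\<lambda>k. 2 ^ m * (1 + (f 2 - f 1) / (f 1 - x k))) \<longlonglongrightarrow> 2 ^ m * (1 + 0)"
      by (intro tendsto_intros tendsto_divide_0[OF tendsto_const xinf'])
    moreover have "\<forall>\<^sub>F k in sequentially. f 1 - x k \<noteq> 0"
      using xinf' by (rule filterlim_at_infinity_imp_eventually_ne)
    then have "\<forall>\<^sub>F k in sequentially. 2 ^ m * (1 + (f 2 - f 1) / (f 1 - x k)) = poly (P (x k)) 2 / poly (P (x k)) 1"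
      by (rule eventually_mono) (simp add: poly_shifted_poly field_simps)
    ultimately show ?thesis by (simp add: filterlim_cong)
  qed
  have fac: "(\<lambda>k. (2 - roots (x k) ! j) / (1 - roots (x k) ! j)) \<longlonglongrightarrow> (if j < q then 2 else 1)" if j: "j < 2 * m" for j
  proof (cases "j < q")
    case True
    have "(\<lambda>k. (2 - roots (x k) ! j) / (1 - roots (x k) ! j)) \<longlonglongrightarrow> (2 - 0) / (1 - 0)"
      by (intro tendsto_intros lim0 True j) auto
    then show ?thesis using True by simp
  next
    case False
    have "(\<lambda>k. (2 * inverse (roots (x k) ! j) - 1) / (inverse (roots (x k) ! j) - 1)) \<longlonglongrightarrow> (2 * 0 - 1) / (0 - 1)"
      by (intro tendsto_intros liminf False j) auto
    moreover have "(2 * inverse (roots (x k) ! j) - 1) / (inverse (roots (x k) ! j) - 1) = (2 - roots (x k) ! j) / (1 - roots (x k) ! j)" for k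
    proof -
      have nz: "roots (x k) ! j \<noteq> 0" using set_roots[of "roots (x k) ! j" "x k"] j by (simp add: length_roots)
      have "2 * inverse (roots (x k) ! j) - 1 = inverse (roots (x k) ! j) * (2 - roots (x k) ! j)"
        "inverse (roots (x k) ! j) - 1 = inverse (roots (x k) ! j) * (1 - roots (x k) ! j)"
        using nz by (simp_all add: algebra_simps)
      then show ?thesis using nz by simp
    qed
    ultimately show ?thesis using False by simp
  qed
  have "(\<lambda>k. \<Prod>j<2*m. (2 - roots (x k) ! j) / (1 - roots (x k) ! j)) \<longlonglongrightarrow> (\<Prod>j<2*m. if j < q then 2 else 1)"
    by (intro tendsto_prod fac) auto
  moreover have "(\<Prod>j<2*m. (2 - roots (x k) ! j) / (1 - roots (x k) ! j)) = poly (P (x k)) 2 / poly (P (x k)) 1" for k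
    using a_bot by (simp add: poly_P_prod prod_dividef)
  ultimately have "(\<Prod>j<2*m. if j < q then 2 else (1::complex)) = 2 ^ m"
    using r1 LIMSEQ_unique by fastforce
  moreover have q2: "q \<le> 2 * m" using p(1) by (simp add: q_def)
  have "(\<Prod>j<2*m. if j < q then 2 else (1::complex)) = 2 ^ q"
  proof -
    have "{..<2*m} \<inter> {j. j < q} = {..<q}" using q2 by auto
    then show ?thesis by (simp add: prod.If_cases)
  qed
  ultimately have "(2::complex) ^ q = 2 ^ m" by simp
  then have "norm ((2::complex) ^ q) = norm ((2::complex) ^ m)" by (rule arg_cong)
  then have "(2::real) ^ q = 2 ^ m" by (simp only: norm_power norm_numeral)
  then have "q = m" by simp
  have "\<forall>\<^sub>F k in sequentially. norm (roots (x k) ! (m - 1)) < b"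
    using tendstoD[OF lim0[of "m-1"] \<open>b > 0\<close>] m_pos \<open>q = m\<close> by simp
  moreover have "\<forall>\<^sub>F k in sequentially. norm (inverse (roots (x k) ! m)) < 1 / B"
    using tendstoD[OF liminf[of "m"], of "1/B"] \<open>B > 0\<close> m_pos \<open>q = m\<close> by simp
  ultimately have "\<forall>\<^sub>F k in sequentially. False"
  proof eventually_elim
    case (elim k)
    have nz: "roots (x k) ! m \<noteq> 0" using set_roots[of "roots (x k) ! m" "x k"] m_pos by (simp add: length_roots)
    then have "B < norm (roots (x k) ! m)" using elim(2) \<open>B > 0\<close>
      by (simp add: norm_inverse inverse_eq_divide[symmetric] inverse_less_iff_less)
    then show ?case using elim(1) y(2)[of "\<phi> k"] by (simp add: inner_mod_def outer_mod_def x_def)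
  qed
  then show False by simp
qed

end

section \<open>The modulus order and the curve\<close>

text \<open>The curve is given by the continuous radius function $\rho$, constant on rays, instead
  of a function of the angle; this avoids the cut of the argument. A point is inside, on or
  outside the curve according to whether its modulus is smaller than, equal to or larger than
  \<open>\<rho>\<close> there.\<close>

locale star_curve_symbol = laurent_symbol +
  fixes \<rho> :: "complex \<Rightarrow> real"
  assumes cont_\<rho>: "continuous_on (- {0}) \<rho>"
    and \<rho>_pos: "z \<noteq> 0 \<Longrightarrow> \<rho> z > 0"
    and \<rho>_ray: "t > 0 \<Longrightarrow> \<rho> (of_real t * z) = \<rho> z"
    and Z_eq: "Z_set m a = {z. z \<noteq> 0 \<and> norm z = \<rho> z}"
    and sep: "separated m a"
begin

text \<open>If the two middle moduli differ, this fixes the position of every root: the first $m$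
  are inside the curve, the others outside. If they agree, the roots of the middle modulus are
  exempt, so that the property can hold at levels where they are on the curve.\<close>

definition curve_sorted :: "complex \<Rightarrow> bool" where
  "curve_sorted \<xi> \<longleftrightarrow> (\<forall>z. z \<noteq> 0 \<longrightarrow> f z = \<xi> \<longrightarrow>
     (norm z < outer_mod \<xi> \<longrightarrow> norm z < \<rho> z) \<and> (inner_mod \<xi> < norm z \<longrightarrow> \<rho> z < norm z))"

text \<open>A point of the curve is a middle root of some real level, which can only be the value
  of $f$ there.\<close>

lemma on_curve:
  assumes "z \<noteq> 0" "norm z = \<rho> z"
  shows "f z \<in> \<real>" "inner_mod (f z) = norm z" "outer_mod (f z) = norm z"
proof -
  have "z \<in> Z_set m a" using assms Z_eq by blast
  then obtain \<xi> where \<xi>: "\<xi> \<in> \<real>" "inner_mod \<xi> = outer_mod \<xi>" "z = roots \<xi> ! (m - 1) \<or> z = roots \<xi> ! m"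
    unfolding Z_set_def by (auto simp: ordered_root_eq inner_mod_def outer_mod_def)
  have "z \<in> set (roots \<xi>)" using \<xi>(3) m_pos length_roots[of \<xi>] by auto
  then have "f z = \<xi>" by (simp add: set_roots)
  then show "f z \<in> \<real>" "inner_mod (f z) = norm z" "outer_mod (f z) = norm z" using \<xi> by (auto simp: inner_mod_def outer_mod_def)
qed

lemma middle_on_curve:
  assumes "\<xi> \<in> \<real>" "inner_mod \<xi> = outer_mod \<xi>" "z = roots \<xi> ! (m - 1) \<or> z = roots \<xi> ! m"
  shows "z \<noteq> 0" "norm z = \<rho> z" "f z = \<xi>"
proof -
  have "z \<in> Z_set m a" unfolding Z_set_def using assms by (auto simp: ordered_root_eq inner_mod_def outer_mod_def)
  then show "z \<noteq> 0" "norm z = \<rho> z" using Z_eq by auto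
  have "z \<in> set (roots \<xi>)" using assms(3) m_pos length_roots[of \<xi>] by auto
  then show "f z = \<xi>" by (simp add: set_roots)
qed

lemma separated_roots:
  assumes "\<xi> \<in> \<real>" "inner_mod \<xi> = outer_mod \<xi>" "m \<ge> 2"
  shows "norm (roots \<xi> ! (m - 2)) < inner_mod \<xi>" "outer_mod \<xi> < norm (roots \<xi> ! (m + 1))"
  using sep assms unfolding separated_def inner_mod_def outer_mod_def ordered_root_eq
  by (auto simp: numeral_2_eq_2)

lemma tendsto_\<rho>: "(y \<longlongrightarrow> z) F \<Longrightarrow> z \<noteq> 0 \<Longrightarrow> ((\<lambda>k. \<rho> (y k)) \<longlongrightarrow> \<rho> z) F"
  using cont_\<rho> continuous_on_eq_continuous_at[of "- {0}" \<rho>] isCont_tendsto_compose[of z \<rho> y F] by auto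

text \<open>Passing to the limit gives weak inequalities; they are strict because a root on the
  curve has the modulus of both middle roots.\<close>

lemma curve_sorted_closed:
  assumes "x \<longlonglongrightarrow> \<xi>" "\<And>k. curve_sorted (x k)"
  shows "curve_sorted \<xi>"
proof -
  obtain \<phi> L where \<phi>: "strict_mono (\<phi> :: nat \<Rightarrow> nat)" and L: "length L = 2 * m" "set L = set (roots \<xi>)"
    and lim: "\<And>j. j < 2 * m \<Longrightarrow> (\<lambda>k. roots (x (\<phi> k)) ! j) \<longlonglongrightarrow> L ! j"
    and nL: "\<And>j. j < 2 * m \<Longrightarrow> norm (L ! j) = norm (roots \<xi> ! j)"
    and N1l: "(\<lambda>k. inner_mod (x (\<phi> k))) \<longlonglongrightarrow> inner_mod \<xi>" and N2l: "(\<lambda>k. outer_mod (x (\<phi> k))) \<longlonglongrightarrow> outer_mod \<xi>"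
    using roots_limit[OF assms(1)] by metis
  show ?thesis unfolding curve_sorted_def
  proof (intro allI impI)
    fix z assume z: "z \<noteq> 0" "f z = \<xi>"
    then have "z \<in> set L" using L(2) set_roots by auto
    then obtain j where j: "j < 2 * m" "z = L ! j" using L(1) by (metis in_set_conv_nth)
    define y where "y k = roots (x (\<phi> k)) ! j" for k
    have y: "y \<longlonglongrightarrow> z" using lim[OF j(1)] j(2) by (simp add: y_def[abs_def])
    have yr: "y k \<noteq> 0" "f (y k) = x (\<phi> k)" for k
      using set_roots[of "y k" "x (\<phi> k)"] j by (auto simp: y_def length_roots)
    have "norm z < \<rho> z" if "norm z < outer_mod \<xi>"
    proof -
      have "\<forall>\<^sub>F k in sequentially. norm (y k) < outer_mod (x (\<phi> k))"
        by (rule eventually_less_of_tendsto[OF tendsto_norm[OF y] N2l that])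
      then have "\<forall>\<^sub>F k in sequentially. norm (y k) \<le> \<rho> (y k)"
        by (rule eventually_mono) (use assms(2) yr curve_sorted_def less_imp_le in metis)
      then have "norm z \<le> \<rho> z"
        by (intro tendsto_le[OF _ tendsto_\<rho>[OF y z(1)] tendsto_norm[OF y]]) auto
      then show ?thesis using on_curve(3)[OF z(1)] that z by fastforce
    qed
    moreover have "\<rho> z < norm z" if "inner_mod \<xi> < norm z"
    proof -
      have "\<forall>\<^sub>F k in sequentially. inner_mod (x (\<phi> k)) < norm (y k)"
        by (rule eventually_less_of_tendsto[OF N1l tendsto_norm[OF y] that])
      then have "\<forall>\<^sub>F k in sequentially. \<rho> (y k) \<le> norm (y k)"
        by (rule eventually_mono) (use assms(2) yr curve_sorted_def less_imp_le in metis)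
      then have "\<rho> z \<le> norm z"
        by (intro tendsto_le[OF _ tendsto_norm[OF y] tendsto_\<rho>[OF y z(1)]]) auto
      then show ?thesis using on_curve(2)[OF z(1)] that z by fastforce
    qed
    ultimately show "(norm z < outer_mod \<xi> \<longrightarrow> norm z < \<rho> z) \<and> (inner_mod \<xi> < norm z \<longrightarrow> \<rho> z < norm z)" by blast
  qed
qed

text \<open>Roots are assigned to the inner or the outer group by their index in the sorted list.
  If the middle moduli differ at the limit, the index determines the group. Otherwise only the two
  middle indices are ambiguous; they are exempt along the sequence by hypothesis, and the
  separation assumption keeps all other indices strictly away from the middle modulus.\<close>

lemma curve_sorted_open:
  assumes "x \<longlonglongrightarrow> \<xi>" "curve_sorted \<xi>"
    and dich: "inner_mod \<xi> < outer_mod \<xi> \<or> (\<xi> \<in> \<real> \<and> (\<forall>k. inner_mod (x k) = outer_mod (x k)))"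
  shows "\<exists>k. curve_sorted (x k)"
proof -
  obtain \<phi> L where \<phi>: "strict_mono (\<phi> :: nat \<Rightarrow> nat)" and L: "length L = 2 * m" "set L = set (roots \<xi>)"
    and lim: "\<And>j. j < 2 * m \<Longrightarrow> (\<lambda>k. roots (x (\<phi> k)) ! j) \<longlonglongrightarrow> L ! j"
    and nL: "\<And>j. j < 2 * m \<Longrightarrow> norm (L ! j) = norm (roots \<xi> ! j)"
    and N1l: "(\<lambda>k. inner_mod (x (\<phi> k))) \<longlonglongrightarrow> inner_mod \<xi>" and N2l: "(\<lambda>k. outer_mod (x (\<phi> k))) \<longlonglongrightarrow> outer_mod \<xi>"
    using roots_limit[OF assms(1)] by metis
  define good where "good k j \<longleftrightarrow> (let z = roots (x (\<phi> k)) ! j in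
      (norm z < outer_mod (x (\<phi> k)) \<longrightarrow> norm z < \<rho> z) \<and> (inner_mod (x (\<phi> k)) < norm z \<longrightarrow> \<rho> z < norm z))" for k j
  have Lroot: "L ! j \<noteq> 0 \<and> f (L ! j) = \<xi>" if "j < 2 * m" for j
    using that L set_roots nth_mem by metis
  have low: "\<forall>\<^sub>F k in sequentially. good k j" if j: "j < m" "norm (L ! j) < outer_mod \<xi>" for j
  proof -
    have j2: "j < 2 * m" using j by simp
    have "norm (L ! j) < \<rho> (L ! j)" using assms(2) Lroot[OF j2] j unfolding curve_sorted_def by blast
    then have "\<forall>\<^sub>F k in sequentially. norm (roots (x (\<phi> k)) ! j) < \<rho> (roots (x (\<phi> k)) ! j)"
      using eventually_less_of_tendsto[OF tendsto_norm[OF lim[OF j2]] tendsto_\<rho>[OF lim[OF j2]]] Lroot[OF j2] by blast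
    then show ?thesis
    proof (rule eventually_mono)
      fix k assume *: "norm (roots (x (\<phi> k)) ! j) < \<rho> (roots (x (\<phi> k)) ! j)"
      have "norm (roots (x (\<phi> k)) ! j) \<le> inner_mod (x (\<phi> k))" unfolding inner_mod_def using j by (intro roots_mono) auto
      then show "good k j" using * by (simp add: good_def Let_def)
    qed
  qed
  have high: "\<forall>\<^sub>F k in sequentially. good k j" if j: "m \<le> j" "j < 2 * m" "inner_mod \<xi> < norm (L ! j)" for j
  proof -
    have "\<rho> (L ! j) < norm (L ! j)" using assms(2) Lroot[OF j(2)] j unfolding curve_sorted_def by blast
    then have "\<forall>\<^sub>F k in sequentially. \<rho> (roots (x (\<phi> k)) ! j) < norm (roots (x (\<phi> k)) ! j)"
      using eventually_less_of_tendsto[OF tendsto_\<rho>[OF lim[OF j(2)]] tendsto_norm[OF lim[OF j(2)]]] Lroot[OF j(2)] by blast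
    then show ?thesis
    proof (rule eventually_mono)
      fix k assume *: "\<rho> (roots (x (\<phi> k)) ! j) < norm (roots (x (\<phi> k)) ! j)"
      have "outer_mod (x (\<phi> k)) \<le> norm (roots (x (\<phi> k)) ! j)" unfolding outer_mod_def using j by (intro roots_mono) auto
      then show "good k j" using * by (simp add: good_def Let_def)
    qed
  qed
  have "\<forall>\<^sub>F k in sequentially. good k j" if j: "j < 2 * m" for j
    using dich
  proof
    assume lt: "inner_mod \<xi> < outer_mod \<xi>"
    show ?thesis
    proof (cases "j < m")
      case True
      have "norm (L ! j) \<le> inner_mod \<xi>" unfolding nL[OF j] inner_mod_def using True by (intro roots_mono) auto
      then show ?thesis using low True lt by simp
    next
      case False
      have "outer_mod \<xi> \<le> norm (L ! j)" unfolding nL[OF j] outer_mod_def using False j by (intro roots_mono) auto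
      then show ?thesis using high False lt j by simp
    qed
  next
    assume eq: "\<xi> \<in> \<real> \<and> (\<forall>k. inner_mod (x k) = outer_mod (x k))"
    have eq': "inner_mod \<xi> = outer_mod \<xi>" using LIMSEQ_unique[OF N1l] N2l eq by simp
    consider "j = m - 1 \<or> j = m" | "j + 2 \<le> m" | "m + 1 \<le> j" by linarith
    then show ?thesis
    proof cases
      case 1
      then have "norm (roots (x (\<phi> k)) ! j) = inner_mod (x (\<phi> k))" "norm (roots (x (\<phi> k)) ! j) = outer_mod (x (\<phi> k))" for k
        using eq by (auto simp: inner_mod_def outer_mod_def)
      then show ?thesis by (simp add: good_def Let_def)
    next
      case 2
      have "norm (L ! j) \<le> norm (roots \<xi> ! (m - 2))" unfolding nL[OF j] using 2 by (intro roots_mono) auto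
      also have "\<dots> < outer_mod \<xi>" using separated_roots(1)[of \<xi>] eq eq' 2 by simp
      finally show ?thesis using low 2 by simp
    next
      case 3
      have "inner_mod \<xi> < norm (roots \<xi> ! (m + 1))" using separated_roots(2)[of \<xi>] eq eq' 3 j by simp
      also have "\<dots> \<le> norm (L ! j)" unfolding nL[OF j] using 3 j by (intro roots_mono) auto
      finally show ?thesis using high 3 j by simp
    qed
  qed
  then have "\<forall>\<^sub>F k in sequentially. \<forall>j\<in>{..<2*m}. good k j" by (intro eventually_ball_finite) auto
  then obtain k where k: "\<And>j. j < 2 * m \<Longrightarrow> good k j"
    by (auto simp: eventually_sequentially)
  have "curve_sorted (x (\<phi> k))" unfolding curve_sorted_def
  proof (intro allI impI)
    fix z assume "z \<noteq> 0" "f z = x (\<phi> k)"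
    then have "z \<in> set (roots (x (\<phi> k)))" by (simp add: set_roots)
    then obtain j where "j < 2 * m" "z = roots (x (\<phi> k)) ! j" by (metis in_set_conv_nth length_roots)
    then show "(norm z < outer_mod (x (\<phi> k)) \<longrightarrow> norm z < \<rho> z) \<and> (inner_mod (x (\<phi> k)) < norm z \<longrightarrow> \<rho> z < norm z)"
      using k unfolding good_def Let_def by blast
  qed
  then show ?thesis by blast
qed

end


context star_curve_symbol begin

definition \<gamma> :: "complex set" where "\<gamma> = {z. z \<noteq> 0 \<and> norm z = \<rho> z}"

lemma \<gamma>_image: "\<gamma> = (\<lambda>w. of_real (\<rho> w) * w) ` sphere 0 1"
proof (intro equalityI subsetI)
  fix z assume z: "z \<in> \<gamma>"
  then have "z \<noteq> 0" by (simp add: \<gamma>_def)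
  have "sgn z = of_real (1 / norm z) * z"
    by (simp add: sgn_div_norm scaleR_conv_of_real field_simps)
  then have "\<rho> (sgn z) = \<rho> z" using \<rho>_ray[of "1 / norm z" z] \<open>z \<noteq> 0\<close> by simp
  moreover have "\<rho> z \<noteq> 0" using \<rho>_pos[OF \<open>z \<noteq> 0\<close>] by simp
  ultimately have "z = of_real (\<rho> (sgn z)) * sgn z" using z
    by (simp add: \<gamma>_def sgn_div_norm scaleR_conv_of_real field_simps)
  moreover have "sgn z \<in> sphere 0 1" using \<open>z \<noteq> 0\<close> by (simp add: norm_sgn)
  ultimately show "z \<in> (\<lambda>w. of_real (\<rho> w) * w) ` sphere 0 1" by blast
next
  fix z assume "z \<in> (\<lambda>w. of_real (\<rho> w) * w) ` sphere 0 1"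
  then obtain w where w: "norm w = 1" "z = of_real (\<rho> w) * w" by auto
  then have "\<rho> w > 0" by (intro \<rho>_pos) auto
  then show "z \<in> \<gamma>" using w \<rho>_ray[of "\<rho> w" w] by (auto simp: \<gamma>_def norm_mult)
qed

lemma cont_\<rho>_sphere: "continuous_on (sphere 0 1) \<rho>"
  by (rule continuous_on_subset[OF cont_\<rho>]) auto

lemma compact_\<gamma>: "compact \<gamma>" and connected_\<gamma>: "connected \<gamma>" and \<gamma>_nonempty: "\<gamma> \<noteq> {}"
proof -
  have c: "continuous_on (sphere 0 1) (\<lambda>w. of_real (\<rho> w) * w)"
    by (intro continuous_intros cont_\<rho>_sphere)
  show "compact \<gamma>" unfolding \<gamma>_image by (intro compact_continuous_image c) auto
  show "connected \<gamma>" unfolding \<gamma>_image by (intro connected_continuous_image c connected_sphere) auto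
  show "\<gamma> \<noteq> {}" unfolding \<gamma>_image by simp
qed

lemma f_\<gamma>: "compact (f ` \<gamma>)" "connected (f ` \<gamma>)" "f ` \<gamma> \<subseteq> \<real>"
proof -
  have c: "continuous_on \<gamma> f" by (rule continuous_on_subset[OF continuous_f]) (auto simp: \<gamma>_def)
  show "compact (f ` \<gamma>)" "connected (f ` \<gamma>)"
    using compact_\<gamma> connected_\<gamma> c by (auto intro: compact_continuous_image connected_continuous_image)
  show "f ` \<gamma> \<subseteq> \<real>" using on_curve(1) by (auto simp: \<gamma>_def)
qed

lemma middle_moduli_eq_iff:
  assumes "\<xi> \<in> \<real>" shows "inner_mod \<xi> = outer_mod \<xi> \<longleftrightarrow> \<xi> \<in> f ` \<gamma>"
proof
  assume "inner_mod \<xi> = outer_mod \<xi>"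
  from middle_on_curve[OF assms this, of "roots \<xi> ! m"] show "\<xi> \<in> f ` \<gamma>"
    unfolding \<gamma>_def by (intro image_eqI[of _ _ "roots \<xi> ! m"]) auto
next
  assume "\<xi> \<in> f ` \<gamma>" then show "inner_mod \<xi> = outer_mod \<xi>" using on_curve by (auto simp: \<gamma>_def)
qed

lemma \<rho>_bounds: obtains lo hi where "lo > 0" "hi > 0" "\<And>z. z \<noteq> 0 \<Longrightarrow> lo \<le> \<rho> z" "\<And>z. z \<noteq> 0 \<Longrightarrow> \<rho> z \<le> hi"
proof -
  have sg: "\<rho> (sgn z) = \<rho> z" "sgn z \<in> sphere 0 1" if "z \<noteq> 0" for z
    using \<rho>_ray[of "1 / norm z" z] that by (auto simp: sgn_div_norm scaleR_conv_of_real field_simps norm_divide)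
  have ne: "compact (sphere (0::complex) 1)" "sphere (0::complex) 1 \<noteq> {}" by auto
  obtain u where u: "u \<in> sphere 0 1" "\<And>y. y \<in> sphere 0 1 \<Longrightarrow> \<rho> u \<le> \<rho> y"
    using continuous_attains_inf[OF ne cont_\<rho>_sphere] by blast
  obtain v where v: "v \<in> sphere 0 1" "\<And>y. y \<in> sphere 0 1 \<Longrightarrow> \<rho> y \<le> \<rho> v"
    using continuous_attains_sup[OF ne cont_\<rho>_sphere] by blast
  have "\<rho> u > 0" "\<rho> v > 0" using u(1) v(1) by (auto intro!: \<rho>_pos)
  then show ?thesis using that[of "\<rho> u" "\<rho> v"] u(2) v(2) sg by metis
qed

lemma curve_sorted_at_infinity: obtains R where "R > 0" "\<And>\<xi>. norm \<xi> \<ge> R \<Longrightarrow> inner_mod \<xi> < outer_mod \<xi>" "\<And>\<xi>. norm \<xi> \<ge> R \<Longrightarrow> curve_sorted \<xi>"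
proof -
  obtain lo hi where b: "lo > 0" "hi > 0" "\<And>z. z \<noteq> 0 \<Longrightarrow> lo \<le> \<rho> z" "\<And>z. z \<noteq> 0 \<Longrightarrow> \<rho> z \<le> hi"
    using \<rho>_bounds by blast
  obtain R where R: "R > 0" "\<And>\<xi>. norm \<xi> \<ge> R \<Longrightarrow> inner_mod \<xi> < lo" "\<And>\<xi>. norm \<xi> \<ge> R \<Longrightarrow> outer_mod \<xi> > hi"
    using roots_at_infinity[OF b(1,2)] by blast
  have "lo \<le> hi" using b(3,4)[of 1] by simp
  have "inner_mod \<xi> < outer_mod \<xi>" if "norm \<xi> \<ge> R" for \<xi>
    using R(2,3)[OF that] \<open>lo \<le> hi\<close> by linarith
  moreover have "curve_sorted \<xi>" if "norm \<xi> \<ge> R" for \<xi>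
    unfolding curve_sorted_def
  proof (intro allI impI conjI)
    fix z assume z: "z \<noteq> 0" "f z = \<xi>"
    show "norm z < \<rho> z" if "norm z < outer_mod \<xi>"
      using root_below_outer[OF z that] R(2)[OF \<open>norm \<xi> \<ge> R\<close>] b(3)[OF z(1)] by linarith
    show "\<rho> z < norm z" if "inner_mod \<xi> < norm z"
      using root_above_inner[OF z that] R(3)[OF \<open>norm \<xi> \<ge> R\<close>] b(4)[OF z(1)] by linarith
  qed
  ultimately show ?thesis using that R(1) by blast
qed

text \<open>The set $f(\gamma)$ is an interval, so a real level off it can be moved to plus or
  minus infinity without meeting it.\<close>

lemma curve_sorted_real_off:
  fixes t :: real
  assumes "of_real t \<notin> f ` \<gamma>"
  shows "curve_sorted (of_real t)"
proof -
  obtain R where R: "R > 0" "\<And>\<xi>. norm \<xi> \<ge> R \<Longrightarrow> curve_sorted \<xi>" using curve_sorted_at_infinity by metis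
  define T where "T = Re ` f ` \<gamma>"
  have Tf: "of_real s \<in> f ` \<gamma> \<Longrightarrow> s \<in> T" for s
    unfolding T_def by (rule image_eqI[of _ _ "of_real s"]) auto
  have fT: "s \<in> T \<Longrightarrow> of_real s \<in> f ` \<gamma>" for s using f_\<gamma>(3) by (auto simp: T_def)
  have "connected T" unfolding T_def by (intro connected_continuous_image f_\<gamma> continuous_intros)
  then have conn: "\<And>x y z. x \<in> T \<Longrightarrow> y \<in> T \<Longrightarrow> x \<le> z \<Longrightarrow> z \<le> y \<Longrightarrow> z \<in> T"
    unfolding connected_iff_interval by blast
  have "t \<notin> T" using assms fT by blast
  have main: "curve_sorted (of_real t)" if "is_interval I" "t \<in> I" "s \<in> I" "\<bar>s\<bar> \<ge> R" "I \<inter> T = {}" for I :: "real set" and s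
  proof (rule connected_sequential_induct[of "of_real ` I" "of_real s" curve_sorted])
    show "connected (of_real ` I :: complex set)"
      by (intro connected_continuous_image continuous_intros is_interval_connected that(1))
    show "curve_sorted (of_real s)" using R(2) that(4) by simp
    show "curve_sorted l" if "x \<longlonglongrightarrow> l" "\<And>k. curve_sorted (x k)" for x l using curve_sorted_closed that by blast
    show "\<exists>k. curve_sorted (x k)" if "l \<in> of_real ` I" "x \<longlonglongrightarrow> l" "curve_sorted l" for x l
    proof (rule curve_sorted_open[OF that(2,3)])
      have "l \<in> of_real ` I" by (rule that(1))
      then obtain u where "u \<in> I" "l = of_real u" by (rule imageE)
      have "l \<notin> f ` \<gamma>"
      proof
        assume "l \<in> f ` \<gamma>"
        then have "u \<in> T" using Tf[of u] \<open>l = of_real u\<close> by simp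
        then show False using \<open>u \<in> I\<close> \<open>I \<inter> T = {}\<close> by blast
      qed
      moreover have "l \<in> \<real>" using that(1) by auto
      ultimately have "inner_mod l \<noteq> outer_mod l" using middle_moduli_eq_iff by blast
      then show "inner_mod l < outer_mod l \<or> (l \<in> \<real> \<and> (\<forall>k. inner_mod (x k) = outer_mod (x k)))" using inner_le_outer_mod[of l] by linarith
    qed
  qed (use that in auto)
  show ?thesis
  proof (cases "\<exists>s\<in>T. s \<ge> t")
    case True
    then obtain s where s: "s \<in> T" "s \<ge> t" by blast
    have "u \<notin> T" if "u \<le> t" for u
      using conn[OF _ s(1) that s(2)] \<open>t \<notin> T\<close> by blast
    then have "{..t} \<inter> T = {}" by auto
    then show ?thesis using main[of "{..t}" "min t (- R)"] R(1) by (auto simp: is_interval_ic)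
  next
    case False
    then have "{t..} \<inter> T = {}" by fastforce
    then show ?thesis using main[of "{t..}" "max t R"] R(1) by (auto simp: is_interval_ci)
  qed
qed

text \<open>The largest value of $f$ on the curve is a limit of larger levels, which are covered
  already; from there the property spreads over the connected set $f(\gamma)$.\<close>

lemma curve_sorted_real:
  assumes "\<xi> \<in> \<real>" shows "curve_sorted \<xi>"
proof (cases "\<xi> \<in> f ` \<gamma>")
  case False
  then show ?thesis using curve_sorted_real_off assms by (metis Reals_cases)
next
  case True
  define T where "T = Re ` f ` \<gamma>"
  have fT: "s \<in> T \<Longrightarrow> of_real s \<in> f ` \<gamma>" for s using f_\<gamma>(3) by (auto simp: T_def)
  have "compact T" unfolding T_def by (intro compact_continuous_image f_\<gamma> continuous_intros)
  moreover have "T \<noteq> {}" using \<gamma>_nonempty by (simp add: T_def)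
  ultimately have "\<exists>s\<in>T. \<forall>t\<in>T. t \<le> s" by (rule compact_attains_sup)
  then obtain s where s: "s \<in> T" "\<And>t. t \<in> T \<Longrightarrow> t \<le> s" by blast
  \<comment> \<open>Levels above the maximum are off the curve values, and they tend to
    it.\<close>
  define y where "y k = complex_of_real (s + 1 / real (Suc k))" for k
  have "(\<lambda>k. 1 / real (Suc k)) \<longlonglongrightarrow> 0" by (rule LIMSEQ_Suc[OF lim_1_over_n])
  then have "(\<lambda>k. complex_of_real (s + 1 / real (Suc k))) \<longlonglongrightarrow> of_real (s + 0)" by (intro tendsto_intros)
  moreover have "curve_sorted (complex_of_real (s + 1 / real (Suc k)))" for k
  proof (rule curve_sorted_real_off)
    show "complex_of_real (s + 1 / real (Suc k)) \<notin> f ` \<gamma>"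
    proof
      assume "complex_of_real (s + 1 / real (Suc k)) \<in> f ` \<gamma>"
      then have "Re (complex_of_real (s + 1 / real (Suc k))) \<in> T" unfolding T_def by (rule imageI)
      then show False using s(2) by (force simp: not_le)
    qed
  qed
  ultimately have Ks: "curve_sorted (of_real s)" using curve_sorted_closed by fastforce
  show ?thesis
  proof (rule connected_sequential_induct[of "f ` \<gamma>" "of_real s" curve_sorted])
    show "curve_sorted l" if "x \<longlonglongrightarrow> l" "\<And>k. curve_sorted (x k)" for x l using curve_sorted_closed that by blast
    show "\<exists>k. curve_sorted (x k)" if "\<And>k. x k \<in> f ` \<gamma>" "l \<in> f ` \<gamma>" "x \<longlonglongrightarrow> l" "curve_sorted l" for x l
    proof (rule curve_sorted_open[OF that(3,4)])
      have "inner_mod (x k) = outer_mod (x k)" for k using middle_moduli_eq_iff[of "x k"] that(1) f_\<gamma>(3) by blast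
      then show "inner_mod l < outer_mod l \<or> (l \<in> \<real> \<and> (\<forall>k. inner_mod (x k) = outer_mod (x k)))" using that(2) f_\<gamma>(3) by blast
    qed
  qed (use f_\<gamma> Ks fT[OF s(1)] True in auto)
qed

lemma real_level_inside_le_outside:
  assumes "\<xi> \<in> \<real>" "z \<noteq> 0" "f z = \<xi>" "norm z \<le> \<rho> z" "w \<noteq> 0" "f w = \<xi>" "\<rho> w \<le> norm w"
  shows "norm z \<le> norm w"
proof -
  have "norm z \<le> inner_mod \<xi>" using curve_sorted_real[OF assms(1)] assms(2-4) unfolding curve_sorted_def by force
  moreover have "outer_mod \<xi> \<le> norm w" using curve_sorted_real[OF assms(1)] assms(5-7) unfolding curve_sorted_def by force
  ultimately show ?thesis using inner_le_outer_mod[of \<xi>] by linarith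
qed

text \<open>Under a rotational symmetry of $f$ a point $y$ of the curve and its rotation $c y$ are
  roots of the same level with the same modulus. By separation only the two middle roots have this
  modulus, so $c y$ is on the curve too; the curve is invariant and the rotation preserves its
  outside.\<close>

lemma rotation_symmetry_preserves_outside:
  assumes c: "norm c = 1" and sym: "\<And>w. w \<noteq> 0 \<Longrightarrow> f (c * w) = f w"
    and w: "w \<noteq> 0" "\<rho> w < norm w"
  shows "\<rho> (c * w) < norm (c * w)"
proof -
  define t where "t = \<rho> w / norm w"
  have t: "0 < t" "t < 1" using w \<rho>_pos[OF w(1)] by (auto simp: t_def)
  define y where "y = of_real t * w"
  have y: "y \<noteq> 0" "norm y = \<rho> y" using t w \<rho>_ray[OF t(1), of w] by (auto simp: y_def norm_mult) (simp add: t_def)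
  define \<xi> where "\<xi> = f y"
  have \<xi>: "\<xi> \<in> \<real>" "inner_mod \<xi> = norm y" "outer_mod \<xi> = norm y" using on_curve[OF y] by (auto simp: \<xi>_def)
  have nz: "c * y \<noteq> 0" using c y(1) by auto
  then have "c * y \<in> set (roots \<xi>)" using sym[OF y(1)] by (simp add: set_roots \<xi>_def)
  then obtain j where j: "j < 2 * m" "c * y = roots \<xi> ! j" by (metis in_set_conv_nth length_roots)
  have "j = m - 1 \<or> j = m"
  proof (rule ccontr)
    assume n: "\<not> ?thesis"
    have nj: "norm (roots \<xi> ! j) = norm y" using j c by (metis mult_1 norm_mult)
    consider "j + 2 \<le> m" | "m + 1 \<le> j" using n by linarith
    then show False
    proof cases
      case 1
      have "norm (roots \<xi> ! j) \<le> norm (roots \<xi> ! (m - 2))" using 1 by (intro roots_mono) auto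
      then show False using separated_roots(1)[of \<xi>] \<xi> nj 1 by simp
    next
      case 2
      have "norm (roots \<xi> ! (m + 1)) \<le> norm (roots \<xi> ! j)" using 2 j by (intro roots_mono) auto
      then show False using separated_roots(2)[of \<xi>] \<xi> nj 2 j by simp
    qed
  qed
  then have "norm (c * y) = \<rho> (c * y)" using middle_on_curve(2)[OF \<xi>(1), of "c * y"] \<xi> j by auto
  moreover have "\<rho> (c * y) = \<rho> (c * w)" using \<rho>_ray[OF t(1), of "c * w"] by (simp add: y_def mult_ac)
  ultimately have "\<rho> (c * w) = t * norm w" using c t by (simp add: norm_mult y_def)
  then show ?thesis using c t w by (simp add: norm_mult mult_less_cancel_right2)
qed

end


section \<open>Non-real levels\<close>

lemma uniform_limit_finite_sum:
  fixes g :: "'i \<Rightarrow> 'b \<Rightarrow> 'c \<Rightarrow> 'd::real_normed_vector"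
  assumes "finite I" "\<And>k. k \<in> I \<Longrightarrow> uniform_limit A (g k) (h k) F"
  shows "uniform_limit A (\<lambda>n w. \<Sum>k\<in>I. g k n w) (\<lambda>w. \<Sum>k\<in>I. h k w) F"
  using assms by (induction I rule: finite_induct) (auto intro!: uniform_limit_add uniform_limit_const)

context star_curve_symbol begin

text \<open>Locally uniform dependence of $f(cw) - f(w)$ on the factor $c$, as needed for Hurwitz'
  theorem.\<close>

lemma uniform_limit_dilation:
  assumes c: "c \<longlonglongrightarrow> c0" "c0 \<noteq> 0" "\<And>n. c n \<noteq> 0" and A: "compact A" "0 \<notin> A"
  shows "uniform_limit A (\<lambda>n w. f (c n * w) - f w) (\<lambda>w. f (c0 * w) - f w) sequentially"
proof -
  have bd: "bounded ((\<lambda>w. of_real (a k) * w powi (- k)) ` A)" for k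
    by (intro compact_imp_bounded compact_continuous_image A continuous_intros) (use A in auto)
  have cl: "(\<lambda>n. c n powi (- k)) \<longlonglongrightarrow> c0 powi (- k)" for k
    using c by (intro tendsto_intros) auto
  have "uniform_limit A (\<lambda>n w. c n powi (- k) * (of_real (a k) * w powi (- k)))
     (\<lambda>w. c0 powi (- k) * (of_real (a k) * w powi (- k))) sequentially" for k
  proof (rule uniform_lim_mult)
    show "uniform_limit A (\<lambda>n w. c n powi (- k)) (\<lambda>w. c0 powi (- k)) sequentially"
      using cl[of k] unfolding uniform_limit_iff tendsto_iff by (auto elim: eventually_mono)
  qed (use bd in \<open>auto simp: uniform_limit_const image_constant_conv\<close>)
  then have "uniform_limit A (\<lambda>n w. \<Sum>k=-int m..int m. c n powi (- k) * (of_real (a k) * w powi (- k)))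
     (\<lambda>w. \<Sum>k=-int m..int m. c0 powi (- k) * (of_real (a k) * w powi (- k))) sequentially"
    by (intro uniform_limit_finite_sum) auto
  then have "uniform_limit A (\<lambda>n w. (\<Sum>k=-int m..int m. c n powi (- k) * (of_real (a k) * w powi (- k))) - f w)
     (\<lambda>w. (\<Sum>k=-int m..int m. c0 powi (- k) * (of_real (a k) * w powi (- k))) - f w) sequentially"
    by (intro uniform_limit_minus uniform_limit_const)
  then show ?thesis by (simp add: laurent_def power_int_mult_distrib mult_ac)
qed

lemma holomorphic_f: "f holomorphic_on (- {0})"
  unfolding laurent_def by (intro holomorphic_intros) auto

text \<open>The identity theorem for polynomials, followed by a comparison of leading
  coefficients, which gives $c^m = 1$.\<close>

lemma invariant_dilation_is_rotation:
  assumes "c \<noteq> 0" "e > 0" "w0 \<noteq> 0" and inv: "\<And>w. w \<in> ball w0 e \<Longrightarrow> w \<noteq> 0 \<Longrightarrow> f (c * w) = f w"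
  shows "norm c = 1" "\<And>w. w \<noteq> 0 \<Longrightarrow> f (c * w) = f w"
proof -
  define q where "q = pcompose (P 0) [:0, c:] - Polynomial.smult (c ^ m) (P 0)"
  have pq: "poly q w = c ^ m * w ^ m * (f (c * w) - f w)" if "w \<noteq> 0" for w
    using that assms(1) by (simp add: q_def poly_pcompose poly_shifted_poly algebra_simps power_mult_distrib)
  have "infinite (ball w0 e - {0})" using uncountable_infinite[OF uncountable_ball[OF assms(2), of w0]] by simp
  moreover have "ball w0 e - {0} \<subseteq> {w. poly q w = 0}" using inv pq by auto
  ultimately have "q = 0" using poly_roots_finite finite_subset by blast
  then show "f (c * w) = f w" if "w \<noteq> 0" for w using pq[OF that] that assms(1) by simp
  have "coeff (pcompose (P 0) [:0, c:]) (2 * m) = c ^ (2 * m) * of_real (a (- int m))"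
    by (simp add: coeff_pcompose_linear coeff_shifted_poly)
  moreover have "coeff (Polynomial.smult (c ^ m) (P 0)) (2 * m) = c ^ m * of_real (a (- int m))"
    by (simp add: coeff_shifted_poly)
  moreover have "coeff q (2 * m) = 0" using \<open>q = 0\<close> by simp
  ultimately have "c ^ (2 * m) * complex_of_real (a (- int m)) = c ^ m * of_real (a (- int m))"
    unfolding q_def coeff_diff by simp
  then have "c ^ (2 * m) = c ^ m" using a_bot by simp
  then have "c ^ m = 1" using assms(1) by (simp add: mult_2 power_add)
  then show "norm c = 1" using m_pos by (metis norm_one norm_power power_eq_1_iff norm_ge_zero not_one_le_zero)
qed

text \<open>The maximum principle for the ratio of a root inside to a root outside the curve,
  without choosing local branches of the roots: near a pair of maximal ratio $c$ the zeros $w$ of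
  $f(c'w) - f(w)$ for $|c'| > |c|$ would give pairs of larger ratio.\<close>

lemma nonreal_inside_less_outside:
  assumes z: "z1 \<noteq> 0" "norm z1 < \<rho> z1" and w: "w1 \<noteq> 0" "\<rho> w1 < norm w1"
    and eq: "f z1 = f w1" and nonreal: "f z1 \<notin> \<real>"
  shows "norm z1 < norm w1"
proof (rule ccontr)
  assume "\<not> norm z1 < norm w1"
  then have le1: "norm w1 \<le> norm z1" by simp
  obtain lo hi where b: "lo > 0" "hi > 0" "\<And>z. z \<noteq> 0 \<Longrightarrow> lo \<le> \<rho> z" "\<And>z. z \<noteq> 0 \<Longrightarrow> \<rho> z \<le> hi"
    using \<rho>_bounds by blast
  define A where "A = cball (0::complex) hi - ball 0 lo"
  have A0: "z \<noteq> 0" if "z \<in> A" for z using that b(1) by (auto simp: A_def)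
  have cA: "compact A" unfolding A_def by (intro compact_diff compact_cball open_ball)
  have subA: "A \<subseteq> - {0}" using A0 by auto
  have cf1: "continuous_on (A \<times> A) (\<lambda>p. f (fst p))" and cf2: "continuous_on (A \<times> A) (\<lambda>p. f (snd p))"
    and c\<rho>1: "continuous_on (A \<times> A) (\<lambda>p. \<rho> (fst p))" and c\<rho>2: "continuous_on (A \<times> A) (\<lambda>p. \<rho> (snd p))"
    by (rule continuous_on_compose2[OF continuous_f] continuous_on_compose2[OF cont_\<rho>]; use A0 in \<open>force intro!: continuous_intros\<close>)+
  define T where "T = {p \<in> A \<times> A. f (fst p) = f (snd p) \<and> norm (fst p) \<le> \<rho> (fst p) \<and>
     \<rho> (snd p) \<le> norm (snd p) \<and> norm (snd p) \<le> norm (fst p)}"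
  \<comment> \<open>An inside point that is not smaller than an outside point is confined,
    together with it, to the annulus between the extreme radii; this makes the set of pairs
    compact.\<close>
  have inT: "(z, w) \<in> T" if "z \<noteq> 0" "w \<noteq> 0" "f z = f w" "norm z \<le> \<rho> z" "\<rho> w \<le> norm w" "norm w \<le> norm z" for z w
    using that b(3)[of w] b(4)[of z] by (auto simp: T_def A_def)
  have cAA: "compact (A \<times> A)" by (intro compact_Times cA)
  have clAA: "closed (A \<times> A)" using cAA compact_imp_closed by blast
  have T_alt: "T = {p \<in> A \<times> A. f (fst p) = f (snd p)} \<inter> {p \<in> A \<times> A. norm (fst p) \<le> \<rho> (fst p)} \<inter>
     {p \<in> A \<times> A. \<rho> (snd p) \<le> norm (snd p)} \<inter> {p \<in> A \<times> A. norm (snd p) \<le> norm (fst p)}"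
    by (auto simp: T_def)
  have "closed {p \<in> A \<times> A. f (fst p) - f (snd p) = 0}"
    by (intro continuous_closed_preimage_constant continuous_intros cf1 cf2 clAA)
  then have "closed T" unfolding T_alt
    by (intro closed_Int continuous_on_closed_Collect_le continuous_intros c\<rho>1 c\<rho>2 clAA) simp
  then have "compact T" using cAA compact_Int_closed[of "A \<times> A" T] by (simp add: T_def Int_absorb1 subset_iff Collect_conj_eq[symmetric])
  moreover have T1: "(z1, w1) \<in> T" using inT z w eq le1 by simp
  moreover have "continuous_on T (\<lambda>p. norm (fst p) / norm (snd p))"
    by (intro continuous_intros) (use A0 in \<open>auto simp: T_def\<close>)
  ultimately obtain p where p: "p \<in> T" "\<And>q. q \<in> T \<Longrightarrow> norm (fst q) / norm (snd q) \<le> norm (fst p) / norm (snd p)"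
    using continuous_attains_sup[of T "\<lambda>p. norm (fst p) / norm (snd p)"] by blast
  \<comment> \<open>If the maximum is attained at a real level, it equals 1 and is attained by the
    given pair as well.\<close>
  have "\<exists>z w. (z, w) \<in> T \<and> f z \<notin> \<real> \<and> (\<forall>q\<in>T. norm (fst q) / norm (snd q) \<le> norm z / norm w)"
  proof (cases "f (fst p) \<in> \<real>")
    case False
    then show ?thesis using p by (metis prod.collapse)
  next
    case True
    have pp: "fst p \<noteq> 0" "snd p \<noteq> 0" "f (snd p) = f (fst p)" "norm (fst p) \<le> \<rho> (fst p)" "\<rho> (snd p) \<le> norm (snd p)"
      using p(1) A0 by (auto simp: T_def)
    have "norm (fst p) \<le> norm (snd p)"
      by (rule real_level_inside_le_outside[OF True pp(1) refl pp(4) pp(2,3,5)])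
    then have "norm (fst p) / norm (snd p) \<le> 1" using pp by simp
    also have "1 \<le> norm z1 / norm w1" using le1 w(1) by simp
    finally have "\<forall>q\<in>T. norm (fst q) / norm (snd q) \<le> norm z1 / norm w1" using p(2) by force
    then show ?thesis using T1 nonreal by blast
  qed
  then obtain z0 w0 where zw: "(z0, w0) \<in> T" "f z0 \<notin> \<real>"
    and max: "\<And>z w. (z, w) \<in> T \<Longrightarrow> norm z / norm w \<le> norm z0 / norm w0" by fastforce
  have nz: "z0 \<noteq> 0" "w0 \<noteq> 0" and feq: "f z0 = f w0" and "norm w0 \<le> norm z0"
    and "norm z0 \<le> \<rho> z0" "\<rho> w0 \<le> norm w0" using zw A0 by (auto simp: T_def)
  then have z0in: "norm z0 < \<rho> z0" and w0out: "\<rho> w0 < norm w0"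
    using on_curve(1)[OF nz(1)] on_curve(1)[OF nz(2)] zw(2) by (force simp: less_le)+
  define c0 where "c0 = z0 / w0"
  have c0: "c0 \<noteq> 0" "c0 * w0 = z0" "norm c0 = norm z0 / norm w0" using nz by (auto simp: c0_def norm_divide)
  have "norm c0 \<ge> 1" using \<open>norm w0 \<le> norm z0\<close> nz c0(3) by simp
  \<comment> \<open>The factors tend to the maximal ratio from above.\<close>
  define c where "c n = c0 * of_real (1 + 1 / real (Suc n))" for n
  have cpos: "1 + 1 / real (Suc n) > 0" for n by (simp add: add_pos_pos)
  have cnz: "c n \<noteq> 0" for n using c0(1) cpos[of n] unfolding c_def by (simp del: of_real_add of_real_divide)
  have cnorm: "norm (c n) > norm c0" for n
    using c0(1) by (simp add: c_def norm_mult del: of_real_add of_real_divide)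
  have "(\<lambda>n. 1 / real (Suc n)) \<longlonglongrightarrow> 0" by (rule LIMSEQ_Suc[OF lim_1_over_n])
  then have "(\<lambda>n. c0 * of_real (1 + 1 / real (Suc n))) \<longlonglongrightarrow> c0 * of_real (1 + 0)" by (intro tendsto_intros)
  then have clim: "c \<longlonglongrightarrow> c0" by (simp add: c_def[abs_def])
  have notconst: "\<not> (\<forall>w\<in>ball w0 e. w \<noteq> 0 \<longrightarrow> f (c0 * w) = f w)" if "e > 0" for e
  proof
    assume *: "\<forall>w\<in>ball w0 e. w \<noteq> 0 \<longrightarrow> f (c0 * w) = f w"
    have "norm c0 = 1" "\<And>w. w \<noteq> 0 \<Longrightarrow> f (c0 * w) = f w"
      using invariant_dilation_is_rotation[OF c0(1) that nz(2)] * by blast+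
    from rotation_symmetry_preserves_outside[OF this nz(2) w0out] show False using z0in c0(2) by simp
  qed
  have "\<forall>\<^sub>F n in sequentially. \<exists>w\<in>ball w0 e - {0}. f (c n * w) = f w" if "e > 0" for e
  proof (rule ccontr)
    assume "\<not> ?thesis"
    then have fr: "\<exists>\<^sub>F n in sequentially. \<forall>w\<in>ball w0 e - {0}. f (c n * w) \<noteq> f w"
      by (simp add: frequently_def)
    from frequently_subseq[OF fr] obtain \<psi> :: "nat \<Rightarrow> nat"
      where \<psi>: "strict_mono \<psi>" "\<And>n. \<forall>w\<in>ball w0 e - {0}. f (c (\<psi> n) * w) \<noteq> f w" by blast
    define e' where "e' = min e (norm w0)"
    have e': "e' > 0" using that nz by (simp add: e'_def)
    have sub: "w \<noteq> 0" "w \<in> ball w0 e - {0}" if "w \<in> ball w0 e'" for w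
      using that by (auto simp: e'_def dist_norm)
    have zn: "0 \<notin> ball w0 e'" using sub(1) by blast
    have "(\<lambda>w. f (c0 * w) - f w) w0 \<noteq> 0"
    proof (rule Hurwitz_no_zeros[of "ball w0 e'" "\<lambda>n w. f (c (\<psi> n) * w) - f w" "\<lambda>w. f (c0 * w) - f w" w0])
      have hol: "(\<lambda>w. f (d * w) - f w) holomorphic_on ball w0 e'" if "d \<noteq> 0" for d
        by (intro holomorphic_intros holomorphic_on_compose_gen[OF _ holomorphic_f, unfolded o_def] holomorphic_on_subset[OF holomorphic_f])
           (use that zn in auto)
      show "(\<lambda>w. f (c (\<psi> n) * w) - f w) holomorphic_on ball w0 e'" for n using hol cnz by blast
      show "(\<lambda>w. f (c0 * w) - f w) holomorphic_on ball w0 e'" using hol c0(1) by blast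
      show "uniform_limit D (\<lambda>n w. f (c (\<psi> n) * w) - f w) (\<lambda>w. f (c0 * w) - f w) sequentially"
        if "compact D" "D \<subseteq> ball w0 e'" for D
        by (rule uniform_limit_dilation) (use LIMSEQ_subseq_LIMSEQ[OF clim \<psi>(1)] c0(1) cnz that zn in \<open>auto simp: o_def\<close>)
      show "\<not> (\<lambda>w. f (c0 * w) - f w) constant_on ball w0 e'"
      proof
        assume "(\<lambda>w. f (c0 * w) - f w) constant_on ball w0 e'"
        then have "f (c0 * w) - f w = f (c0 * w0) - f w0" if "w \<in> ball w0 e'" for w
          using that e' unfolding constant_on_def by (metis centre_in_ball)
        then show False using notconst[OF e'] feq c0(2) by simp
      qed
    qed (use \<psi>(2) sub e' in auto)
    then show False using feq c0(2) by simp
  qed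
  then have "\<exists>n w. n \<ge> k \<and> w \<noteq> 0 \<and> dist w0 w < 1 / real (Suc k) \<and> f (c n * w) = f w" for k
  proof -
    have "\<forall>\<^sub>F n in sequentially. k \<le> n \<and> (\<exists>w\<in>ball w0 (1 / real (Suc k)) - {0}. f (c n * w) = f w)"
      using eventually_conj[OF eventually_ge_at_top[of k] \<open>\<And>e. 0 < e \<Longrightarrow> \<forall>\<^sub>F n in sequentially. \<exists>w\<in>ball w0 e - {0}. f (c n * w) = f w\<close>[of "1 / real (Suc k)"]]
      by simp
    then show ?thesis using eventually_happens'[OF sequentially_bot] by fastforce
  qed
  then obtain N W where NW: "\<And>k. N k \<ge> k" "\<And>k. W k \<noteq> 0" "\<And>k. dist w0 (W k) < 1 / real (Suc k)" "\<And>k. f (c (N k) * W k) = f (W k)"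
    by metis
  have "W \<longlonglongrightarrow> w0"
  proof (rule metric_tendsto_imp_tendsto[of "\<lambda>k. 1 / real (Suc k)" 0])
    show "(\<lambda>k. 1 / real (Suc k)) \<longlonglongrightarrow> 0" by (rule LIMSEQ_Suc[OF lim_1_over_n])
    show "\<forall>\<^sub>F k in sequentially. dist (W k) w0 \<le> dist (1 / real (Suc k)) 0"
      using NW(3) by (intro always_eventually allI) (simp add: dist_commute less_imp_le)
  qed
  moreover have "filterlim N at_top sequentially"
    by (rule filterlim_at_top_mono[OF filterlim_ident]) (use NW(1) in auto)
  then have "(\<lambda>k. c (N k)) \<longlonglongrightarrow> c0" using filterlim_compose[OF clim] by blast
  ultimately have "(\<lambda>k. c (N k) * W k) \<longlonglongrightarrow> c0 * w0" by (intro tendsto_intros)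
  then have Zl: "(\<lambda>k. c (N k) * W k) \<longlonglongrightarrow> z0" using c0(2) by simp
  have "\<forall>\<^sub>F k in sequentially. norm (c (N k) * W k) < \<rho> (c (N k) * W k)"
    by (rule eventually_less_of_tendsto[OF tendsto_norm[OF Zl] tendsto_\<rho>[OF Zl nz(1)] z0in])
  moreover have "\<forall>\<^sub>F k in sequentially. \<rho> (W k) < norm (W k)"
    by (rule eventually_less_of_tendsto[OF tendsto_\<rho>[OF \<open>W \<longlonglongrightarrow> w0\<close> nz(2)] tendsto_norm[OF \<open>W \<longlonglongrightarrow> w0\<close>] w0out])
  ultimately have "\<forall>\<^sub>F k in sequentially. norm (c (N k) * W k) < \<rho> (c (N k) * W k) \<and> \<rho> (W k) < norm (W k)"
    by (rule eventually_conj)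
  then obtain k where k: "norm (c (N k) * W k) < \<rho> (c (N k) * W k)" "\<rho> (W k) < norm (W k)"
    using eventually_happens'[OF sequentially_bot] by blast
  have c1: "norm (c (N k)) > 1" using cnorm[of "N k"] \<open>norm c0 \<ge> 1\<close> by linarith
  have "(c (N k) * W k, W k) \<in> T"
    by (rule inT) (use k NW(2,4) cnz c1 in \<open>auto simp: norm_mult mult_le_cancel_right1\<close>)
  from max[OF this] have "norm (c (N k)) \<le> norm c0" using NW(2)[of k] c0(3) by (simp add: norm_mult)
  then show False using cnorm[of "N k"] by simp
qed

text \<open>Continuation from infinity along the ray through the level, which stays off the real
  line. The limit keeps the first $m$ roots inside and the others outside, and then their moduli
  are strictly ordered.\<close>

lemma nonreal_separation:
  assumes "\<xi> \<notin> \<real>"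
  shows "inner_mod \<xi> < outer_mod \<xi>"
proof -
  obtain R where R: "R > 0" "\<And>\<xi>. norm \<xi> \<ge> R \<Longrightarrow> inner_mod \<xi> < outer_mod \<xi>" "\<And>\<xi>. norm \<xi> \<ge> R \<Longrightarrow> curve_sorted \<xi>"
    using curve_sorted_at_infinity by metis
  have "\<xi> \<noteq> 0" using assms by auto
  define S where "S = (\<lambda>t. of_real t * \<xi>) ` {1..}"
  have nr: "x \<notin> \<real>" if x: "x \<in> S" for x
  proof
    assume "x \<in> \<real>"
    obtain t where t: "t \<ge> 1" "x = of_real t * \<xi>" using x by (auto simp: S_def)
    then have "\<xi> = x / of_real t" by simp
    then show False using \<open>x \<in> \<real>\<close> assms by auto
  qed
  have "inner_mod \<xi> < outer_mod \<xi> \<and> curve_sorted \<xi>"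
  proof (rule connected_sequential_induct[of S "of_real (max 1 (R / norm \<xi>)) * \<xi>" "\<lambda>\<xi>. inner_mod \<xi> < outer_mod \<xi> \<and> curve_sorted \<xi>"])
    show "connected S" unfolding S_def
      by (intro connected_continuous_image continuous_intros) auto
    show "of_real (max 1 (R / norm \<xi>)) * \<xi> \<in> S" unfolding S_def by (rule imageI) auto
    have "norm (of_real (max 1 (R / norm \<xi>)) * \<xi>) \<ge> R"
      using \<open>\<xi> \<noteq> 0\<close> mult_right_mono[of "R / norm \<xi>" "max 1 (R / norm \<xi>)" "norm \<xi>"] by (simp add: norm_mult)
    then show "inner_mod (of_real (max 1 (R / norm \<xi>)) * \<xi>) < outer_mod (of_real (max 1 (R / norm \<xi>)) * \<xi>) \<and>
      curve_sorted (of_real (max 1 (R / norm \<xi>)) * \<xi>)" using R by blast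
    show "\<xi> \<in> S" unfolding S_def by (rule image_eqI[of _ _ 1]) auto
  next
    fix x l assume x: "\<And>k::nat. x k \<in> S" "l \<in> S" "x \<longlonglongrightarrow> l" "\<And>k. inner_mod (x k) < outer_mod (x k) \<and> curve_sorted (x k)"
    have "curve_sorted l" using curve_sorted_closed[OF x(3)] x(4) by blast
    moreover have "inner_mod l < outer_mod l"
    proof -
      obtain \<phi> L where \<phi>: "strict_mono (\<phi> :: nat \<Rightarrow> nat)" and L: "length L = 2 * m" "set L = set (roots l)"
        and lim: "\<And>j. j < 2 * m \<Longrightarrow> (\<lambda>k. roots (x (\<phi> k)) ! j) \<longlonglongrightarrow> L ! j"
        and nL: "\<And>j. j < 2 * m \<Longrightarrow> norm (L ! j) = norm (roots l ! j)"
        using roots_limit[OF x(3)] by metis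
      have jm: "m - 1 < 2 * m" "m < 2 * m" using m_pos by auto
      have root: "L ! j \<noteq> 0" "f (L ! j) = l" if "j < 2 * m" for j
        using that L set_roots nth_mem by metis+
      have rootk: "roots (x k) ! j \<noteq> 0" "f (roots (x k) ! j) = x k" if "j < 2 * m" for j k
        using that length_roots set_roots nth_mem by metis+
      have "norm (L ! (m - 1)) \<le> \<rho> (L ! (m - 1))"
        by (rule LIMSEQ_le[OF tendsto_norm[OF lim[OF jm(1)]] tendsto_\<rho>[OF lim[OF jm(1)] root(1)[OF jm(1)]]])
           (use x(4) rootk[OF jm(1)] in \<open>auto simp: curve_sorted_def inner_mod_def intro!: exI[of _ 0] less_imp_le\<close>)
      moreover have "\<rho> (L ! m) \<le> norm (L ! m)"
        by (rule LIMSEQ_le[OF tendsto_\<rho>[OF lim[OF jm(2)] root(1)[OF jm(2)]] tendsto_norm[OF lim[OF jm(2)]]])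
           (use x(4) rootk[OF jm(2)] in \<open>auto simp: curve_sorted_def outer_mod_def intro!: exI[of _ 0] less_imp_le\<close>)
      moreover have "norm (L ! (m - 1)) \<noteq> \<rho> (L ! (m - 1))" "norm (L ! m) \<noteq> \<rho> (L ! m)"
        using on_curve(1) root jm nr[OF x(2)] by metis+
      ultimately have "norm (L ! (m - 1)) < norm (L ! m)"
        using root[OF jm(1)] root[OF jm(2)] nr[OF x(2)] by (intro nonreal_inside_less_outside) auto
      then show ?thesis using nL jm by (simp add: inner_mod_def outer_mod_def)
    qed
    ultimately show "inner_mod l < outer_mod l \<and> curve_sorted l" by blast
  next
    fix x l assume x: "\<And>k::nat. x k \<in> S" "l \<in> S" "x \<longlonglongrightarrow> l" "inner_mod l < outer_mod l \<and> curve_sorted l"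
    obtain \<phi> where \<phi>: "strict_mono (\<phi> :: nat \<Rightarrow> nat)"
      and "(\<lambda>k. inner_mod (x (\<phi> k))) \<longlonglongrightarrow> inner_mod l" "(\<lambda>k. outer_mod (x (\<phi> k))) \<longlonglongrightarrow> outer_mod l"
      using roots_limit[OF x(3)] by metis
    then have "\<forall>\<^sub>F k in sequentially. inner_mod (x (\<phi> k)) < outer_mod (x (\<phi> k))"
      using eventually_less_of_tendsto x(4) by blast
    then obtain k0 where k0: "\<And>k. k \<ge> k0 \<Longrightarrow> inner_mod (x (\<phi> k)) < outer_mod (x (\<phi> k))"
      by (auto simp: eventually_sequentially)
    have "(\<lambda>k. x (\<phi> (k + k0))) \<longlonglongrightarrow> l"
      using LIMSEQ_ignore_initial_segment[OF LIMSEQ_subseq_LIMSEQ[OF x(3) \<phi>], of k0] by (simp add: o_def)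
    from curve_sorted_open[OF this] x(4) obtain k where "curve_sorted (x (\<phi> (k + k0)))" by blast
    then show "\<exists>k. inner_mod (x k) < outer_mod (x k) \<and> curve_sorted (x k)" using k0[of "k + k0"] by auto
  qed
  then show ?thesis by blast
qed

end


section \<open>Polynomial multiples with a gap\<close>

text \<open>The $\ell^1$ norm of the coefficient sequence.\<close>

definition coeff_norm :: "complex poly \<Rightarrow> real" where "coeff_norm p = (\<Sum>i\<le>degree p. norm (coeff p i))"

lemma coeff_norm_alt: assumes "\<And>i. i > d \<Longrightarrow> coeff p i = 0" shows "coeff_norm p = (\<Sum>i\<le>d. norm (coeff p i))"
proof -
  have "degree p \<le> d" using assms by (intro degree_le) auto
  then show ?thesis unfolding coeff_norm_def by (intro sum.mono_neutral_left) (auto simp: coeff_eq_0)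
qed

lemma coeff_norm_nonneg: "coeff_norm p \<ge> 0" by (simp add: coeff_norm_def sum_nonneg)
lemma coeff_norm_0 [simp]: "coeff_norm 0 = 0" by (simp add: coeff_norm_def)
lemma coeff_norm_eq_0_iff: "coeff_norm p = 0 \<longleftrightarrow> p = 0"
proof
  assume "coeff_norm p = 0"
  then have "norm (coeff p (degree p)) = 0" unfolding coeff_norm_def by (subst (asm) sum_nonneg_eq_0_iff) auto
  then show "p = 0" by simp
qed simp

lemma coeff_norm_add: "coeff_norm (p + q) \<le> coeff_norm p + coeff_norm q"
proof -
  define d where "d = max (degree p) (degree q)"
  have "coeff_norm (p + q) = (\<Sum>i\<le>d. norm (coeff (p + q) i))"
    by (rule coeff_norm_alt) (auto simp: d_def coeff_eq_0)
  also have "\<dots> \<le> (\<Sum>i\<le>d. norm (coeff p i) + norm (coeff q i))"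
    by (intro sum_mono) (simp add: norm_triangle_ineq)
  also have "\<dots> = coeff_norm p + coeff_norm q"
    by (subst (1 2) coeff_norm_alt[of d]) (auto simp: d_def coeff_eq_0 sum.distrib)
  finally show ?thesis .
qed

lemma coeff_norm_smult: "coeff_norm (Polynomial.smult c p) = norm c * coeff_norm p"
  by (cases "c = 0") (simp_all add: coeff_norm_def norm_mult sum_distrib_left)

lemma coeff_norm_sum: "coeff_norm (\<Sum>i\<in>I. p i) \<le> (\<Sum>i\<in>I. coeff_norm (p i))"
  by (induction I rule: infinite_finite_induct) (auto intro: order.trans[OF coeff_norm_add])

lemma coeff_norm_linear_mult: "coeff_norm ([:- w, 1:] * p) \<le> (1 + norm w) * coeff_norm p"
proof -
  have "[:- w, 1:] * p = Polynomial.smult (- w) p + pCons 0 p" by simp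
  moreover have "coeff_norm (pCons 0 p) = coeff_norm p"
  proof -
    have "coeff_norm (pCons 0 p) = (\<Sum>i\<le>Suc (degree p). norm (coeff (pCons 0 p) i))"
      by (rule coeff_norm_alt) (auto simp: coeff_pCons coeff_eq_0 split: nat.splits)
    also have "\<dots> = norm (coeff (pCons 0 p) 0) + (\<Sum>i\<le>degree p. norm (coeff (pCons 0 p) (Suc i)))"
      by (rule sum.atMost_Suc_shift)
    finally show ?thesis by (simp add: coeff_norm_def[of p])
  qed
  ultimately have "coeff_norm ([:- w, 1:] * p) \<le> coeff_norm (Polynomial.smult (- w) p) + coeff_norm p"
    using coeff_norm_add by metis
  then show ?thesis unfolding coeff_norm_smult norm_minus_cancel by (simp only: distrib_right mult_1 add.commute)
qed

abbreviation prod_linear :: "complex list \<Rightarrow> complex poly" where "prod_linear ws \<equiv> (\<Prod>w\<leftarrow>ws. [:- w, 1:])"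

text \<open>The remainder of $X^N$ modulo a product of linear factors with roots in the disc of
  radius $\sigma$ is $O(N^l \sigma^N)$, uniformly in the roots, which may coincide. Induction on
  the factors: $X^N = (X - w) \sum_{i<N} w^{N-1-i} X^i + w^N$, and each $X^i$ is reduced modulo
  the remaining factors.\<close>

lemma power_remainder_bound:
  assumes "\<sigma> > 0" "\<And>w. w \<in> set ws \<Longrightarrow> norm w \<le> \<sigma>"
  shows "\<exists>R. prod_linear ws dvd ([:0, 1:] ^ N - R) \<and> (\<forall>i\<ge>length ws. coeff R i = 0) \<and>
     coeff_norm R \<le> ((2 + 1 / \<sigma>) * real (N + 1)) ^ length ws * \<sigma> ^ N"
  using assms(2)
proof (induction ws arbitrary: N)
  case Nil
  then show ?case using assms(1) by (intro exI[of _ 0]) auto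
next
  case (Cons w ws)
  define c where "c = 2 + 1 / \<sigma>"
  define l where "l = length ws"
  have c1: "c \<ge> 1" using assms(1) by (simp add: c_def)
  have nw: "norm w \<le> \<sigma>" using Cons.prems by simp
  obtain R where R: "\<And>i. prod_linear ws dvd ([:0, 1:] ^ i - R i)" "\<And>i j. j \<ge> l \<Longrightarrow> coeff (R i) j = 0"
    "\<And>i. coeff_norm (R i) \<le> (c * real (i + 1)) ^ l * \<sigma> ^ i"
    using Cons.IH Cons.prems unfolding c_def l_def by (metis list.set_intros(2))
  define S where "S = (\<Sum>i<N. Polynomial.smult (w ^ (N - Suc i)) (R i))"
  define R' where "R' = [:- w, 1:] * S + [:w ^ N:]"
  have cS: "coeff S j = 0" if "j \<ge> l" for j using R(2)[OF that] by (simp add: S_def coeff_sum)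
  have "[:0, 1:] ^ N - [:w:] ^ N = ([:0, 1:] - [:w:]) * (\<Sum>i<N. [:w:] ^ (N - Suc i) * [:0, 1:] ^ i)"
    by (rule power_diff_sumr2)
  then have "[:0, 1:] ^ N - R' = [:- w, 1:] * ((\<Sum>i<N. Polynomial.smult (w ^ (N - Suc i)) ([:0, 1:] ^ i)) - S)"
    by (simp add: R'_def poly_const_pow algebra_simps del: mult_pCons_left mult_pCons_right) (simp add: algebra_simps)
  also have "(\<Sum>i<N. Polynomial.smult (w ^ (N - Suc i)) ([:0, 1:] ^ i)) - S
     = (\<Sum>i<N. Polynomial.smult (w ^ (N - Suc i)) ([:0, 1:] ^ i - R i))"
    by (simp add: S_def sum_subtractf smult_diff_right)
  finally have e: "[:0, 1:] ^ N - R' = [:- w, 1:] * (\<Sum>i<N. Polynomial.smult (w ^ (N - Suc i)) ([:0, 1:] ^ i - R i))" .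
  have "prod_linear (w # ws) dvd ([:0, 1:] ^ N - R')"
    unfolding e list.map prod_list.Cons
    by (intro mult_dvd_mono dvd_sum dvd_smult R(1) dvd_refl)
  moreover have "coeff R' i = 0" if "i \<ge> length (w # ws)" for i
    using that cS[of i] cS[of "i - 1"] by (auto simp: R'_def l_def coeff_pCons split: nat.splits)
  moreover have "coeff_norm R' \<le> (c * real (N + 1)) ^ Suc l * \<sigma> ^ N"
  proof -
    have cN: "c * real (N + 1) \<ge> 1" using c1 mult_mono[of 1 c 1 "real (N + 1)"] by simp
    have "coeff_norm S \<le> (\<Sum>i<N. coeff_norm (Polynomial.smult (w ^ (N - Suc i)) (R i)))" unfolding S_def by (rule coeff_norm_sum)
    also have "\<dots> \<le> (\<Sum>i<N. (c * real (N + 1)) ^ l * (\<sigma> ^ N / \<sigma>))"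
    proof (rule sum_mono)
      fix i assume "i \<in> {..<N}"
      then have i: "i < N" by simp
      have "coeff_norm (Polynomial.smult (w ^ (N - Suc i)) (R i)) \<le> \<sigma> ^ (N - Suc i) * ((c * real (i + 1)) ^ l * \<sigma> ^ i)"
        unfolding coeff_norm_smult norm_power
        by (intro mult_mono power_mono nw R(3)) (use assms(1) coeff_norm_nonneg in auto)
      also have "\<dots> \<le> \<sigma> ^ (N - Suc i) * ((c * real (N + 1)) ^ l * \<sigma> ^ i)"
        using i c1 assms(1) by (intro mult_left_mono mult_right_mono power_mono) auto
      also have "\<dots> = (c * real (N + 1)) ^ l * \<sigma> ^ (N - 1)"
        using i by (simp add: mult_ac flip: power_add)
      also have "\<sigma> ^ (N - 1) = \<sigma> ^ N / \<sigma>" using i assms(1) by (cases N) auto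
      finally show "coeff_norm (Polynomial.smult (w ^ (N - Suc i)) (R i)) \<le> (c * real (N + 1)) ^ l * (\<sigma> ^ N / \<sigma>)" .
    qed
    finally have S: "coeff_norm S \<le> real N * ((c * real (N + 1)) ^ l * (\<sigma> ^ N / \<sigma>))" by simp
    have "coeff_norm R' \<le> coeff_norm ([:- w, 1:] * S) + coeff_norm [:w ^ N:]" unfolding R'_def by (rule coeff_norm_add)
    also have "\<dots> \<le> (1 + norm w) * coeff_norm S + norm w ^ N"
      by (intro add_mono coeff_norm_linear_mult) (simp add: coeff_norm_def norm_power)
    also have "\<dots> \<le> (1 + \<sigma>) * (real N * ((c * real (N + 1)) ^ l * (\<sigma> ^ N / \<sigma>))) + \<sigma> ^ N"
      by (intro add_mono mult_mono power_mono nw S) (use nw assms(1) coeff_norm_nonneg in auto)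
    also have "\<dots> = ((1 + 1 / \<sigma>) * real N * (c * real (N + 1)) ^ l + 1) * \<sigma> ^ N"
      using assms(1) by (simp add: field_simps)
    also have "\<dots> \<le> ((1 + 1 / \<sigma>) * real N * (c * real (N + 1)) ^ l + (c * real (N + 1)) ^ l) * \<sigma> ^ N"
      using cN assms(1) by (intro mult_right_mono add_left_mono) (auto intro: one_le_power)
    also have "\<dots> = ((1 + 1 / \<sigma>) * real N + 1) * ((c * real (N + 1)) ^ l * \<sigma> ^ N)" by (simp add: algebra_simps)
    also have "\<dots> \<le> (c * real (N + 1)) * ((c * real (N + 1)) ^ l * \<sigma> ^ N)"
    proof (rule mult_right_mono)
      show "(1 + 1 / \<sigma>) * real N + 1 \<le> c * real (N + 1)"
        using assms(1) by (simp add: c_def algebra_simps)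
      show "0 \<le> (c * real (N + 1)) ^ l * \<sigma> ^ N" using c1 assms(1) by auto
    qed
    finally show ?thesis by (simp add: mult_ac)
  qed
  ultimately show ?case unfolding c_def l_def by (intro exI[of _ R']) auto
qed

lemma prod_linear_nonzero: "prod_linear ws \<noteq> 0"
  by (auto simp: prod_list_zero_iff)

lemma degree_prod_linear: "degree (prod_linear ws) = length ws"
proof (induction ws)
  case (Cons w ws)
  have "degree ([:- w, 1:] * prod_linear ws) = 1 + degree (prod_linear ws)"
    by (subst degree_mult_eq[OF _ prod_linear_nonzero]) auto
  then show ?case using Cons by simp
qed simp

text \<open>Since $v$ has degree below the number of factors, it is determined by $u$: it is minus
  the remainder of $X^N u$.\<close>

lemma low_part_bound:
  assumes "\<sigma> > 0" "\<And>w. w \<in> set ws \<Longrightarrow> norm w \<le> \<sigma>"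
    and dvd: "prod_linear ws dvd v + [:0, 1:] ^ N * u"
    and v: "\<And>i. i \<ge> length ws \<Longrightarrow> coeff v i = 0" and u: "\<And>i. i \<ge> l \<Longrightarrow> coeff u i = 0"
  shows "coeff_norm v \<le> coeff_norm u * (((2 + 1 / \<sigma>) * real (N + l + 1)) ^ length ws * (max 1 \<sigma>) ^ l * \<sigma> ^ N)"
proof -
  define c where "c = 2 + 1 / \<sigma>"
  have c0: "c \<ge> 0" using assms(1) by (simp add: c_def)
  define k where "k = length ws"
  obtain R where R: "\<And>i. prod_linear ws dvd ([:0, 1:] ^ i - R i)" "\<And>i j. j \<ge> k \<Longrightarrow> coeff (R i) j = 0"
    "\<And>i. coeff_norm (R i) \<le> (c * real (i + 1)) ^ k * \<sigma> ^ i"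
    using power_remainder_bound[OF assms(1,2)] unfolding c_def k_def by metis
  define S where "S = (\<Sum>i<l. Polynomial.smult (coeff u i) (R (N + i)))"
  have "u = (\<Sum>i<l. monom (coeff u i) i)"
    by (rule poly_eqI) (use u in \<open>auto simp: coeff_sum coeff_monom not_less\<close>)
  then have "[:0, 1:] ^ N * u = (\<Sum>i<l. Polynomial.smult (coeff u i) ([:0, 1:] ^ (N + i)))"
    by (metis (mono_tags, lifting) mult_smult_right monom_altdef power_add sum.cong sum_distrib_left)
  then have "v + [:0, 1:] ^ N * u - (v + S) = (\<Sum>i<l. Polynomial.smult (coeff u i) ([:0, 1:] ^ (N + i) - R (N + i)))"
    by (simp add: S_def sum_subtractf smult_diff_right)
  then have "prod_linear ws dvd v + [:0, 1:] ^ N * u - (v + S)"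
    by (simp only:) (intro dvd_sum dvd_smult R(1))
  from dvd_diff[OF dvd this] have dvS: "prod_linear ws dvd v + S" by simp
  have cf: "coeff (v + S) i = 0" if "i \<ge> k" for i
    using that v R(2) by (simp add: S_def coeff_sum k_def)
  have "v + S = 0"
  proof (rule ccontr)
    assume "v + S \<noteq> 0"
    from dvd_imp_degree_le[OF dvS this] have "coeff (v + S) (degree (v + S)) = 0"
      by (intro cf) (simp add: degree_prod_linear k_def)
    then show False using \<open>v + S \<noteq> 0\<close> by (simp only: leading_coeff_0_iff)
  qed
  then have "v = Polynomial.smult (- 1) S" by (simp add: eq_neg_iff_add_eq_0)
  then have "coeff_norm v = coeff_norm S" by (metis mult_1 coeff_norm_smult norm_minus_cancel norm_one)
  also have "\<dots> \<le> (\<Sum>i<l. coeff_norm (Polynomial.smult (coeff u i) (R (N + i))))" unfolding S_def by (rule coeff_norm_sum)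
  also have "\<dots> \<le> (\<Sum>i<l. norm (coeff u i) * ((c * real (N + l + 1)) ^ k * (max 1 \<sigma> ^ l * \<sigma> ^ N)))"
  proof (rule sum_mono)
    fix i assume "i \<in> {..<l}"
    then have i: "i < l" by simp
    have "coeff_norm (R (N + i)) \<le> (c * real (N + i + 1)) ^ k * \<sigma> ^ (N + i)" by (rule R(3))
    also have "\<dots> \<le> (c * real (N + l + 1)) ^ k * (max 1 \<sigma> ^ l * \<sigma> ^ N)"
    proof (intro mult_mono power_mono mult_left_mono)
      have "\<sigma> ^ i \<le> max 1 \<sigma> ^ i" using assms(1) by (intro power_mono) auto
      also have "\<dots> \<le> max 1 \<sigma> ^ l" using i by (intro power_increasing) auto
      finally show "\<sigma> ^ (N + i) \<le> max 1 \<sigma> ^ l * \<sigma> ^ N" using assms(1) by (simp add: power_add mult.commute)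
    qed (use c0 i assms(1) in auto)
    finally show "coeff_norm (Polynomial.smult (coeff u i) (R (N + i))) \<le> norm (coeff u i) * ((c * real (N + l + 1)) ^ k * (max 1 \<sigma> ^ l * \<sigma> ^ N))"
      unfolding coeff_norm_smult by (intro mult_left_mono) auto
  qed
  also have "\<dots> = (\<Sum>i<l. norm (coeff u i)) * ((c * real (N + l + 1)) ^ k * (max 1 \<sigma> ^ l * \<sigma> ^ N))"
    by (simp add: sum_distrib_right)
  also have "(\<Sum>i<l. norm (coeff u i)) = coeff_norm u"
  proof -
    have "coeff_norm u = (\<Sum>i\<le>l. norm (coeff u i))" by (rule coeff_norm_alt) (use u in auto)
    then show ?thesis using u[of l] by (simp add: lessThan_Suc_atMost[symmetric])
  qed
  finally show ?thesis unfolding c_def k_def by (simp add: mult_ac)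
qed

text \<open>Unlike \<open>reflect_poly\<close>, the reversal is relative to a prescribed degree
  bound, so it is linear and keeps track of roots at 0 and at infinity.\<close>

definition reverse_poly :: "nat \<Rightarrow> complex poly \<Rightarrow> complex poly" where
  "reverse_poly d p = (\<Sum>i\<le>d. monom (coeff p (d - i)) i)"

lemma coeff_reverse_poly: "coeff (reverse_poly d p) i = (if i \<le> d then coeff p (d - i) else 0)"
  by (auto simp: reverse_poly_def coeff_sum coeff_monom)

lemma poly_reverse_poly: assumes "degree p \<le> d" "z \<noteq> 0" shows "poly (reverse_poly d p) z = z ^ d * poly p (1 / z)"
proof -
  have "poly (reverse_poly d p) z = (\<Sum>i\<le>d. coeff p (d - i) * z ^ i)" by (simp add: reverse_poly_def poly_sum poly_monom)
  also have "\<dots> = (\<Sum>i\<le>d. coeff p i * z ^ (d - i))"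
    by (rule sum.reindex_bij_witness[of _ "\<lambda>i. d - i" "\<lambda>i. d - i"]) auto
  also have "\<dots> = (\<Sum>i\<le>d. z ^ d * (coeff p i * (1 / z) ^ i))"
    by (intro sum.cong refl) (use assms(2) in \<open>auto simp: power_diff field_simps\<close>)
  also have "\<dots> = z ^ d * poly p (1 / z)"
    by (simp add: poly_as_sum_le[OF assms(1)] sum_distrib_left)
  finally show ?thesis .
qed

lemma coeff_norm_reverse_poly: assumes "degree p \<le> d" shows "coeff_norm (reverse_poly d p) = coeff_norm p"
proof -
  have "coeff_norm (reverse_poly d p) = (\<Sum>i\<le>d. norm (coeff (reverse_poly d p) i))" by (rule coeff_norm_alt) (auto simp: coeff_reverse_poly)
  also have "\<dots> = (\<Sum>i\<le>d. norm (coeff p (d - i)))" by (simp add: coeff_reverse_poly)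
  also have "\<dots> = (\<Sum>i\<le>d. norm (coeff p i))"
    by (rule sum.reindex_bij_witness[of _ "\<lambda>i. d - i" "\<lambda>i. d - i"]) auto
  also have "\<dots> = coeff_norm p" by (rule coeff_norm_alt[symmetric]) (use assms in \<open>auto simp: coeff_eq_0\<close>)
  finally show ?thesis .
qed

lemma poly_eqI_nonzero:
  fixes p q :: "complex poly"
  assumes "\<And>z. z \<noteq> 0 \<Longrightarrow> poly p z = poly q z" shows "p = q"
proof (rule ccontr)
  assume "p \<noteq> q"
  then have "finite {z. poly (p - q) z = 0}" by (intro poly_roots_finite) simp
  moreover have "- {0} \<subseteq> {z. poly (p - q) z = 0}" using assms by auto
  ultimately have "finite (- {0 :: complex})" using finite_subset by blast
  then show False using infinite_UNIV_char_0[where 'a = complex] by simp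
qed

lemma reverse_poly_prod_linear_dvd:
  assumes dvd: "prod_linear ws dvd W" and d: "degree W \<le> d" and nz: "0 \<notin> set ws"
  shows "prod_linear (map inverse ws) dvd reverse_poly d W"
proof (cases "W = 0")
  case True then show ?thesis by (simp add: reverse_poly_def)
next
  case False
  obtain g where g: "W = prod_linear ws * g" using dvd by blast
  define k where "k = length ws"
  have "prod_linear ws \<noteq> 0" "g \<noteq> 0" using False g by auto
  then have dW: "degree W = k + degree g" using g by (simp add: degree_mult_eq degree_prod_linear k_def)
  have lp: "z ^ length ws * poly (prod_linear ws) (1 / z) = (\<Prod>w\<leftarrow>ws. - w) * poly (prod_linear (map inverse ws)) z"
    if "z \<noteq> 0" for z using nz
  proof (induction ws)
    case (Cons w ws)
    have "z * (1 / z - w) = - w * (z - inverse w)" using that Cons.prems by (simp add: field_simps)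
    moreover have "z ^ length (w # ws) * poly (prod_linear (w # ws)) (1 / z)
        = z * (1 / z - w) * (z ^ length ws * poly (prod_linear ws) (1 / z))"
    proof -
      have "x * z ^ length ws * ((y - w) * poly (prod_linear ws) y) = x * (y - w) * (z ^ length ws * poly (prod_linear ws) y)"
        for x y by simp
      from this[of z "1 / z"] show ?thesis by (simp add: algebra_simps)
    qed
    ultimately have "z ^ length (w # ws) * poly (prod_linear (w # ws)) (1 / z)
        = - w * (z - inverse w) * (z ^ length ws * poly (prod_linear ws) (1 / z))" by metis
    also have "\<dots> = (- w * (\<Prod>w\<leftarrow>ws. - w)) * ((z - inverse w) * poly (prod_linear (map inverse ws)) z)"
      using Cons by simp
    also have "(z - inverse w) * poly (prod_linear (map inverse ws)) z = poly (prod_linear (map inverse (w # ws))) z"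
      by (simp add: algebra_simps)
    finally show ?case by (simp only: list.map prod_list.Cons mult_ac)
  qed simp
  have "reverse_poly d W = prod_linear (map inverse ws) * Polynomial.smult (\<Prod>w\<leftarrow>ws. - w) (reverse_poly (d - k) g)"
  proof (rule poly_eqI_nonzero)
    fix z :: complex assume z: "z \<noteq> 0"
    have "poly (reverse_poly d W) z = z ^ d * poly W (1 / z)" by (rule poly_reverse_poly[OF d z])
    also have "z ^ d = z ^ k * z ^ (d - k)" using dW d by (simp flip: power_add)
    also have "z ^ k * z ^ (d - k) * poly W (1 / z) = (z ^ k * poly (prod_linear ws) (1 / z)) * (z ^ (d - k) * poly g (1 / z))"
      by (simp add: g)
    also have "z ^ (d - k) * poly g (1 / z) = poly (reverse_poly (d - k) g) z"
      using dW d z by (intro poly_reverse_poly[symmetric]) auto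
    finally show "poly (reverse_poly d W) z = poly (prod_linear (map inverse ws) * Polynomial.smult (\<Prod>w\<leftarrow>ws. - w) (reverse_poly (d - k) g)) z"
      using lp[OF z] by (simp add: k_def)
  qed
  then show ?thesis by (rule dvdI)
qed

text \<open>The bound \<open>low_part_bound\<close> is applied to the $m$ roots in
  \<open>us\<close>, and after the reversal $z \mapsto 1/z$, which exchanges the roles of $u$ and
  $v$, to the inverses of the $m$ roots in \<open>ws\<close>. Multiplying the two estimates
  cancels the norms of $u$ and $v$.\<close>

lemma no_gap_multiple:
  assumes \<sigma>: "0 < \<sigma>" and \<tau>: "0 < \<tau>" and m: "m \<ge> 1" "length us = m" "length ws = m"
    and us: "\<And>w. w \<in> set us \<Longrightarrow> norm w \<le> \<sigma>" and ws: "\<And>w. w \<in> set ws \<Longrightarrow> norm w \<ge> \<tau>"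
    and dvd: "prod_linear us dvd v + [:0, 1:] ^ N * u" "prod_linear ws dvd v + [:0, 1:] ^ N * u"
    and v: "\<And>i. i \<ge> m \<Longrightarrow> coeff v i = 0" and u: "\<And>i. i \<ge> m \<Longrightarrow> coeff u i = 0"
    and nz: "v + [:0, 1:] ^ N * u \<noteq> 0"
  shows "1 \<le> ((2 + 1 / \<sigma>) * (2 + \<tau>)) ^ m * (max 1 \<sigma> * max 1 (1 / \<tau>)) ^ m * real (N + m + 1) ^ (2 * m) * (\<sigma> / \<tau>) ^ N"
proof -
  define A where "A = ((2 + 1 / \<sigma>) * real (N + m + 1)) ^ m * max 1 \<sigma> ^ m * \<sigma> ^ N"
  define B where "B = ((2 + 1 / (1 / \<tau>)) * real (N + m + 1)) ^ m * max 1 (1 / \<tau>) ^ m * (1 / \<tau>) ^ N"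
  have vu: "coeff_norm v \<le> coeff_norm u * A"
    unfolding A_def using low_part_bound[OF \<sigma> us dvd(1) _ u] v m by simp
  define W where "W = v + [:0, 1:] ^ N * u"
  define k where "k = m - 1"
  define d where "d = N + k"
  have dv: "degree v \<le> k" and du: "degree u \<le> k" using v u m(1) by (auto intro!: degree_le simp: k_def)
  have dW: "degree W \<le> d"
    unfolding W_def d_def
    by (intro degree_add_le order.trans[OF degree_mult_le] order.trans[OF dv])
       (use du in \<open>auto simp: degree_power_eq\<close>)
  have rW: "reverse_poly d W = reverse_poly k u + [:0, 1:] ^ N * reverse_poly k v"
  proof (rule poly_eqI_nonzero)
    fix z :: complex assume z: "z \<noteq> 0"
    show "poly (reverse_poly d W) z = poly (reverse_poly k u + [:0, 1:] ^ N * reverse_poly k v) z"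
      using z by (simp add: poly_reverse_poly[OF dW z] poly_reverse_poly[OF du z] poly_reverse_poly[OF dv z])
        (simp add: W_def d_def power_add power_divide algebra_simps)
  qed
  have "prod_linear (map inverse ws) dvd reverse_poly d W"
    by (rule reverse_poly_prod_linear_dvd[OF _ dW]) (use dvd(2) ws \<tau> in \<open>force simp: W_def\<close>)+
  then have "prod_linear (map inverse ws) dvd reverse_poly k u + [:0, 1:] ^ N * reverse_poly k v" by (simp only: rW)
  moreover have "norm w \<le> 1 / \<tau>" if "w \<in> set (map inverse ws)" for w
  proof -
    from that obtain w' where "w' \<in> set ws" "w = inverse w'" by auto
    then show ?thesis using ws[of w'] \<tau> by (simp add: norm_inverse inverse_eq_divide[symmetric] le_imp_inverse_le)
  qed
  ultimately have "coeff_norm (reverse_poly k u) \<le> coeff_norm (reverse_poly k v) * B"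
    unfolding B_def
    using low_part_bound[of "1 / \<tau>" "map inverse ws" "reverse_poly k u" N "reverse_poly k v" m] \<tau> m
    by (simp add: coeff_reverse_poly k_def)
  then have uv: "coeff_norm u \<le> coeff_norm v * B" by (simp add: coeff_norm_reverse_poly du dv)
  have A0: "A \<ge> 0" and B0: "B \<ge> 0" using \<sigma> \<tau> by (auto simp: A_def B_def)
  have "coeff_norm v > 0"
  proof (rule ccontr)
    assume "\<not> coeff_norm v > 0"
    then have "coeff_norm v = 0" using coeff_norm_nonneg[of v] by simp
    then have "coeff_norm u = 0" using uv coeff_norm_nonneg[of u] by simp
    then show False using \<open>coeff_norm v = 0\<close> nz by (simp add: coeff_norm_eq_0_iff)
  qed
  moreover have "coeff_norm v * 1 \<le> coeff_norm v * (B * A)"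
    using order.trans[OF vu mult_right_mono[OF uv A0]] by (simp add: mult_ac)
  ultimately have "1 \<le> B * A" by (simp only: mult_le_cancel_left_pos)
  also have "B * A = ((2 + 1 / \<sigma>) * (2 + \<tau>)) ^ m * (max 1 \<sigma> * max 1 (1 / \<tau>)) ^ m * real (N + m + 1) ^ (2 * m) * (\<sigma> / \<tau>) ^ N"
  proof -
    have "x ^ (2 * m) = x ^ m * x ^ m" for x :: real by (simp add: mult_2 power_add)
    then show ?thesis
      by (simp add: A_def B_def power_mult_distrib power_divide mult_ac del: of_nat_add)
  qed
  finally show ?thesis .
qed


section \<open>Eigenvalues, traces and operator norms of matrices\<close>

definition mat_trace :: "complex mat \<Rightarrow> complex" where "mat_trace A = (\<Sum>i<dim_row A. A $$ (i, i))"

lemma mat_trace_commute: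
  assumes "A \<in> carrier_mat n n" "B \<in> carrier_mat n n"
  shows "mat_trace (A * B) = mat_trace (B * A)"
proof -
  have e: "(X * Y) $$ (i, i) = (\<Sum>j<n. X $$ (i, j) * Y $$ (j, i))"
    if "X \<in> carrier_mat n n" "Y \<in> carrier_mat n n" "i < n" for X Y :: "complex mat" and i
    using that by (auto simp: scalar_prod_def atLeast0LessThan intro!: sum.cong)
  have "mat_trace (A * B) = (\<Sum>i<n. \<Sum>j<n. A $$ (i, j) * B $$ (j, i))"
    using assms by (auto simp: mat_trace_def e simp del: index_mult_mat(1) intro!: sum.cong)
  also have "\<dots> = (\<Sum>j<n. \<Sum>i<n. B $$ (j, i) * A $$ (i, j))"
    by (subst sum.swap) (simp add: mult.commute)
  also have "\<dots> = mat_trace (B * A)"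
    using assms by (auto simp: mat_trace_def e simp del: index_mult_mat(1) intro!: sum.cong)
  finally show ?thesis .
qed

lemma upper_triangular_pow_diag:
  assumes "B \<in> carrier_mat n n" "upper_triangular B"
  shows "upper_triangular (B ^\<^sub>m k) \<and> (\<forall>i<n. (B ^\<^sub>m k) $$ (i, i) = (B $$ (i, i)) ^ k)"
proof (induction k)
  case 0
  then show ?case using assms by auto
next
  case (Suc k)
  have c: "B ^\<^sub>m k \<in> carrier_mat n n" using assms by simp
  have e: "(B ^\<^sub>m k * B) $$ (i, j) = (\<Sum>l<n. (B ^\<^sub>m k) $$ (i, l) * B $$ (l, j))" if "i < n" "j < n" for i j
    using that c assms(1) by (auto simp: scalar_prod_def atLeast0LessThan intro!: sum.cong)
  have z1: "(B ^\<^sub>m k) $$ (i, l) = 0" if "l < i" "i < n" for i l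
    using Suc.IH that c by (auto dest: upper_triangularD)
  have z2: "B $$ (i, l) = 0" if "l < i" "i < n" for i l
    using assms that by (auto dest: upper_triangularD)
  have "(B ^\<^sub>m k * B) $$ (i, j) = 0" if "j < i" "i < n" for i j
    unfolding e[OF that(2) order.strict_trans[OF that]]
  proof (rule sum.neutral, rule ballI)
    fix l assume "l \<in> {..<n}"
    then show "(B ^\<^sub>m k) $$ (i, l) * B $$ (l, j) = 0"
      using z1[of l i] z2[of j l] that by (cases "l < i") auto
  qed
  moreover have "(B ^\<^sub>m k * B) $$ (i, i) = B $$ (i, i) ^ Suc k" if "i < n" for i
  proof -
    have "(B ^\<^sub>m k * B) $$ (i, i) = (\<Sum>l<n. if l = i then (B ^\<^sub>m k) $$ (i, i) * B $$ (i, i) else 0)"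
      unfolding e[OF that that]
    proof (rule sum.cong[OF refl])
      fix l assume "l \<in> {..<n}"
      then show "(B ^\<^sub>m k) $$ (i, l) * B $$ (l, i) = (if l = i then (B ^\<^sub>m k) $$ (i, i) * B $$ (i, i) else 0)"
        using z1[of l i] z2[of i l] that by (cases l i rule: linorder_cases) auto
    qed
    then show ?thesis using Suc.IH that by (simp add: power_commutes)
  qed
  ultimately show ?case using c assms(1) by auto
qed

lemma pow_mat_Suc_left:
  assumes "A \<in> carrier_mat n n"
  shows "A ^\<^sub>m Suc k = A * A ^\<^sub>m k"
proof (induction k)
  case (Suc k)
  have "A ^\<^sub>m Suc (Suc k) = A * A ^\<^sub>m k * A" using Suc by simp
  also have "\<dots> = A * (A ^\<^sub>m k * A)"
    by (rule assoc_mult_mat[of _ n n _ n _ n]) (use assms in auto)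
  finally show ?case by simp
qed (use assms in simp)

lemma linear_factors_char_poly:
  assumes "A \<in> carrier_mat n n" "mset es = proots (char_poly A)"
  shows "char_poly (A :: complex mat) = (\<Prod>e\<leftarrow>es. [:- e, 1:])"
proof -
  have "lead_coeff (char_poly A) = 1" using degree_monic_char_poly[OF assms(1)] by simp
  then have "char_poly A = (\<Prod>e\<in>#proots (char_poly A). [:- e, 1:])"
    using complex_poly_decompose_multiset[of "char_poly A"] by simp
  then show ?thesis unfolding assms(2)[symmetric] by (simp add: prod_mset_prod_list flip: mset_map)
qed

text \<open>The Schur decomposition makes the matrix triangular, and the trace is invariant under
  similarity.\<close>

lemma eigenvalue_power_sum:
  assumes A: "A \<in> carrier_mat n n"
  shows "(\<Sum>e\<in>#proots (char_poly A). e ^ k) = mat_trace (A ^\<^sub>m k)"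
proof -
  obtain es where es: "mset es = proots (char_poly A)" using ex_mset by blast
  obtain B P Q where s: "schur_decomposition A es = (B, P, Q)" by (cases "schur_decomposition A es")
  from schur_decomposition[OF A linear_factors_char_poly[OF A es] s]
  have sim: "similar_mat_wit A B P Q" and ut: "upper_triangular B" and d: "diag_mat B = es" by auto
  note D = similar_mat_witD2[OF A sim]
  have Bk: "B ^\<^sub>m k \<in> carrier_mat n n" using D by simp
  have "mat_trace (A ^\<^sub>m k) = mat_trace (P * (B ^\<^sub>m k * Q))"
    using similar_mat_wit_pow_id[OF sim, of k] D Bk by (simp add: assoc_mult_mat[of _ n n _ n _ n])
  also have "\<dots> = mat_trace ((B ^\<^sub>m k * Q) * P)"
    by (rule mat_trace_commute[of _ n]) (use D Bk in auto)
  also have "(B ^\<^sub>m k * Q) * P = B ^\<^sub>m k * (Q * P)"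
    using D Bk by (simp add: assoc_mult_mat[of _ n n _ n _ n])
  also have "\<dots> = B ^\<^sub>m k" using D Bk by simp
  also have "mat_trace (B ^\<^sub>m k) = (\<Sum>i<n. (B $$ (i, i)) ^ k)"
    using upper_triangular_pow_diag[OF D(5) ut, of k] Bk by (auto simp: mat_trace_def intro!: sum.cong)
  also have "\<dots> = (\<Sum>e\<leftarrow>es. e ^ k)"
    using D(5) by (simp add: d[symmetric] diag_mat_def sum_list_sum_nth atLeast0LessThan)
  also have "\<dots> = (\<Sum>e\<in>#mset es. e ^ k)" by (simp add: sum_mset_sum_list flip: mset_map)
  finally show ?thesis by (simp add: es)
qed

definition l2 :: "complex vec \<Rightarrow> real" where "l2 x = L2_set (\<lambda>i. norm (x $ i)) {..<dim_vec x}"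

text \<open>The matrix has Euclidean operator norm at most $c$.\<close>

definition l2_bounded :: "complex mat \<Rightarrow> real \<Rightarrow> bool" where
  "l2_bounded A c \<longleftrightarrow> (\<forall>x\<in>carrier_vec (dim_col A). l2 (A *\<^sub>v x) \<le> c * l2 x)"

lemma l2_nonneg: "l2 x \<ge> 0" by (simp add: l2_def L2_set_nonneg)

lemma l2_add:
  assumes "x \<in> carrier_vec n" "y \<in> carrier_vec n" shows "l2 (x + y) \<le> l2 x + l2 y"
proof -
  have "l2 (x + y) = L2_set (\<lambda>i. norm (x $ i + y $ i)) {..<n}"
    using assms by (auto simp: l2_def intro!: L2_set_cong)
  also have "\<dots> \<le> L2_set (\<lambda>i. norm (x $ i) + norm (y $ i)) {..<n}"
    by (intro L2_set_mono norm_triangle_ineq) auto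
  also have "\<dots> \<le> l2 x + l2 y" using assms by (auto simp: l2_def intro!: L2_set_triangle_ineq)
  finally show ?thesis .
qed

lemma l2_bounded_mult:
  assumes "A \<in> carrier_mat n n" "B \<in> carrier_mat n n" "l2_bounded A c" "l2_bounded B d" "c \<ge> 0"
  shows "l2_bounded (A * B) (c * d)"
  unfolding l2_bounded_def
proof
  fix x :: "complex vec" assume "x \<in> carrier_vec (dim_col (A * B))"
  then have x: "x \<in> carrier_vec n" using assms by auto
  have "l2 ((A * B) *\<^sub>v x) = l2 (A *\<^sub>v (B *\<^sub>v x))" using assms x by (simp add: assoc_mult_mat_vec[of _ n n _ n])
  also have "\<dots> \<le> c * l2 (B *\<^sub>v x)" using assms x unfolding l2_bounded_def by auto
  also have "\<dots> \<le> c * (d * l2 x)" using assms x unfolding l2_bounded_def by (intro mult_left_mono) auto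
  finally show "l2 (A * B *\<^sub>v x) \<le> c * d * l2 x" by (simp add: mult.assoc)
qed

lemma l2_bounded_add:
  assumes "A \<in> carrier_mat n n" "B \<in> carrier_mat n n" "l2_bounded A c" "l2_bounded B d"
  shows "l2_bounded (A + B) (c + d)"
  unfolding l2_bounded_def
proof
  fix x :: "complex vec" assume "x \<in> carrier_vec (dim_col (A + B))"
  then have x: "x \<in> carrier_vec n" using assms by auto
  have "l2 ((A + B) *\<^sub>v x) \<le> l2 (A *\<^sub>v x) + l2 (B *\<^sub>v x)"
    using assms x by (simp add: add_mult_distrib_mat_vec[of _ n n] l2_add[of _ n])
  also have "\<dots> \<le> c * l2 x + d * l2 x" using assms x unfolding l2_bounded_def by (intro add_mono) auto
  finally show "l2 ((A + B) *\<^sub>v x) \<le> (c + d) * l2 x" by (simp add: algebra_simps)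
qed

lemma l2_bounded_pow:
  assumes "A \<in> carrier_mat n n" "l2_bounded A c" "c \<ge> 0"
  shows "l2_bounded (A ^\<^sub>m k) (c ^ k)"
proof (induction k)
  case 0
  then show ?case using assms by (auto simp: l2_bounded_def)
next
  case (Suc k)
  then show ?case using l2_bounded_mult[OF _ assms(1) Suc assms(2)] assms by (simp add: mult.commute)
qed

lemma l2_bounded_diag:
  assumes "A \<in> carrier_mat n n" "l2_bounded A c" "i < n"
  shows "norm (A $$ (i, i)) \<le> c"
proof -
  have "norm ((A *\<^sub>v unit_vec n i) $ i) \<le> l2 (A *\<^sub>v unit_vec n i)"
    unfolding l2_def using assms by (intro member_le_L2_set) auto
  also have "\<dots> \<le> c * l2 (unit_vec n i)" using assms unfolding l2_bounded_def by auto
  also have "l2 (unit_vec n i) = 1"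
  proof -
    have "l2 (unit_vec n i) = L2_set (\<lambda>j. if j = i then 1 else 0) {..<n}"
      unfolding l2_def by (rule L2_set_cong) (auto simp: unit_vec_def)
    also have "\<dots> = sqrt (\<Sum>j<n. if j = i then 1 else 0)" unfolding L2_set_def by (intro arg_cong[of _ _ sqrt] sum.cong) auto
    finally show ?thesis using assms(3) by simp
  qed
  finally show ?thesis using assms by (simp add: scalar_prod_right_unit)
qed

lemma l2_pos: assumes "x \<in> carrier_vec n" "x \<noteq> 0\<^sub>v n" shows "l2 x > 0"
proof (rule ccontr)
  assume "\<not> l2 x > 0"
  then have "l2 x = 0" using l2_nonneg[of x] by simp
  then have "\<forall>i<n. x $ i = 0" using assms(1) by (auto simp: l2_def L2_set_eq_0_iff)
  then have "x = 0\<^sub>v n" using assms(1) by (intro eq_vecI) auto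
  then show False using assms(2) by simp
qed

lemma l2_bounded_eigenvalue:
  assumes "A \<in> carrier_mat n n" "l2_bounded A c" "eigenvalue A k"
  shows "norm k \<le> c"
proof -
  obtain v where v: "v \<in> carrier_vec n" "v \<noteq> 0\<^sub>v n" "A *\<^sub>v v = k \<cdot>\<^sub>v v"
    using assms unfolding eigenvalue_def eigenvector_def by auto
  have "l2 (k \<cdot>\<^sub>v v) = norm k * l2 v"
  proof -
    have "l2 (k \<cdot>\<^sub>v v) = L2_set (\<lambda>i. norm k * norm (v $ i)) {..<n}"
      unfolding l2_def using v by (intro L2_set_cong) (auto simp: norm_mult)
    also have "\<dots> = norm k * l2 v" using v(1) by (simp add: l2_def L2_set_right_distrib)
    finally show ?thesis .
  qed
  moreover have "l2 (A *\<^sub>v v) \<le> c * l2 v" using assms v unfolding l2_bounded_def by auto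
  ultimately have "norm k * l2 v \<le> c * l2 v" using v(3) by simp
  then show ?thesis using l2_pos[OF v(1,2)] by simp
qed

lemma l2_bounded_pow_diff:
  assumes "A \<in> carrier_mat n n" "B \<in> carrier_mat n n" "l2_bounded A c" "l2_bounded B c" "l2_bounded (A - B) e" "c \<ge> 0" "e \<ge> 0"
  shows "l2_bounded (A ^\<^sub>m k - B ^\<^sub>m k) (real k * c ^ (k - 1) * e)"
proof (induction k)
  case 0
  have z: "A ^\<^sub>m 0 - B ^\<^sub>m 0 = 0\<^sub>m n n" using assms(1,2) by (intro eq_matI) auto
  have "l2 (0\<^sub>v n) = 0" by (simp add: l2_def L2_set_eq_0_iff)
  moreover have "0\<^sub>m n n *\<^sub>v x = 0\<^sub>v n" if "x \<in> carrier_vec n" for x :: "complex vec"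
    using that by (intro eq_vecI) auto
  ultimately show ?case unfolding l2_bounded_def z by auto
next
  case (Suc k)
  note cA = pow_carrier_mat[OF assms(1), of k] and cB = pow_carrier_mat[OF assms(2), of k]
  have eq: "A ^\<^sub>m Suc k - B ^\<^sub>m Suc k = A ^\<^sub>m k * (A - B) + (A ^\<^sub>m k - B ^\<^sub>m k) * B"
  proof -
    have "A ^\<^sub>m k * (A - B) = A ^\<^sub>m k * A - A ^\<^sub>m k * B"
      by (rule mult_minus_distrib_mat[OF cA assms(1,2)])
    moreover have "(A ^\<^sub>m k - B ^\<^sub>m k) * B = A ^\<^sub>m k * B - B ^\<^sub>m k * B"
      by (rule minus_mult_distrib_mat[OF cA cB assms(2)])
    ultimately show ?thesis using cA cB assms(1,2) by (intro eq_matI) auto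
  qed
  have "l2_bounded (A ^\<^sub>m Suc k - B ^\<^sub>m Suc k) (c ^ k * e + real k * c ^ (k - 1) * e * c)"
    unfolding eq
  proof (rule l2_bounded_add)
    show "l2_bounded (A ^\<^sub>m k * (A - B)) (c ^ k * e)"
      by (rule l2_bounded_mult[OF cA _ l2_bounded_pow[OF assms(1,3,6)] assms(5)]) (use assms in auto)
    show "l2_bounded ((A ^\<^sub>m k - B ^\<^sub>m k) * B) (real k * c ^ (k - 1) * e * c)"
      by (rule l2_bounded_mult[OF _ assms(2) Suc assms(4)]) (use assms cA cB in auto)
  qed (use assms cA cB in auto)
  also have "c ^ k * e + real k * c ^ (k - 1) * e * c = real (Suc k) * c ^ (Suc k - 1) * e"
    by (cases k) (auto simp: algebra_simps)
  finally show ?case .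
qed


section \<open>Toeplitz matrices as compressed multiplication operators\<close>

lemma cnj_mult_self: "cnj z * z = complex_of_real ((norm z)\<^sup>2)" "z * cnj z = complex_of_real ((norm z)\<^sup>2)"
  by (simp_all only: complex_norm_square mult.commute)

lemma integral_complex_of_real:
  "g integrable_on S \<Longrightarrow> integral S (\<lambda>x. complex_of_real (g x)) = of_real (integral S g)"
  using integral_linear[OF _ bounded_linear_of_real, of g S] by (simp add: o_def)

definition circle_continuous :: "(complex \<Rightarrow> complex) \<Rightarrow> bool" where
  "circle_continuous b \<longleftrightarrow> continuous_on {-pi..pi} (\<lambda>t. b (cis t))"

lemma circle_continuous_integrable: "circle_continuous b \<Longrightarrow> continuous_on {-pi..pi} g \<Longrightarrow> (\<lambda>t. b (cis t) * g t) integrable_on {-pi..pi}"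
  unfolding circle_continuous_def by (intro integrable_continuous_real continuous_intros)

lemma continuous_on_cis_times: "continuous_on S (\<lambda>t. cis (c * t))"
  by (intro continuous_intros)

lemma integral_cis: "integral {-pi..pi} (\<lambda>t. cis (of_int k * t)) = (if k = 0 then 2 * pi else 0)"
proof (cases "k = 0")
  case False
  have d: "((\<lambda>t. cis (of_int k * t) / (\<i> * of_int k)) has_vector_derivative cis (of_int k * t)) (at t within {-pi..pi})" for t
  proof -
    have "((\<lambda>t. exp (\<i> * of_int k * of_real t) / (\<i> * of_int k)) has_vector_derivative
      exp (\<i> * of_int k * of_real t) * (\<i> * of_int k) / (\<i> * of_int k)) (at t within {-pi..pi})"
      by (rule derivative_eq_intros has_vector_derivative_real_field refl | simp)+
    then show ?thesis using False by (simp add: cis_conv_exp mult_ac)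
  qed
  have "((\<lambda>t. cis (of_int k * t)) has_integral
      (cis (of_int k * pi) / (\<i> * of_int k) - cis (of_int k * (- pi)) / (\<i> * of_int k))) {-pi..pi}"
    by (rule fundamental_theorem_of_calculus) (use d in auto)
  moreover have "cis (of_int k * pi) = cis (of_int k * (- pi))"
    by (auto simp: complex_eq_iff sin_zero_iff_int2)
  ultimately show ?thesis using False by (simp add: integral_unique)
qed (simp add: content_real scaleR_conv_of_real)

lemma symbol_coeff_1: "symbol_coeff (\<lambda>_. 1) k = (if k = 0 then 1 else 0)"
  unfolding symbol_coeff_def by (simp add: integral_cis)

text \<open>Only the values on the unit circle enter, in the same sign convention as
  \<open>symbol_coeff\<close>.\<close>

definition trigsum :: "nat \<Rightarrow> (int \<Rightarrow> complex) \<Rightarrow> (complex \<Rightarrow> complex) \<Rightarrow> bool" where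
  "trigsum D c b \<longleftrightarrow> (\<forall>t. b (cis t) = (\<Sum>s = - int D..int D. c s * cis (- of_int s * t)))"

lemma trigsum_circle_continuous: "trigsum D c b \<Longrightarrow> circle_continuous b"
  unfolding trigsum_def circle_continuous_def by (simp add: continuous_intros)

text \<open>One factor is a finite sum, so that only linearity of the integral is
  involved.\<close>

lemma trigsum_convolution:
  assumes "trigsum D c b" "circle_continuous b'"
  shows "symbol_coeff (\<lambda>z. b z * b' z) k = (\<Sum>s = - int D..int D. c s * symbol_coeff b' (k - s))"
proof -
  have i: "(\<lambda>t. c s * (b' (cis t) * cis (of_int (k - s) * t))) integrable_on {-pi..pi}" for s
    by (intro integrable_on_mult_right circle_continuous_integrable assms(2) continuous_on_cis_times)
  have "integral {-pi..pi} (\<lambda>t. b (cis t) * b' (cis t) * cis (of_int k * t))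
    = integral {-pi..pi} (\<lambda>t. \<Sum>s = - int D..int D. c s * (b' (cis t) * cis (of_int (k - s) * t)))"
  proof (rule arg_cong[of _ _ "integral {-pi..pi}"], rule ext)
    fix t
    have "cis (- of_int s * t) * cis (of_int k * t) = cis (of_int (k - s) * t)" for s
      by (simp add: cis_mult algebra_simps)
    then show "b (cis t) * b' (cis t) * cis (of_int k * t) = (\<Sum>s = - int D..int D. c s * (b' (cis t) * cis (of_int (k - s) * t)))"
      using assms(1) unfolding trigsum_def by (simp add: sum_distrib_left sum_distrib_right mult_ac)
  qed
  also have "\<dots> = (\<Sum>s = - int D..int D. c s * integral {-pi..pi} (\<lambda>t. b' (cis t) * cis (of_int (k - s) * t)))"
    by (subst integral_sum) (use i in auto)
  finally show ?thesis unfolding symbol_coeff_def by (simp add: sum_distrib_left mult_ac)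
qed

lemma trigsum_coeff:
  assumes "trigsum D c b"
  shows "symbol_coeff b k = (if \<bar>k\<bar> \<le> int D then c k else 0)"
proof -
  have "circle_continuous (\<lambda>_. 1)" by (simp add: circle_continuous_def)
  from trigsum_convolution[OF assms this, of k]
  have "symbol_coeff b k = (\<Sum>s = - int D..int D. c s * symbol_coeff (\<lambda>_. 1) (k - s))" by simp
  also have "\<dots> = (\<Sum>s = - int D..int D. if s = k then c k else 0)"
    by (intro sum.cong) (auto simp: symbol_coeff_1)
  finally show ?thesis by (auto simp: abs_le_iff)
qed

lemma circle_continuous_pow: "circle_continuous b \<Longrightarrow> circle_continuous (\<lambda>z. b z ^ l)"
  unfolding circle_continuous_def by (intro continuous_intros)

lemma toeplitz_carrier [simp]: "toeplitz b n \<in> carrier_mat n n"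
  by (simp add: toeplitz_def)

text \<open>Away from the first and last $l D$ rows the truncation is not felt, and powers of the
  banded matrix agree with those of the doubly infinite one.\<close>

lemma toeplitz_pow_entry:
  assumes T: "trigsum D c b" and "j < n" "l * D \<le> i" "i + l * D < n"
  shows "(toeplitz b n ^\<^sub>m l) $$ (i, j) = symbol_coeff (\<lambda>z. b z ^ l) (int i - int j)"
  using assms(3,4)
proof (induction l arbitrary: i)
  case 0
  then show ?case using assms(2) by (auto simp: symbol_coeff_1 toeplitz_def)
next
  case (Suc l)
  let ?T = "toeplitz b n"
  have iD: "D \<le> i" "i + D < n" using Suc.prems by auto
  have in': "i < n" using iD by simp
  have "?T ^\<^sub>m Suc l = ?T * ?T ^\<^sub>m l" by (rule pow_mat_Suc_left[OF toeplitz_carrier])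
  then have "(?T ^\<^sub>m Suc l) $$ (i, j) = (\<Sum>k<n. ?T $$ (i, k) * (?T ^\<^sub>m l) $$ (k, j))"
    using in' assms(2) pow_carrier_mat[OF toeplitz_carrier, of b n l]
    by (simp add: scalar_prod_def atLeast0LessThan carrier_matD[OF toeplitz_carrier])
  also have "\<dots> = (\<Sum>k\<in>{i-D..i+D}. ?T $$ (i, k) * (?T ^\<^sub>m l) $$ (k, j))"
  proof (rule sum.mono_neutral_right)
    show "{i - D..i + D} \<subseteq> {..<n}" using iD by auto
    show "\<forall>k\<in>{..<n} - {i - D..i + D}. ?T $$ (i, k) * (?T ^\<^sub>m l) $$ (k, j) = 0"
      using iD in' by (auto simp: toeplitz_def trigsum_coeff[OF T])
  qed auto
  also have "\<dots> = (\<Sum>k\<in>{i-D..i+D}. c (int i - int k) * symbol_coeff (\<lambda>z. b z ^ l) (int k - int j))"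
  proof (rule sum.cong[OF refl])
    fix k assume k: "k \<in> {i-D..i+D}"
    have "(?T ^\<^sub>m l) $$ (k, j) = symbol_coeff (\<lambda>z. b z ^ l) (int k - int j)"
      using k Suc.prems by (intro Suc.IH) auto
    moreover have "?T $$ (i, k) = c (int i - int k)"
      using k iD in' by (auto simp: toeplitz_def trigsum_coeff[OF T])
    ultimately show "?T $$ (i, k) * (?T ^\<^sub>m l) $$ (k, j) = c (int i - int k) * symbol_coeff (\<lambda>z. b z ^ l) (int k - int j)"
      by simp
  qed
  also have "\<dots> = (\<Sum>s = - int D..int D. c s * symbol_coeff (\<lambda>z. b z ^ l) (int i - int j - s))"
    by (rule sum.reindex_bij_witness[of _ "\<lambda>s. nat (int i - s)" "\<lambda>k. int i - int k"]) (use iD in \<open>auto simp: algebra_simps\<close>)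
  also have "\<dots> = symbol_coeff (\<lambda>z. b z * b z ^ l) (int i - int j)"
    by (rule trigsum_convolution[OF T, symmetric]) (intro circle_continuous_pow trigsum_circle_continuous[OF T])
  finally show ?case by simp
qed

definition trig_poly :: "nat \<Rightarrow> complex vec \<Rightarrow> real \<Rightarrow> complex" where
  "trig_poly n x t = (\<Sum>j<n. x $ j * cis (- (of_nat j * t)))"

lemma continuous_trig_poly [continuous_intros]: "continuous_on S (trig_poly n x)"
  unfolding trig_poly_def by (intro continuous_intros)

text \<open>The matrix represents multiplication by the symbol, compressed to trigonometric
  polynomials. Both the norm bound and the reality of the spectrum for a real symbol follow from
  this formula.\<close>

lemma toeplitz_form:
  assumes b: "circle_continuous b" and x: "x \<in> carrier_vec n" and y: "y \<in> carrier_vec n"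
  shows "(\<Sum>i<n. cnj (y $ i) * (toeplitz b n *\<^sub>v x) $ i) =
     1 / (2 * pi) * integral {-pi..pi} (\<lambda>t. b (cis t) * (trig_poly n x t * cnj (trig_poly n y t)))"
proof -
  let ?X = "Xp n x"
  let ?Y = "Xp n y"
  let ?F = "\<lambda>i j t. cnj (y $ i) * x $ j * (b (cis t) * cis (of_int (int i - int j) * t))"
  let ?I = "integral {-pi..pi}"
  have i: "(\<lambda>t. ?F i j t) integrable_on {-pi..pi}" for i j
    by (intro integrable_on_mult_right circle_continuous_integrable b continuous_on_cis_times)
  have "?I (\<lambda>t. b (cis t) * (trig_poly n x t * cnj (trig_poly n y t)))
     = ?I (\<lambda>t. \<Sum>i<n. \<Sum>j<n. ?F i j t)"
  proof (rule arg_cong[of _ _ "?I"], rule ext)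
    fix t
    have c: "cis (- (of_nat j * t)) * cnj (cis (- (of_nat i * t))) = cis (of_int (int i - int j) * t)" for i j
      by (simp add: cis_cnj cis_mult algebra_simps)
    have "trig_poly n x t * cnj (trig_poly n y t) = (\<Sum>i<n. \<Sum>j<n. cnj (y $ i) * x $ j * (cis (- (of_nat j * t)) * cnj (cis (- (of_nat i * t)))))"
      unfolding trig_poly_def cnj_sum sum_product by (subst sum.swap) (simp add: mult_ac)
    then show "b (cis t) * (trig_poly n x t * cnj (trig_poly n y t)) = (\<Sum>i<n. \<Sum>j<n. ?F i j t)"
      unfolding c by (simp add: sum_distrib_left mult_ac)
  qed
  also have "\<dots> = (\<Sum>i<n. \<Sum>j<n. cnj (y $ i) * x $ j * ?I (\<lambda>t. b (cis t) * cis (of_int (int i - int j) * t)))"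
  proof -
    have "?I (\<lambda>t. \<Sum>i<n. \<Sum>j<n. ?F i j t)
      = (\<Sum>i<n. ?I (\<lambda>t. \<Sum>j<n. ?F i j t))"
      by (intro integral_sum integrable_sum i finite_lessThan)
    also have "\<dots> = (\<Sum>i<n. \<Sum>j<n. ?I (\<lambda>t. ?F i j t))"
      by (intro sum.cong refl integral_sum i finite_lessThan)
    finally show ?thesis by simp
  qed
  finally have "1 / (2 * pi) * ?I (\<lambda>t. b (cis t) * (trig_poly n x t * cnj (trig_poly n y t)))
    = (\<Sum>i<n. \<Sum>j<n. cnj (y $ i) * x $ j * symbol_coeff b (int i - int j))"
    unfolding symbol_coeff_def by (simp add: sum_distrib_left mult_ac)
  also have "\<dots> = (\<Sum>i<n. cnj (y $ i) * (toeplitz b n *\<^sub>v x) $ i)"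
  proof (rule sum.cong[OF refl])
    fix i assume "i \<in> {..<n}"
    then have "(toeplitz b n *\<^sub>v x) $ i = (\<Sum>j<n. symbol_coeff b (int i - int j) * x $ j)"
      using x by (simp add: toeplitz_def scalar_prod_def atLeast0LessThan)
    then show "(\<Sum>j<n. cnj (y $ i) * x $ j * symbol_coeff b (int i - int j)) = cnj (y $ i) * (toeplitz b n *\<^sub>v x) $ i"
      by (simp add: sum_distrib_left mult_ac)
  qed
  finally show ?thesis by simp
qed

lemma toeplitz_1: "toeplitz (\<lambda>_. 1) n = 1\<^sub>m n"
  by (rule eq_matI) (auto simp: toeplitz_def symbol_coeff_1)

lemma l2_sq: "x \<in> carrier_vec n \<Longrightarrow> (l2 x)\<^sup>2 = (\<Sum>i<n. (norm (x $ i))\<^sup>2)"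
  by (simp add: l2_def L2_set_def sum_nonneg)

lemma parseval:
  assumes x: "x \<in> carrier_vec n"
  shows "1 / (2 * pi) * integral {-pi..pi} (\<lambda>t. (norm (trig_poly n x t))\<^sup>2) = (l2 x)\<^sup>2"
proof -
  let ?X = "Xp n x"
  let ?I = "integral {-pi..pi}"
  have "circle_continuous (\<lambda>_. 1)" by (simp add: circle_continuous_def)
  from toeplitz_form[OF this x x]
  have "(\<Sum>i<n. cnj (x $ i) * x $ i) = 1 / (2 * pi) * ?I (\<lambda>t. trig_poly n x t * cnj (trig_poly n x t))"
    using x by (simp add: toeplitz_1)
  also have "(\<Sum>i<n. cnj (x $ i) * x $ i) = of_real ((l2 x)\<^sup>2)"
    by (simp only: l2_sq[OF x] cnj_mult_self of_real_sum)
  also have "?I (\<lambda>t. trig_poly n x t * cnj (trig_poly n x t)) = ?I (\<lambda>t. complex_of_real ((norm (trig_poly n x t))\<^sup>2))"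
    by (simp only: cnj_mult_self)
  also have "\<dots> = of_real (?I (\<lambda>t. (norm (trig_poly n x t))\<^sup>2))"
    by (rule integral_complex_of_real) (intro integrable_continuous_real continuous_intros)
  finally have "of_real ((l2 x)\<^sup>2) = complex_of_real (1 / (2 * pi) * ?I (\<lambda>t. (norm (trig_poly n x t))\<^sup>2))"
    by simp
  then show ?thesis by (simp only: of_real_eq_iff)
qed

text \<open>Test the quadratic form with $y = T_n(b) x$ and use $2 M |X| |Y| \le M^2 |X|^2 +
  |Y|^2$ under the integral.\<close>

lemma toeplitz_l2_bounded:
  assumes b: "circle_continuous b" and M: "\<And>t. t \<in> {-pi..pi} \<Longrightarrow> norm (b (cis t)) \<le> M" and M0: "M > 0"
  shows "l2_bounded (toeplitz b n) M"
  unfolding l2_bounded_def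
proof
  fix x :: "complex vec" assume "x \<in> carrier_vec (dim_col (toeplitz b n))"
  then have x: "x \<in> carrier_vec n" by (simp add: toeplitz_def)
  define y where "y = toeplitz b n *\<^sub>v x"
  have y: "y \<in> carrier_vec n" unfolding y_def by (rule mult_mat_vec_carrier[OF toeplitz_carrier x])
  have cX: "continuous_on {-pi..pi} (\<lambda>t. (norm (trig_poly n v t))\<^sup>2)" for v by (intro continuous_intros)
  have "of_real ((l2 y)\<^sup>2) = (\<Sum>i<n. cnj (y $ i) * y $ i)"
    by (simp only: l2_sq[OF y] cnj_mult_self of_real_sum)
  also have "\<dots> = 1 / (2 * pi) * integral {-pi..pi} (\<lambda>t. b (cis t) * (trig_poly n x t * cnj (trig_poly n y t)))"
    using toeplitz_form[OF b x y] by (simp add: y_def)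
  finally have "norm (complex_of_real ((l2 y)\<^sup>2)) = norm (1 / (2 * pi) * integral {-pi..pi} (\<lambda>t. b (cis t) * (trig_poly n x t * cnj (trig_poly n y t))))"
    by (rule arg_cong)
  then have "(l2 y)\<^sup>2 = 1 / (2 * pi) * norm (integral {-pi..pi} (\<lambda>t. b (cis t) * (trig_poly n x t * cnj (trig_poly n y t))))"
    by (simp add: norm_mult norm_divide norm_power)
  also have "\<dots> \<le> 1 / (2 * pi) * integral {-pi..pi} (\<lambda>t. 1 / 2 * (M\<^sup>2 * (norm (trig_poly n x t))\<^sup>2) + 1 / 2 * (norm (trig_poly n y t))\<^sup>2)"
  proof (intro mult_left_mono integral_norm_bound_integral)
    show "(\<lambda>t. b (cis t) * (trig_poly n x t * cnj (trig_poly n y t))) integrable_on {-pi..pi}"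
      by (intro circle_continuous_integrable b continuous_intros)
    show "(\<lambda>t. 1 / 2 * (M\<^sup>2 * (norm (trig_poly n x t))\<^sup>2) + 1 / 2 * (norm (trig_poly n y t))\<^sup>2) integrable_on {-pi..pi}"
      by (intro integrable_continuous_real continuous_intros)
    fix t assume t: "t \<in> {-pi..pi}"
    have "norm (b (cis t) * (trig_poly n x t * cnj (trig_poly n y t))) \<le> M * (norm (trig_poly n x t) * norm (trig_poly n y t))"
      using M[OF t] by (simp add: norm_mult mult_right_mono)
    also have "\<dots> \<le> 1 / 2 * (M\<^sup>2 * (norm (trig_poly n x t))\<^sup>2) + 1 / 2 * (norm (trig_poly n y t))\<^sup>2"
      using sum_squares_bound[of "M * norm (trig_poly n x t)" "norm (trig_poly n y t)"] by (simp add: power_mult_distrib)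
    finally show "norm (b (cis t) * (trig_poly n x t * cnj (trig_poly n y t))) \<le> \<dots>" .
  qed auto
  also have "\<dots> = 1 / (2 * pi) * (1 / 2 * (M\<^sup>2 * integral {-pi..pi} (\<lambda>t. (norm (trig_poly n x t))\<^sup>2)) + 1 / 2 * integral {-pi..pi} (\<lambda>t. (norm (trig_poly n y t))\<^sup>2))"
    by (subst integral_add) (auto intro!: integrable_continuous_real continuous_intros cX)
  also have "\<dots> = 1 / 2 * (M\<^sup>2 * (1 / (2 * pi) * integral {-pi..pi} (\<lambda>t. (norm (trig_poly n x t))\<^sup>2))) + 1 / 2 * (1 / (2 * pi) * integral {-pi..pi} (\<lambda>t. (norm (trig_poly n y t))\<^sup>2))"
    by (simp add: algebra_simps)
  also have "\<dots> = 1 / 2 * (M\<^sup>2 * (l2 x)\<^sup>2) + 1 / 2 * (l2 y)\<^sup>2"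
    unfolding parseval[OF x] parseval[OF y] ..
  finally have "(l2 y)\<^sup>2 \<le> (M * l2 x)\<^sup>2" by (simp add: power_mult_distrib)
  then show "l2 (toeplitz b n *\<^sub>v x) \<le> M * l2 x"
    using M0 l2_nonneg[of x] unfolding y_def by (auto intro: power2_le_imp_le)
qed

lemma toeplitz_real_eigenvalue:
  assumes b: "circle_continuous b" and real: "\<And>t. t \<in> {-pi..pi} \<Longrightarrow> b (cis t) \<in> \<real>" and ev: "eigenvalue (toeplitz b n) k"
  shows "k \<in> \<real>"
proof -
  obtain x where x: "x \<in> carrier_vec n" "x \<noteq> 0\<^sub>v n" "toeplitz b n *\<^sub>v x = k \<cdot>\<^sub>v x"
    using ev carrier_matD[OF toeplitz_carrier] unfolding eigenvalue_def eigenvector_def by metis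
  have "(\<Sum>i<n. cnj (x $ i) * (k \<cdot>\<^sub>v x) $ i) = k * of_real ((l2 x)\<^sup>2)"
  proof -
    have "(\<Sum>i<n. cnj (x $ i) * (k \<cdot>\<^sub>v x) $ i) = (\<Sum>i<n. k * (cnj (x $ i) * x $ i))"
      using x(1) by (intro sum.cong) auto
    then show ?thesis by (simp only: l2_sq[OF x(1)] cnj_mult_self of_real_sum sum_distrib_left)
  qed
  then have "k * of_real ((l2 x)\<^sup>2) = 1 / (2 * pi) * integral {-pi..pi} (\<lambda>t. b (cis t) * (trig_poly n x t * cnj (trig_poly n x t)))"
    using toeplitz_form[OF b x(1) x(1)] x(3) by simp
  also have "integral {-pi..pi} (\<lambda>t. b (cis t) * (trig_poly n x t * cnj (trig_poly n x t)))
     = integral {-pi..pi} (\<lambda>t. complex_of_real (Re (b (cis t)) * (norm (trig_poly n x t))\<^sup>2))"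
    by (rule integral_cong) (use real in \<open>simp add: cnj_mult_self\<close>)
  also have "\<dots> = of_real (integral {-pi..pi} (\<lambda>t. Re (b (cis t)) * (norm (trig_poly n x t))\<^sup>2))"
    by (rule integral_complex_of_real) (use b in \<open>auto simp: circle_continuous_def intro!: integrable_continuous_real continuous_intros\<close>)
  finally have "k * of_real ((l2 x)\<^sup>2) \<in> \<real>" by simp
  then have "k * of_real ((l2 x)\<^sup>2) / of_real ((l2 x)\<^sup>2) \<in> \<real>" by (intro Reals_divide) auto
  then show ?thesis using l2_pos[OF x(1,2)] by simp
qed


section \<open>Eigenvalues of banded Toeplitz matrices\<close>

context laurent_symbol begin

lemma trigsum_laurent: "trigsum m (\<lambda>s. of_real (a s)) f"
  unfolding trigsum_def laurent_def by (simp add: cis_power_int)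

lemma toeplitz_laurent_entry:
  "i < n \<Longrightarrow> j < n \<Longrightarrow> toeplitz f n $$ (i, j) = (if \<bar>int i - int j\<bar> \<le> int m then of_real (a (int i - int j)) else 0)"
  by (simp add: toeplitz_def trigsum_coeff[OF trigsum_laurent])

text \<open>Let $q$ be the polynomial with the entries of an eigenvector as coefficients, in
  reverse order. The eigenvalue equation says that the coefficients $m, \dots, m + n - 1$ of
  $P_\xi q$ vanish; $v$ and $u$ are the parts below and above this gap.\<close>

lemma eigenvector_gap_polynomial:
  assumes ev: "eigenvalue (toeplitz f n) \<xi>"
  shows "\<exists>v u. (\<forall>i\<ge>m. coeff v i = 0) \<and> (\<forall>i\<ge>m. coeff u i = 0) \<and>
    P \<xi> dvd v + [:0, 1:] ^ (n + m) * u \<and> v + [:0, 1:] ^ (n + m) * u \<noteq> 0"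
proof -
  note Tc = toeplitz_carrier[of f n]
  obtain x where x: "x \<in> carrier_vec n" "x \<noteq> 0\<^sub>v n" "toeplitz f n *\<^sub>v x = \<xi> \<cdot>\<^sub>v x"
    using ev carrier_matD[OF Tc] unfolding eigenvalue_def eigenvector_def by metis
  define q where "q = (\<Sum>j<n. monom (x $ j) (n - 1 - j))"
  have cq: "coeff q i = (if i < n then x $ (n - 1 - i) else 0)" for i
  proof -
    have "coeff q i = (\<Sum>j<n. if j = n - 1 - i then (if i < n then x $ (n - 1 - i) else 0) else 0)"
      unfolding q_def coeff_sum by (intro sum.cong) (auto simp: coeff_monom)
    then show ?thesis by simp
  qed
  have "q \<noteq> 0"
  proof
    assume "q = 0"
    have "x = 0\<^sub>v n"
    proof (rule eq_vecI)
      fix i assume "i < dim_vec (0\<^sub>v n :: complex vec)"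
      then show "x $ i = 0\<^sub>v n $ i" using cq[of "n - 1 - i"] \<open>q = 0\<close> by simp
    qed (use x in simp)
    then show False using x(2) by simp
  qed
  define W where "W = P \<xi> * q"
  have "W \<noteq> 0" using \<open>q \<noteq> 0\<close> P_nonzero by (simp add: W_def)
  have gap: "coeff W (m + l) = 0" if l: "l < n" for l
  proof -
    define i where "i = n - 1 - l"
    have i: "i < n" "l = n - 1 - i" using l by (auto simp: i_def)
    have "coeff W (m + l) = (\<Sum>k\<le>m + l. coeff (P \<xi>) (m + l - k) * coeff q k)"
      unfolding W_def by (subst mult.commute, subst coeff_mult) (simp add: mult.commute)
    also have "\<dots> = (\<Sum>k<n. (if k \<le> m + l then coeff (P \<xi>) (m + l - k) else 0) * coeff q k)"
    proof -
      have "(\<Sum>k\<le>m + l. coeff (P \<xi>) (m + l - k) * coeff q k) = (\<Sum>k\<le>m + l + n. (if k \<le> m + l then coeff (P \<xi>) (m + l - k) else 0) * coeff q k)"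
        by (rule sum.mono_neutral_cong_left) auto
      also have "\<dots> = (\<Sum>k<n. (if k \<le> m + l then coeff (P \<xi>) (m + l - k) else 0) * coeff q k)"
        by (rule sum.mono_neutral_right) (auto simp: cq)
      finally show ?thesis .
    qed
    also have "\<dots> = (\<Sum>j<n. (if n - 1 - j \<le> m + l then coeff (P \<xi>) (m + l - (n - 1 - j)) else 0) * x $ j)"
      by (rule sum.reindex_bij_witness[of _ "\<lambda>j. n - 1 - j" "\<lambda>k. n - 1 - k"]) (auto simp: cq)
    also have "\<dots> = (\<Sum>j<n. (toeplitz f n $$ (i, j) - (if i = j then \<xi> else 0)) * x $ j)"
    proof (rule sum.cong[OF refl])
      fix j assume "j \<in> {..<n}"
      then have j: "j < n" by simp
      have "(if n - 1 - j \<le> m + l then coeff (P \<xi>) (m + l - (n - 1 - j)) else 0) = toeplitz f n $$ (i, j) - (if i = j then \<xi> else 0)"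
      proof (cases "i \<le> m + j")
        case True
        have k: "m + l - (n - 1 - j) = m + j - i" "n - 1 - j \<le> m + l" using i j True by auto
        have e: "int m - int (m + j - i) = int i - int j" using True by (simp add: of_nat_diff)
        have "m + j - i \<le> 2 * m \<longleftrightarrow> \<bar>int i - int j\<bar> \<le> int m" using True by (auto simp: abs_le_iff)
        moreover have "m + j - i = m \<longleftrightarrow> i = j" using True by auto
        ultimately show ?thesis using k(2) unfolding k(1) coeff_shifted_poly e toeplitz_laurent_entry[OF i(1) j] by simp
      next
        case False
        have "\<not> n - 1 - j \<le> m + l" using i j False by auto
        moreover have "\<not> \<bar>int i - int j\<bar> \<le> int m" "i \<noteq> j" using False by auto
        ultimately show ?thesis unfolding toeplitz_laurent_entry[OF i(1) j] by simp
      qed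
      then show "(if n - 1 - j \<le> m + l then coeff (P \<xi>) (m + l - (n - 1 - j)) else 0) * x $ j = (toeplitz f n $$ (i, j) - (if i = j then \<xi> else 0)) * x $ j"
        by (rule arg_cong)
    qed
    also have "\<dots> = (\<Sum>j<n. toeplitz f n $$ (i, j) * x $ j) - (\<Sum>j<n. (if i = j then \<xi> else 0) * x $ j)"
      by (simp add: left_diff_distrib sum_subtractf)
    also have "(\<Sum>j<n. toeplitz f n $$ (i, j) * x $ j) = (toeplitz f n *\<^sub>v x) $ i"
      using i x(1) carrier_matD[OF Tc] by (simp add: scalar_prod_def atLeast0LessThan)
    also have "(\<Sum>j<n. (if i = j then \<xi> else 0) * x $ j) = \<xi> * x $ i"
    proof -
      have "(\<Sum>j<n. (if i = j then \<xi> else 0) * x $ j) = (\<Sum>j<n. if i = j then \<xi> * x $ j else 0)"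
        by (intro sum.cong) auto
      then show ?thesis using i(1) by simp
    qed
    finally show ?thesis using x i(1) by simp
  qed
  define v where "v = poly_cutoff m W"
  define u where "u = poly_shift (n + m) W"
  have "v + [:0, 1:] ^ (n + m) * u = W"
  proof (rule poly_eqI)
    fix i
    have "coeff ([:0, 1:] ^ (n + m) * u) i = (if i < n + m then 0 else coeff u (i - (n + m)))"
      unfolding monom_altdef[of 1, simplified, symmetric] by (simp add: coeff_monom_mult)
    then show "coeff (v + [:0, 1:] ^ (n + m) * u) i = coeff W i"
      using gap[of "i - m"] by (auto simp: v_def u_def coeff_poly_cutoff coeff_poly_shift)
  qed
  moreover have "coeff u i = 0" if "i \<ge> m" for i
  proof -
    have "degree W = 2 * m + degree q" using \<open>q \<noteq> 0\<close> P_nonzero by (simp add: W_def degree_mult_eq degree_P)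
    moreover have "degree q \<le> n - 1" by (rule degree_le) (auto simp: cq)
    moreover have "n > 0" using \<open>q \<noteq> 0\<close> by (auto simp: q_def)
    ultimately show ?thesis using that by (simp add: u_def coeff_poly_shift coeff_eq_0)
  qed
  moreover have "coeff v i = 0" if "i \<ge> m" for i using that by (simp add: v_def coeff_poly_cutoff)
  ultimately show ?thesis using \<open>W \<noteq> 0\<close> by (intro exI[of _ v] exI[of _ u]) (simp add: W_def)
qed

text \<open>The lower bound of \<open>no_gap_multiple\<close> fails for large $n$, since
  $(\sigma/\tau)^n$ beats the power of $n$, uniformly in the levels whose middle moduli are
  separated by $\sigma < \tau$.\<close>

lemma no_eigenvalue_if_gap:
  assumes "0 < \<sigma>" "\<sigma> < \<tau>"
  shows "\<forall>\<^sub>F n in sequentially. \<forall>\<xi>. inner_mod \<xi> \<le> \<sigma> \<longrightarrow> \<tau> \<le> outer_mod \<xi> \<longrightarrow> \<not> eigenvalue (toeplitz f n) \<xi>"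
proof -
  define C where "C = ((2 + 1 / \<sigma>) * (2 + \<tau>)) ^ m * (max 1 \<sigma> * max 1 (1 / \<tau>)) ^ m"
  define \<theta> where "\<theta> = \<sigma> / \<tau>"
  have \<theta>: "0 < \<theta>" "\<theta> < 1" using assms by (auto simp: \<theta>_def)
  have "(\<lambda>n. C * real (n + m + m + 1) ^ (2 * m) * \<theta> ^ (n + m)) \<longlonglongrightarrow> 0"
  proof -
    define k where "k = 2 * m"
    \<comment> \<open>A $2m$-th root of the ratio distributes the geometric decay over the $2m$
      linear factors.\<close>
    define \<eta> where "\<eta> = root k \<theta>"
    have k: "k > 0" using m_pos by (simp add: k_def)
    have \<eta>: "0 < \<eta>" "\<eta> < 1" "\<eta> ^ k = \<theta>" using \<theta> k by (auto simp: \<eta>_def real_root_lt_1_iff)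
    have l0: "(\<lambda>n. real n * \<eta> ^ n + real (k + 1) * \<eta> ^ n) \<longlonglongrightarrow> 0 + real (k + 1) * 0"
      using \<eta> by (intro tendsto_intros LIMSEQ_power_zero powser_times_n_limit_0) auto
    have "(\<lambda>n. C * (real n * \<eta> ^ n + real (k + 1) * \<eta> ^ n) ^ k * \<theta> ^ m) \<longlonglongrightarrow> C * (0 + real (k + 1) * 0) ^ k * \<theta> ^ m"
      by (intro tendsto_mult tendsto_power tendsto_const l0)
    moreover have eq: "C * (real n * \<eta> ^ n + real (k + 1) * \<eta> ^ n) ^ k * \<theta> ^ m = C * real (n + m + m + 1) ^ (2 * m) * \<theta> ^ (n + m)" for n
    proof -
      have "real n * \<eta> ^ n + real (k + 1) * \<eta> ^ n = real (n + m + m + 1) * \<eta> ^ n"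
        by (simp add: k_def algebra_simps)
      moreover have "(\<eta> ^ n) ^ k = \<theta> ^ n" using \<eta>(3) by (simp add: power_mult[symmetric] mult.commute[of n] flip: \<eta>(3))
      ultimately show ?thesis unfolding k_def[symmetric] by (simp add: power_mult_distrib power_add)
    qed
    moreover have "C * (0 + real (k + 1) * 0) ^ k * \<theta> ^ m = 0" using k by simp
    ultimately show ?thesis by (simp only: eq)
  qed
  then have "\<forall>\<^sub>F n in sequentially. C * real (n + m + m + 1) ^ (2 * m) * \<theta> ^ (n + m) < 1"
    by (rule order_tendstoD) simp
  then show ?thesis
  proof (rule eventually_mono, intro allI impI notI)
    fix n \<xi> assume small: "C * real (n + m + m + 1) ^ (2 * m) * \<theta> ^ (n + m) < 1"
      and N: "inner_mod \<xi> \<le> \<sigma>" "\<tau> \<le> outer_mod \<xi>" and ev: "eigenvalue (toeplitz f n) \<xi>"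
    obtain v u where uv: "\<forall>i\<ge>m. coeff v i = 0" "\<forall>i\<ge>m. coeff u i = 0"
      "P \<xi> dvd v + [:0, 1:] ^ (n + m) * u" "v + [:0, 1:] ^ (n + m) * u \<noteq> 0"
      using eigenvector_gap_polynomial[OF ev] by (elim exE conjE)
    have dP: "prod_linear (roots \<xi>) dvd P \<xi>" by (subst P_factor) (rule dvd_smult[OF dvd_refl])
    have "prod_linear (take m (roots \<xi>) @ drop m (roots \<xi>)) = prod_linear (take m (roots \<xi>)) * prod_linear (drop m (roots \<xi>))"
      by (simp only: map_append prod_list.append)
    then have split: "prod_linear (roots \<xi>) = prod_linear (take m (roots \<xi>)) * prod_linear (drop m (roots \<xi>))"
      by (simp only: append_take_drop_id)
    have d: "prod_linear (take m (roots \<xi>)) dvd P \<xi>" "prod_linear (drop m (roots \<xi>)) dvd P \<xi>"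
      using dvd_mult_left dvd_mult_right dP unfolding split by blast+
    have "1 \<le> C * real (n + m + m + 1) ^ (2 * m) * \<theta> ^ (n + m)"
      unfolding C_def \<theta>_def
    proof (rule no_gap_multiple[where us = "take m (roots \<xi>)" and ws = "drop m (roots \<xi>)" and u = u and v = v])
      fix w assume "w \<in> set (take m (roots \<xi>))"
      then obtain j where "j < m" "w = roots \<xi> ! j" by (auto simp: in_set_conv_nth)
      then have "norm w \<le> inner_mod \<xi>" unfolding inner_mod_def by (auto intro!: roots_mono)
      then show "norm w \<le> \<sigma>" using N by simp
    next
      fix w assume "w \<in> set (drop m (roots \<xi>))"
      then obtain j where "j < m" "w = roots \<xi> ! (m + j)" by (auto simp: in_set_conv_nth length_roots)
      then have "outer_mod \<xi> \<le> norm w" unfolding outer_mod_def by (auto intro!: roots_mono)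
      then show "\<tau> \<le> norm w" using N by simp
    qed (use assms uv m_pos d length_roots in \<open>auto intro: dvd_trans\<close>)
    then show False using small by simp
  qed
qed

end

context star_curve_symbol begin

text \<open>Otherwise the eigenvalues have a non-real limit point. The middle moduli differ there,
  hence with a uniform gap along a subsequence, which excludes eigenvalues.\<close>

lemma eigenvalues_approach_real:
  assumes bound: "\<And>n \<xi>. eigenvalue (toeplitz f n) \<xi> \<Longrightarrow> norm \<xi> \<le> M" and "\<delta> > 0"
  shows "\<forall>\<^sub>F n in sequentially. \<forall>\<xi>. eigenvalue (toeplitz f n) \<xi> \<longrightarrow> \<bar>Im \<xi>\<bar> < \<delta>"
proof (rule ccontr)
  assume "\<not> ?thesis"
  then have "\<exists>\<^sub>F n in sequentially. \<exists>\<xi>. eigenvalue (toeplitz f n) \<xi> \<and> \<not> \<bar>Im \<xi>\<bar> < \<delta>"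
    by (simp add: frequently_def)
  from frequently_subseq[OF this] obtain \<psi> :: "nat \<Rightarrow> nat"
    where \<psi>: "strict_mono \<psi>" "\<And>k. \<exists>\<xi>. eigenvalue (toeplitz f (\<psi> k)) \<xi> \<and> \<not> \<bar>Im \<xi>\<bar> < \<delta>" by blast
  then obtain x where x: "\<And>k. eigenvalue (toeplitz f (\<psi> k)) (x k)" "\<And>k. \<bar>Im (x k)\<bar> \<ge> \<delta>"
    by (metis not_less)
  have "bounded (range x)" using bound x(1) by (auto simp: bounded_iff)
  then obtain \<xi> \<kappa> where \<kappa>: "strict_mono (\<kappa> :: nat \<Rightarrow> nat)" "(x \<circ> \<kappa>) \<longlonglongrightarrow> \<xi>"
    using bounded_imp_convergent_subsequence by blast
  obtain \<phi> where \<phi>: "strict_mono (\<phi> :: nat \<Rightarrow> nat)" "(\<lambda>k. inner_mod ((x \<circ> \<kappa>) (\<phi> k))) \<longlonglongrightarrow> inner_mod \<xi>" "(\<lambda>k. outer_mod ((x \<circ> \<kappa>) (\<phi> k))) \<longlonglongrightarrow> outer_mod \<xi>"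
    using roots_limit[OF \<kappa>(2)] by metis
  have "(\<lambda>k. \<bar>Im ((x \<circ> \<kappa>) k)\<bar>) \<longlonglongrightarrow> \<bar>Im \<xi>\<bar>" by (intro tendsto_intros \<kappa>(2))
  then have "\<bar>Im \<xi>\<bar> \<ge> \<delta>" by (rule LIMSEQ_le_const) (use x(2) in auto)
  then have "\<xi> \<notin> \<real>" using \<open>\<delta> > 0\<close> by (auto simp: complex_is_Real_iff)
  then have "inner_mod \<xi> < outer_mod \<xi>" by (rule nonreal_separation)
  then obtain \<tau> where \<tau>: "inner_mod \<xi> < \<tau>" "\<tau> < outer_mod \<xi>" using dense by blast
  then obtain \<sigma> where \<sigma>: "inner_mod \<xi> < \<sigma>" "\<sigma> < \<tau>" using dense by blast
  have "0 < \<sigma>" using \<sigma>(1) by (smt (verit) inner_mod_def norm_ge_zero)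
  have "\<forall>\<^sub>F k in sequentially. inner_mod ((x \<circ> \<kappa>) (\<phi> k)) < \<sigma>" "\<forall>\<^sub>F k in sequentially. \<tau> < outer_mod ((x \<circ> \<kappa>) (\<phi> k))"
    using order_tendstoD(2)[OF \<phi>(2) \<sigma>(1)] order_tendstoD(1)[OF \<phi>(3) \<tau>(2)] .
  moreover have "filterlim (\<lambda>k. \<psi> (\<kappa> (\<phi> k))) at_top sequentially"
    using filterlim_subseq[OF strict_mono_o[OF \<psi>(1) strict_mono_o[OF \<kappa>(1) \<phi>(1)]]] by (simp add: o_def)
  then have "\<forall>\<^sub>F k in sequentially. \<forall>\<xi>. inner_mod \<xi> \<le> \<sigma> \<longrightarrow> \<tau> \<le> outer_mod \<xi> \<longrightarrow> \<not> eigenvalue (toeplitz f (\<psi> (\<kappa> (\<phi> k)))) \<xi>"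
    using no_eigenvalue_if_gap[OF \<open>0 < \<sigma>\<close> \<sigma>(2)] by (rule eventually_compose_filterlim[rotated])
  ultimately have "\<forall>\<^sub>F k in sequentially. False"
  proof eventually_elim
    case (elim k)
    then show ?case using x(1)[of "\<kappa> (\<phi> k)"] by auto
  qed
  then show False by simp
qed

end


section \<open>Limits of normalised traces\<close>

lemma circle_continuous_bounded:
  assumes "circle_continuous b"
  obtains M where "M > 0" "\<And>t. t \<in> {-pi..pi} \<Longrightarrow> norm (b (cis t)) \<le> M"
proof -
  have "compact ((\<lambda>t. b (cis t)) ` {-pi..pi})"
    using assms unfolding circle_continuous_def by (intro compact_continuous_image) auto
  then have "bounded ((\<lambda>t. b (cis t)) ` {-pi..pi})" by (rule compact_imp_bounded)
  then show ?thesis using that unfolding bounded_pos by (auto simp: image_iff)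
qed

lemma norm_symbol_coeff_le:
  assumes "circle_continuous b" "\<And>t. t \<in> {-pi..pi} \<Longrightarrow> norm (b (cis t)) \<le> M"
  shows "norm (symbol_coeff b k) \<le> M"
proof -
  have "norm (integral {-pi..pi} (\<lambda>t. b (cis t) * cis (of_int k * t))) \<le> M * (pi - - pi)"
    by (rule integral_bound) (use assms in \<open>auto simp: circle_continuous_def norm_mult intro!: continuous_intros\<close>)
  then show ?thesis unfolding symbol_coeff_def by (simp add: norm_mult norm_divide field_simps)
qed

lemma symbol_coeff_diff:
  assumes "circle_continuous b" "circle_continuous b'"
  shows "symbol_coeff (\<lambda>z. b z - b' z) k = symbol_coeff b k - symbol_coeff b' k"
proof -
  have i: "(\<lambda>t. x (cis t) * cis (of_int k * t)) integrable_on {-pi..pi}" if "circle_continuous x" for x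
    by (intro circle_continuous_integrable that continuous_on_cis_times)
  show ?thesis
    unfolding symbol_coeff_def left_diff_distrib integral_diff[OF i[OF assms(1)] i[OF assms(2)]]
    by (rule right_diff_distrib)
qed

lemma circle_continuous_diff: "circle_continuous b \<Longrightarrow> circle_continuous b' \<Longrightarrow> circle_continuous (\<lambda>z. b z - b' z)"
  unfolding circle_continuous_def by (intro continuous_intros)

text \<open>All but a bounded number of diagonal entries of the power equal the constant
  coefficient, and the exceptional ones are bounded.\<close>

lemma toeplitz_moment_trigsum:
  assumes T: "trigsum D c b"
  shows "(\<lambda>n. mat_trace (toeplitz b n ^\<^sub>m l) / of_nat n) \<longlonglongrightarrow> symbol_coeff (\<lambda>z. b z ^ l) 0"
proof -
  have cb: "circle_continuous b" by (rule trigsum_circle_continuous[OF T])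
  obtain M where M: "M > 0" "\<And>t. t \<in> {-pi..pi} \<Longrightarrow> norm (b (cis t)) \<le> M"
    using circle_continuous_bounded[OF cb] by blast
  define c0 where "c0 = symbol_coeff (\<lambda>z. b z ^ l) 0"
  define E where "E = M ^ l + norm c0"
  have E0: "E \<ge> 0" using M by (simp add: E_def)
  have bound: "norm (mat_trace (toeplitz b n ^\<^sub>m l) / of_nat n - c0) \<le> 2 * real (l * D) * E / real n" if "n > 0" for n
  proof -
    let ?A = "toeplitz b n ^\<^sub>m l"
    have cA: "?A \<in> carrier_mat n n" by simp
    \<comment> \<open>the rows in which the truncation may be felt\<close>
    define Bad where "Bad = {..<l * D} \<union> {n - l * D..<n}"
    have "mat_trace ?A - of_nat n * c0 = (\<Sum>i<n. ?A $$ (i, i) - c0)"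
      using carrier_matD(1)[OF cA] by (simp add: mat_trace_def sum_subtractf)
    also have "norm \<dots> \<le> (\<Sum>i<n. if i \<in> Bad then E else 0)"
    proof (rule sum_norm_le)
      fix i assume "i \<in> {..<n}"
      then have i: "i < n" by simp
      show "norm (?A $$ (i, i) - c0) \<le> (if i \<in> Bad then E else 0)"
      proof (cases "i \<in> Bad")
        case True
        have "norm (?A $$ (i, i)) \<le> M ^ l"
          by (rule l2_bounded_diag[OF cA l2_bounded_pow[OF toeplitz_carrier toeplitz_l2_bounded[OF cb M(2,1)]] i]) (use M in auto)
        then show ?thesis using True norm_triangle_ineq4[of "?A $$ (i, i)" c0] by (simp add: E_def)
      next
        case False
        then have "l * D \<le> i" "i + l * D < n" using i by (auto simp: Bad_def)
        then show ?thesis using toeplitz_pow_entry[OF T i] False by (simp add: c0_def)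
      qed
    qed
    also have "\<dots> = real (card ({..<n} \<inter> Bad)) * E" by (simp add: sum.If_cases)
    also have "\<dots> \<le> real (2 * (l * D)) * E"
    proof (intro mult_right_mono E0 of_nat_mono)
      have "card ({..<n} \<inter> Bad) \<le> card Bad" by (intro card_mono) (auto simp: Bad_def)
      also have "\<dots> \<le> card {..<l * D} + card {n - l * D..<n}" unfolding Bad_def by (rule card_Un_le)
      also have "\<dots> \<le> 2 * (l * D)" by simp
      finally show "card ({..<n} \<inter> Bad) \<le> 2 * (l * D)" .
    qed
    finally have "norm (mat_trace ?A - of_nat n * c0) / real n \<le> 2 * real (l * D) * E / real n"
      by (intro divide_right_mono) auto
    moreover have "mat_trace ?A / of_nat n - c0 = (mat_trace ?A - of_nat n * c0) / of_nat n"
      using that by (simp add: field_simps)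
    ultimately show ?thesis by (simp add: norm_divide)
  qed
  have "(\<lambda>n. mat_trace (toeplitz b n ^\<^sub>m l) / of_nat n - c0) \<longlonglongrightarrow> 0"
  proof (rule Lim_null_comparison)
    show "\<forall>\<^sub>F n in sequentially. norm (mat_trace (toeplitz b n ^\<^sub>m l) / of_nat n - c0) \<le> 2 * real (l * D) * E / real n"
      using eventually_gt_at_top[of 0] by (rule eventually_mono) (rule bound)
    show "(\<lambda>n. 2 * real (l * D) * E / real n) \<longlonglongrightarrow> 0" by (rule lim_const_over_n)
  qed
  then show ?thesis unfolding c0_def by (simp only: LIM_zero_iff)
qed

lemma norm_power_diff_le:
  fixes x y :: complex
  assumes "norm x \<le> C" "norm y \<le> C" "norm (x - y) \<le> e" "e \<ge> 0"
  shows "norm (x ^ l - y ^ l) \<le> real l * C ^ (l - 1) * e"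
proof (induction l)
  case (Suc l)
  have C0: "C \<ge> 0" using assms(1) norm_ge_zero order_trans by blast
  have "x ^ Suc l - y ^ Suc l = x ^ l * (x - y) + (x ^ l - y ^ l) * y" by (simp add: algebra_simps)
  also have "norm \<dots> \<le> norm x ^ l * norm (x - y) + norm (x ^ l - y ^ l) * norm y"
    by (intro order.trans[OF norm_triangle_ineq]) (simp add: norm_mult norm_power)
  also have "\<dots> \<le> C ^ l * e + real l * C ^ (l - 1) * e * C"
    using assms Suc C0 by (intro add_mono mult_mono power_mono) auto
  also have "\<dots> = real (Suc l) * C ^ (Suc l - 1) * e"
    by (cases l) (auto simp: algebra_simps)
  finally show ?case .
qed (use assms in simp)

text \<open>Powers and normalised traces are Lipschitz in the operator norm on bounded sets, and
  this norm is controlled by the supremum of the symbol.\<close>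

lemma toeplitz_moment_uniform_limit:
  assumes cb: "circle_continuous b"
    and approx: "\<And>e. e > 0 \<Longrightarrow> \<exists>D c h. trigsum D c h \<and> (\<forall>t\<in>{-pi..pi}. norm (b (cis t) - h (cis t)) \<le> e)"
  shows "(\<lambda>n. mat_trace (toeplitz b n ^\<^sub>m l) / of_nat n) \<longlonglongrightarrow> symbol_coeff (\<lambda>z. b z ^ l) 0"
proof (rule tendstoI)
  fix e :: real assume "e > 0"
  obtain M where M: "M > 0" "\<And>t. t \<in> {-pi..pi} \<Longrightarrow> norm (b (cis t)) \<le> M"
    using circle_continuous_bounded[OF cb] by blast
  define C where "C = M + 1"
  define L where "L = real l * C ^ (l - 1) + 1"
  have L: "L > 0" using M(1) by (simp add: L_def C_def add_nonneg_pos)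
  define \<epsilon> where "\<epsilon> = min 1 (e / (3 * L))"
  have \<epsilon>: "0 < \<epsilon>" "\<epsilon> \<le> 1" "L * \<epsilon> \<le> e / 3"
  proof -
    show "0 < \<epsilon>" "\<epsilon> \<le> 1" using \<open>e > 0\<close> L by (auto simp: \<epsilon>_def)
    have "L * \<epsilon> \<le> L * (e / (3 * L))" using L by (intro mult_left_mono) (auto simp: \<epsilon>_def)
    then show "L * \<epsilon> \<le> e / 3" using L by simp
  qed
  obtain D c h where T: "trigsum D c h" and h: "\<And>t. t \<in> {-pi..pi} \<Longrightarrow> norm (b (cis t) - h (cis t)) \<le> \<epsilon>"
    using approx[OF \<epsilon>(1)] by blast
  have ch: "circle_continuous h" by (rule trigsum_circle_continuous[OF T])
  have bC: "norm (b (cis t)) \<le> C" if "t \<in> {-pi..pi}" for t using M(2)[OF that] by (simp add: C_def)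
  have hC: "norm (h (cis t)) \<le> C" if "t \<in> {-pi..pi}" for t
  proof -
    have "norm (h (cis t)) \<le> norm (b (cis t)) + norm (b (cis t) - h (cis t))"
      using norm_triangle_ineq4[of "b (cis t)" "b (cis t) - h (cis t)"] by simp
    then show ?thesis using M(2)[OF that] h[OF that] \<epsilon>(2) by (simp add: C_def)
  qed
  have C0: "C > 0" using M(1) by (simp add: C_def)
  define K where "K = real l * C ^ (l - 1) * \<epsilon>"
  have K: "K \<le> e / 3" using \<epsilon> by (simp add: K_def L_def algebra_simps)
  have trace_close: "norm (mat_trace (toeplitz b n ^\<^sub>m l) / of_nat n - mat_trace (toeplitz h n ^\<^sub>m l) / of_nat n) \<le> K"
    if n: "n > 0" for n
  proof -
    let ?A = "toeplitz b n" and ?B = "toeplitz h n"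
    have "toeplitz (\<lambda>z. b z - h z) n = ?A - ?B"
      by (rule eq_matI) (auto simp: toeplitz_def symbol_coeff_diff[OF cb ch])
    then have "l2_bounded (?A - ?B) \<epsilon>" using toeplitz_l2_bounded[OF circle_continuous_diff[OF cb ch] h \<epsilon>(1), of n] by simp
    then have o: "l2_bounded (?A ^\<^sub>m l - ?B ^\<^sub>m l) K" unfolding K_def
      by (intro l2_bounded_pow_diff[of _ n] toeplitz_carrier toeplitz_l2_bounded cb ch bC hC C0) (use C0 \<epsilon> in auto)
    have cA: "?A ^\<^sub>m l \<in> carrier_mat n n" and cB: "?B ^\<^sub>m l \<in> carrier_mat n n" by auto
    have "mat_trace (?A ^\<^sub>m l) - mat_trace (?B ^\<^sub>m l) = (\<Sum>i<n. (?A ^\<^sub>m l - ?B ^\<^sub>m l) $$ (i, i))"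
      using carrier_matD[OF cA] carrier_matD[OF cB] by (simp add: mat_trace_def sum_subtractf)
    also have "norm \<dots> \<le> (\<Sum>i<n. K)"
      by (rule sum_norm_le) (rule l2_bounded_diag[OF minus_carrier_mat[OF cB] o], simp)
    finally have "norm (mat_trace (?A ^\<^sub>m l) - mat_trace (?B ^\<^sub>m l)) / real n \<le> K" using n by (simp add: field_simps)
    moreover have "mat_trace (?A ^\<^sub>m l) / of_nat n - mat_trace (?B ^\<^sub>m l) / of_nat n = (mat_trace (?A ^\<^sub>m l) - mat_trace (?B ^\<^sub>m l)) / of_nat n"
      by (simp add: diff_divide_distrib)
    ultimately show ?thesis by (simp add: norm_divide)
  qed
  have coeff_close: "norm (symbol_coeff (\<lambda>z. b z ^ l) 0 - symbol_coeff (\<lambda>z. h z ^ l) 0) \<le> K"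
    unfolding symbol_coeff_diff[OF circle_continuous_pow[OF cb] circle_continuous_pow[OF ch], symmetric] K_def
    by (intro norm_symbol_coeff_le circle_continuous_diff circle_continuous_pow cb ch norm_power_diff_le bC hC h) (use \<epsilon> in auto)
  have "\<forall>\<^sub>F n in sequentially. dist (mat_trace (toeplitz h n ^\<^sub>m l) / of_nat n) (symbol_coeff (\<lambda>z. h z ^ l) 0) < e / 3"
    by (rule tendstoD[OF toeplitz_moment_trigsum[OF T]]) (use \<open>e > 0\<close> in simp)
  then show "\<forall>\<^sub>F n in sequentially. dist (mat_trace (toeplitz b n ^\<^sub>m l) / of_nat n) (symbol_coeff (\<lambda>z. b z ^ l) 0) < e"
    using eventually_gt_at_top[of 0]
  proof eventually_elim
    case (elim n)
    have tri: "dist x y < e" if "norm (x - x') \<le> K" "dist x' y' < e / 3" "norm (y - y') \<le> K" for x y x' y' :: complex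
    proof -
      have "dist x y \<le> dist x x' + dist x' y' + dist y' y"
        using dist_triangle[of x y x'] dist_triangle[of x' y y'] by linarith
      then show ?thesis using that K by (simp add: dist_norm norm_minus_commute)
    qed
    show ?case by (rule tri[OF trace_close elim(1) coeff_close]) (rule elim(2))
  qed
qed

text \<open>One step of Horner's scheme for polynomials in $\cos t$.\<close>

lemma trigsum_cos_step:
  assumes "trigsum D c b"
  shows "\<exists>c'. trigsum (D + 1) c' (\<lambda>z. \<alpha> + of_real (Re z) * b z)"
proof -
  define d where "d s = (if \<bar>s\<bar> \<le> int D then c s else 0)" for s
  define c' where "c' s = (if s = 0 then \<alpha> else 0) + (d (s - 1) + d (s + 1)) / 2" for s
  have "trigsum (D + 1) c' (\<lambda>z. \<alpha> + of_real (Re z) * b z)"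
    unfolding trigsum_def
  proof
    fix t
    let ?e = "\<lambda>s::int. cis (- of_int s * t)"
    have b: "b (cis t) = (\<Sum>s = - int D..int D. d s * ?e s)"
      using assms unfolding trigsum_def by (auto simp: d_def intro!: sum.cong)
    have cos: "of_real (cos t) * ?e s = (?e (s + 1) + ?e (s - 1)) / 2" for s
    proof -
      have "of_real (cos t) = (cis t + cis (- t)) / 2" by (simp add: complex_eq_iff)
      then show ?thesis by (simp add: algebra_simps cis_mult add_divide_distrib)
    qed
    have "of_real (cos t) * b (cis t) = (\<Sum>s = - int D..int D. d s * ?e (s + 1) / 2) + (\<Sum>s = - int D..int D. d s * ?e (s - 1) / 2)"
      unfolding b sum_distrib_left sum.distrib[symmetric]
    proof (rule sum.cong[OF refl])
      fix s
      have "of_real (cos t) * (d s * ?e s) = d s * (of_real (cos t) * ?e s)" by (rule mult.left_commute)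
      then show "of_real (cos t) * (d s * ?e s) = d s * ?e (s + 1) / 2 + d s * ?e (s - 1) / 2"
        unfolding cos by (simp only: distrib_left add_divide_distrib times_divide_eq_right)
    qed
    also have "(\<Sum>s = - int D..int D. d s * ?e (s + 1) / 2) = (\<Sum>s = - int (D + 1)..int (D + 1). d (s - 1) * ?e s / 2)"
    proof -
      have "(\<Sum>s = - int D..int D. d s * ?e (s + 1) / 2) = (\<Sum>s = - int D + 1..int D + 1. d (s - 1) * ?e s / 2)"
        by (rule sum.reindex_bij_witness[of _ "\<lambda>s. s - 1" "\<lambda>s. s + 1"]) auto
      also have "\<dots> = (\<Sum>s = - int (D + 1)..int (D + 1). d (s - 1) * ?e s / 2)"
        by (rule sum.mono_neutral_left) (auto simp: d_def)
      finally show ?thesis .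
    qed
    also have "(\<Sum>s = - int D..int D. d s * ?e (s - 1) / 2) = (\<Sum>s = - int (D + 1)..int (D + 1). d (s + 1) * ?e s / 2)"
    proof -
      have "(\<Sum>s = - int D..int D. d s * ?e (s - 1) / 2) = (\<Sum>s = - int D - 1..int D - 1. d (s + 1) * ?e s / 2)"
        by (rule sum.reindex_bij_witness[of _ "\<lambda>s. s + 1" "\<lambda>s. s - 1"]) auto
      also have "\<dots> = (\<Sum>s = - int (D + 1)..int (D + 1). d (s + 1) * ?e s / 2)"
        by (rule sum.mono_neutral_left) (auto simp: d_def)
      finally show ?thesis .
    qed
    finally have 1: "of_real (cos t) * b (cis t) = (\<Sum>s = - int (D + 1)..int (D + 1). (d (s - 1) + d (s + 1)) / 2 * ?e s)"
      by (simp only: sum.distrib[symmetric] distrib_right add_divide_distrib times_divide_eq_left)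
    have 2: "\<alpha> = (\<Sum>s = - int (D + 1)..int (D + 1). (if s = 0 then \<alpha> else 0) * ?e s)"
    proof -
      have "(\<Sum>s = - int (D + 1)..int (D + 1). (if s = 0 then \<alpha> else 0) * ?e s) = (\<Sum>s = - int (D + 1)..int (D + 1). if s = 0 then \<alpha> else 0)"
        by (rule sum.cong) auto
      then show ?thesis by simp
    qed
    have "\<alpha> + of_real (cos t) * b (cis t) = (\<Sum>s = - int (D + 1)..int (D + 1). c' s * ?e s)"
      unfolding c'_def distrib_right sum.distrib by (subst 2, subst 1) (simp only: distrib_right sum.distrib)
    then show "\<alpha> + of_real (Re (cis t)) * b (cis t) = (\<Sum>s = - int (D + 1)..int (D + 1). c' s * ?e s)"
      by simp
  qed
  then show ?thesis by blast
qed

lemma trigsum_poly_cos: "\<exists>D c. trigsum D c (\<lambda>z. of_real (poly p (Re z)))"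
proof (induction p)
  case 0
  have "trigsum 0 (\<lambda>_. 0) (\<lambda>z. of_real (poly 0 (Re z)))" by (simp add: trigsum_def)
  then show ?case by blast
next
  case (pCons \<alpha> p)
  then obtain D c where "trigsum D c (\<lambda>z. of_real (poly p (Re z)))" by blast
  from trigsum_cos_step[OF this, of "of_real \<alpha>"] show ?case by auto
qed

lemma real_poly_approx:
  fixes G :: "real \<Rightarrow> real"
  assumes "continuous_on {u..v} G" "e > 0"
  obtains p :: "real poly" where "\<And>x. x \<in> {u..v} \<Longrightarrow> \<bar>G x - poly p x\<bar> < e"
proof -
  obtain g where g: "real_polynomial_function g" "\<And>x. x \<in> {u..v} \<Longrightarrow> \<bar>G x - g x\<bar> < e"
    using Stone_Weierstrass_real_polynomial_function[OF _ assms] compact_Icc by blast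
  obtain \<alpha> n where "g = (\<lambda>x. \<Sum>i\<le>n. \<alpha> i * x ^ i)"
    using g(1) unfolding real_polynomial_function_iff_sum by blast
  then have "g x = poly (\<Sum>i\<le>n. monom (\<alpha> i) i) x" for x :: real by (simp add: poly_sum poly_monom)
  then show ?thesis using g(2) that by metis
qed

lemma toeplitz_moment_even:
  fixes G :: "real \<Rightarrow> real"
  assumes G: "continuous_on {-1..1} G" and b: "\<And>t. b (cis t) = of_real (G (cos t))"
  shows "(\<lambda>n. mat_trace (toeplitz b n ^\<^sub>m l) / of_nat n) \<longlonglongrightarrow> symbol_coeff (\<lambda>z. b z ^ l) 0"
proof (rule toeplitz_moment_uniform_limit)
  show "circle_continuous b" unfolding circle_continuous_def b
    by (intro continuous_intros continuous_on_compose2[OF G]) auto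
  fix e :: real assume "e > 0"
  obtain p where p: "\<And>x. x \<in> {-1..1} \<Longrightarrow> \<bar>G x - poly p x\<bar> < e" using real_poly_approx[OF G \<open>e > 0\<close>] by blast
  obtain D c where T: "trigsum D c (\<lambda>z. of_real (poly p (Re z)))" using trigsum_poly_cos by blast
  have "norm (b (cis t) - of_real (poly p (Re (cis t)))) \<le> e" for t
    using p[of "cos t"] by (simp add: b norm_of_real flip: of_real_diff)
  then show "\<exists>D c h. trigsum D c h \<and> (\<forall>t\<in>{-pi..pi}. norm (b (cis t) - h (cis t)) \<le> e)"
    using T by blast
qed


section \<open>From moments to the density of states\<close>

definition eigs :: "complex mat \<Rightarrow> complex list" where
  "eigs A = (SOME es. mset es = proots (char_poly A))"

lemma mset_eigs: "mset (eigs A) = proots (char_poly A)"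
  unfolding eigs_def by (rule someI_ex[OF ex_mset])

lemma length_eigs: "A \<in> carrier_mat n n \<Longrightarrow> length (eigs A) = n"
  by (metis degree_monic_char_poly mset_eigs size_mset size_proots_complex)

lemma eigenvalue_eigs:
  assumes A: "A \<in> carrier_mat n n" and "i < n" shows "eigenvalue A (eigs A ! i)"
proof -
  have "char_poly A \<noteq> 0" using degree_monic_char_poly[OF A] by (metis coeff_0 zero_neq_one)
  moreover have "eigs A ! i \<in># proots (char_poly A)"
    using assms length_eigs[OF A] by (metis mset_eigs nth_mem set_mset_mset)
  ultimately show ?thesis using eigenvalue_root_char_poly[OF A] by simp
qed

lemma sum_mset_eigs:
  fixes h :: "complex \<Rightarrow> 'b::comm_monoid_add"
  assumes "A \<in> carrier_mat n n"
  shows "(\<Sum>e\<in>#proots (char_poly A). h e) = (\<Sum>i<n. h (eigs A ! i))"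
proof -
  have "(\<Sum>e\<in>#proots (char_poly A). h e) = (\<Sum>e\<leftarrow>eigs A. h e)"
    unfolding mset_eigs[symmetric] by (simp add: sum_mset_sum_list flip: mset_map)
  also have "\<dots> = (\<Sum>i<n. h (eigs A ! i))"
    by (simp add: sum_list_sum_nth length_eigs[OF assms] atLeast0LessThan)
  finally show ?thesis .
qed

lemma integral_pmf_of_multiset:
  fixes h :: "'a \<Rightarrow> real"
  assumes "M \<noteq> {#}"
  shows "(\<integral>x. h x \<partial>measure_pmf (pmf_of_multiset M)) = (\<Sum>x\<in>#M. h x) / size M"
proof -
  have "(\<integral>x. h x \<partial>measure_pmf (pmf_of_multiset M)) = (\<Sum>x\<in>set_mset M. h x * pmf (pmf_of_multiset M) x)"
    by (rule integral_measure_pmf_real) (use assms in auto)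
  also have "\<dots> = (\<Sum>x\<in>set_mset M. real (count M x) * h x) / size M"
    using assms by (simp add: sum_divide_distrib mult.commute)
  also have "(\<Sum>x\<in>set_mset M. real (count M x) * h x) = (\<Sum>x\<in>#M. h x)"
  proof -
    have "(\<Sum>x\<in>S. real (count M x) * h x) = (\<Sum>x\<in>#M. h x)" if "finite S" "set_mset M \<subseteq> S" for S
      using that(2)
    proof (induction M)
      case (add y M)
      have "(\<Sum>x\<in>S. real (count (add_mset y M) x) * h x) = (\<Sum>x\<in>S. real (count M x) * h x + (if x = y then h y else 0))"
        by (intro sum.cong) (auto simp: algebra_simps)
      then show ?case using add that(1) by (simp add: sum.distrib)
    qed simp
    then show ?thesis by simp
  qed
  finally show ?thesis .
qed

lemma integral_empirical_measure:
  fixes h :: "complex \<Rightarrow> real"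
  assumes A: "A \<in> carrier_mat n n" and "n > 0" and "continuous_on UNIV h"
  shows "integral\<^sup>L (empirical_measure A) h = (\<Sum>i<n. h (eigs A ! i)) / n"
proof -
  have sz: "size (proots (char_poly A)) = n" using length_eigs[OF A] mset_eigs by (metis size_mset)
  then have ne: "proots (char_poly A) \<noteq> {#}" using assms(2) by auto
  have "integral\<^sup>L (empirical_measure A) h = (\<integral>x. h x \<partial>measure_pmf (pmf_of_multiset (proots (char_poly A))))"
    unfolding empirical_measure_def
    by (rule integral_distr) (use assms(3) in \<open>auto intro: borel_measurable_continuous_onI\<close>)
  then show ?thesis using integral_pmf_of_multiset[OF ne, of h] sum_mset_eigs[OF A, of h] sz by simp
qed

text \<open>The law of the angle $t$ under which $g(t)$ has the density of states as its
  distribution.\<close>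

definition uniform_angle :: "real measure" where "uniform_angle = uniform_measure lborel {-pi..pi}"

lemma prob_space_uniform_angle: "prob_space uniform_angle"
  unfolding uniform_angle_def by (rule prob_space_uniform_measure) auto

lemma integral_uniform_angle:
  fixes h :: "real \<Rightarrow> real"
  assumes "continuous_on UNIV h"
  shows "integral\<^sup>L uniform_angle h = 1 / (2 * pi) * integral {-pi..pi} h"
proof -
  have hm: "h \<in> borel_measurable borel" using assms by (rule borel_measurable_continuous_onI)
  have d: "uniform_angle = density lborel (\<lambda>x. ennreal (indicator {-pi..pi} x / (2 * pi)))"
    unfolding uniform_angle_def uniform_measure_def
    by (intro density_cong) (auto simp: divide_ennreal[symmetric] ennreal_indicator)
  have "integral\<^sup>L uniform_angle h = (\<integral>x. (indicator {-pi..pi} x / (2 * pi)) *\<^sub>R h x \<partial>lborel)"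
    unfolding d by (rule integral_density) (use hm in auto)
  also have "\<dots> = (\<integral>x. 1 / (2 * pi) * (indicator {-pi..pi} x *\<^sub>R h x) \<partial>lborel)"
    by simp
  also have "\<dots> = 1 / (2 * pi) * (LINT x : {-pi..pi} | lborel. h x)"
    unfolding set_lebesgue_integral_def by (rule integral_mult_right_zero)
  also have "(LINT x : {-pi..pi} | lborel. h x) = integral {-pi..pi} h"
  proof (rule set_borel_integral_eq_integral(2))
    show "set_integrable lborel {-pi..pi} h"
      by (rule borel_integrable_atLeastAtMost') (use assms continuous_on_subset in blast)
  qed
  finally show ?thesis .
qed

lemma mean_close:
  fixes u v :: "nat \<Rightarrow> real"
  assumes "n > 0" "\<And>i. i < n \<Longrightarrow> \<bar>u i - v i\<bar> \<le> e"
  shows "\<bar>(\<Sum>i<n. u i) / n - (\<Sum>i<n. v i) / n\<bar> \<le> e"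
proof -
  have "\<bar>\<Sum>i<n. u i - v i\<bar> \<le> (\<Sum>i<n. e)" by (intro order.trans[OF sum_abs] sum_mono assms) auto
  then have "\<bar>\<Sum>i<n. u i - v i\<bar> / n \<le> e" using assms(1) by (simp add: field_simps)
  then show ?thesis by (simp add: sum_subtractf diff_divide_distrib[symmetric])
qed

text \<open>A test function $h$ is approximated on the real interval $[-M,M]$ by a polynomial $p$.
  The function $h - \mathrm{Re}\, p$ is small on the interval, hence by uniform continuity also at
  eigenvalues close to it; and the mean of $p$ over the eigenvalues is a combination of
  moments.\<close>

lemma is_DoS_from_moments:
  fixes A :: "nat \<Rightarrow> complex mat" and g :: "real \<Rightarrow> real"
  assumes A: "\<And>n. A n \<in> carrier_mat n n" and g: "continuous_on UNIV g"
    and M: "\<And>n \<xi>. eigenvalue (A n) \<xi> \<Longrightarrow> norm \<xi> \<le> M" "\<And>t. t \<in> {-pi..pi} \<Longrightarrow> \<bar>g t\<bar> \<le> M"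
    and real: "\<And>\<delta>. \<delta> > 0 \<Longrightarrow> \<forall>\<^sub>F n in sequentially. \<forall>\<xi>. eigenvalue (A n) \<xi> \<longrightarrow> \<bar>Im \<xi>\<bar> < \<delta>"
    and mom: "\<And>k. (\<lambda>n. mat_trace (A n ^\<^sub>m k) / of_nat n) \<longlonglongrightarrow> of_real (1 / (2 * pi) * integral {-pi..pi} (\<lambda>t. g t ^ k))"
  shows "is_DoS A (distr uniform_angle borel (\<lambda>t. complex_of_real (g t)))"
proof -
  let ?e = "\<lambda>n. (!) (eigs (A n))"
  let ?I = "\<lambda>h. 1 / (2 * pi) * integral {-pi..pi} h"
  let ?J = "integral {-pi..pi}"
  let ?\<mu> = "distr uniform_angle borel (\<lambda>t. complex_of_real (g t))"
  interpret U: prob_space uniform_angle by (rule prob_space_uniform_angle)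
  have gm: "(\<lambda>t. complex_of_real (g t)) \<in> borel_measurable uniform_angle"
  proof -
    have su: "sets uniform_angle = sets borel" by (simp add: uniform_angle_def)
    show ?thesis using borel_measurable_continuous_onI[OF continuous_on_of_real[OF g]]
      unfolding measurable_cong_sets[OF su refl] .
  qed
  have "prob_space ?\<mu>" by (rule U.prob_space_distr[OF gm])
  moreover have "weakly_converges (\<lambda>n. empirical_measure (A n)) ?\<mu>"
    unfolding weakly_converges_def
  proof (intro allI impI)
    fix h :: "complex \<Rightarrow> real" assume h: "continuous_on UNIV h" "bounded (range h)"
    have hg: "continuous_on UNIV (\<lambda>t. h (complex_of_real (g t)))"
      by (intro continuous_on_compose2[OF h(1)] continuous_intros g) auto
    have R: "integral\<^sup>L ?\<mu> h = ?I (\<lambda>t. h (of_real (g t)))"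
      using integral_distr[OF gm borel_measurable_continuous_onI[OF h(1)]] integral_uniform_angle[OF hg] by simp
    have L: "\<forall>\<^sub>F n in sequentially. (\<Sum>i<n. h (?e n i)) / n = integral\<^sup>L (empirical_measure (A n)) h"
      using eventually_gt_at_top[of 0] by (rule eventually_mono) (simp add: integral_empirical_measure[OF A _ h(1)])
    have "(\<lambda>n. (\<Sum>i<n. h (?e n i)) / n) \<longlonglongrightarrow> ?I (\<lambda>t. h (of_real (g t)))"
    proof (rule tendstoI)
      fix e :: real assume "e > 0"
      define \<epsilon> where "\<epsilon> = e / 4"
      have \<epsilon>: "\<epsilon> > 0" using \<open>e > 0\<close> by (simp add: \<epsilon>_def)
      have "continuous_on {-M..M} (\<lambda>x. h (of_real x))"
        by (intro continuous_on_compose2[OF h(1)] continuous_intros) auto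
      then obtain p where p: "\<And>x. x \<in> {-M..M} \<Longrightarrow> \<bar>h (of_real x) - poly p x\<bar> < \<epsilon>"
        using real_poly_approx[OF _ \<epsilon>] by blast
      define q where "q z = poly (map_poly complex_of_real p) z" for z
      have q_real: "q (of_real x) = of_real (poly p x)" for x by (simp add: q_def)
      define H where "H z = h z - Re (q z)" for z
      have "continuous_on (cball 0 M) H"
        unfolding H_def q_def by (intro continuous_intros continuous_on_subset[OF h(1)]) auto
      then have "uniformly_continuous_on (cball 0 M) H" by (rule compact_uniformly_continuous) simp
      then obtain \<delta> where \<delta>: "\<delta> > 0" "\<And>z w. z \<in> cball 0 M \<Longrightarrow> w \<in> cball 0 M \<Longrightarrow> dist w z < \<delta> \<Longrightarrow> dist (H w) (H z) < \<epsilon>"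
        unfolding uniformly_continuous_on_def using \<epsilon> by metis
      have q_sum: "(\<Sum>i<n. q (?e n i)) / of_nat n = (\<Sum>k\<le>degree p. of_real (coeff p k) * (mat_trace (A n ^\<^sub>m k) / of_nat n))" for n
      proof -
        have "q z = (\<Sum>k\<le>degree p. of_real (coeff p k) * z ^ k)" for z
          unfolding q_def by (simp add: poly_altdef coeff_map_poly degree_map_poly)
        then have "(\<Sum>i<n. q (?e n i)) = (\<Sum>k\<le>degree p. of_real (coeff p k) * (\<Sum>i<n. (?e n i) ^ k))"
          by (simp add: sum_distrib_left sum.swap[of _ "{..<n}"])
        moreover have "(\<Sum>i<n. (?e n i) ^ k) = mat_trace (A n ^\<^sub>m k)" for k
          using sum_mset_eigs[OF A, of "\<lambda>e. e ^ k" n] eigenvalue_power_sum[OF A, of k n] by simp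
        ultimately show ?thesis by (simp add: sum_divide_distrib)
      qed
      have int_p: "(\<Sum>k\<le>degree p. coeff p k * (?I (\<lambda>t. g t ^ k))) = ?I (\<lambda>t. poly p (g t))"
      proof -
        have gi: "continuous_on {-pi..pi} g" using g continuous_on_subset by blast
        have "?J (\<lambda>t. poly p (g t)) = (\<Sum>k\<le>degree p. ?J (\<lambda>t. coeff p k * g t ^ k))"
          unfolding poly_altdef
          by (rule integral_sum) (auto intro!: integrable_continuous_real continuous_intros gi)
        then show ?thesis by (simp add: sum_distrib_left mult_ac)
      qed
      have "(\<lambda>n. (\<Sum>i<n. q (?e n i)) / of_nat n) \<longlonglongrightarrow> (\<Sum>k\<le>degree p. of_real (coeff p k) * of_real (?I (\<lambda>t. g t ^ k)))"
        unfolding q_sum by (intro tendsto_intros mom)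
      then have "(\<lambda>n. (\<Sum>i<n. q (?e n i)) / of_nat n) \<longlonglongrightarrow> of_real (?I (\<lambda>t. poly p (g t)))"
        unfolding int_p[symmetric] by simp
      then have "(\<lambda>n. Re ((\<Sum>i<n. q (?e n i)) / of_nat n)) \<longlonglongrightarrow> Re (of_real (?I (\<lambda>t. poly p (g t))))"
        by (rule tendsto_Re)
      moreover have "Re ((\<Sum>i<n. q (?e n i)) / of_nat n) = (\<Sum>i<n. Re (q (?e n i))) / n" for n
        by (simp add: Re_divide_of_nat)
      ultimately have "(\<lambda>n. (\<Sum>i<n. Re (q (?e n i))) / n) \<longlonglongrightarrow> ?I (\<lambda>t. poly p (g t))"
        by simp
      then have ev1: "\<forall>\<^sub>F n in sequentially. dist ((\<Sum>i<n. Re (q (?e n i))) / n) (?I (\<lambda>t. poly p (g t))) < \<epsilon>"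
        using \<epsilon> by (rule tendstoD)
      have close_int: "\<bar>?I (\<lambda>t. h (of_real (g t))) - ?I (\<lambda>t. poly p (g t))\<bar> \<le> \<epsilon>"
      proof -
        have gi: "continuous_on {-pi..pi} g" using g continuous_on_subset by blast
        have i1: "continuous_on {-pi..pi} (\<lambda>t. h (of_real (g t)))" using hg continuous_on_subset by blast
        have i2: "continuous_on {-pi..pi} (\<lambda>t. poly p (g t))" by (intro continuous_intros gi)
        have "norm (?J (\<lambda>t. h (of_real (g t)) - poly p (g t))) \<le> \<epsilon> * (pi - - pi)"
        proof (rule integral_bound)
          fix t assume "t \<in> {-pi..pi}"
          then have "g t \<in> {-M..M}" using M(2)[of t] by auto
          then show "norm (h (of_real (g t)) - poly p (g t)) \<le> \<epsilon>" using p by force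
        qed (auto intro!: continuous_intros i1 i2)
        then have "\<bar>?J (\<lambda>t. h (of_real (g t))) - ?J (\<lambda>t. poly p (g t))\<bar> \<le> \<epsilon> * (2 * pi)"
          by (simp add: integral_diff integrable_continuous_real i1 i2)
        then have "1 / (2 * pi) * \<bar>?J (\<lambda>t. h (of_real (g t))) - ?J (\<lambda>t. poly p (g t))\<bar> \<le> \<epsilon>"
          by (simp add: field_simps)
        then show ?thesis by (simp only: right_diff_distrib[symmetric] abs_mult) simp
      qed
      show "\<forall>\<^sub>F n in sequentially. dist ((\<Sum>i<n. h (?e n i)) / n) (?I (\<lambda>t. h (of_real (g t)))) < e"
        using ev1 real[OF \<delta>(1)] eventually_gt_at_top[of 0]
      proof eventually_elim
        case (elim n)
        have "\<bar>(\<Sum>i<n. h (?e n i)) / n - (\<Sum>i<n. Re (q (?e n i))) / n\<bar> \<le> 2 * \<epsilon>"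
        proof (rule mean_close[OF elim(3)])
          fix i assume "i < n"
          define z where "z = ?e n i"
          have ez: "eigenvalue (A n) z" unfolding z_def by (rule eigenvalue_eigs[OF A \<open>i < n\<close>])
          have zM: "norm z \<le> M" by (rule M(1)[OF ez])
          have x: "\<bar>Re z\<bar> \<le> M" using abs_Re_le_cmod[of z] zM by linarith
          have "dist z (of_real (Re z)) = \<bar>Im z\<bar>" by (simp add: dist_norm cmod_def)
          then have "dist z (of_real (Re z)) < \<delta>" using elim(2) ez by simp
          then have "dist (H z) (H (of_real (Re z))) < \<epsilon>" using zM x by (intro \<delta>(2)) auto
          moreover have "\<bar>H (of_real (Re z))\<bar> < \<epsilon>" using p[of "Re z"] x by (simp add: H_def q_real abs_le_iff)
          ultimately have "\<bar>H z\<bar> \<le> 2 * \<epsilon>" by (simp add: dist_real_def)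
          then show "\<bar>h (?e n i) - Re (q (?e n i))\<bar> \<le> 2 * \<epsilon>" by (simp add: H_def z_def)
        qed
        then show ?case using elim(1) close_int \<epsilon> unfolding dist_real_def \<epsilon>_def by linarith
      qed
    qed
    then show "(\<lambda>n. integral\<^sup>L (empirical_measure (A n)) h) \<longlonglongrightarrow> integral\<^sup>L ?\<mu> h"
      unfolding R by (rule Lim_transform_eventually) (rule L)
  qed
  ultimately show ?thesis by (simp add: is_DoS_def)
qed


section \<open>Moments along the curve\<close>

lemma Reals_coeff_power:
  fixes p :: "complex poly"
  assumes "\<And>i. coeff p i \<in> \<real>"
  shows "coeff (p ^ k) i \<in> \<real>"
proof (induction k arbitrary: i)
  case (Suc k)
  then show ?case using assms by (simp add: coeff_mult)
qed (simp add: coeff_1)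

text \<open>The residue computation for $z^{e-1}$ along the curve, by an explicit primitive:
  $q^e/(ie)$ for $e \ne 0$ and $t - i \log r$ for $e = 0$. Periodicity of $r$ makes the boundary
  terms cancel.\<close>

lemma polar_power_has_integral:
  fixes r r' :: "real \<Rightarrow> real" and e :: int
  assumes pos: "\<And>\<theta>. \<theta> \<in> {-pi..pi} \<Longrightarrow> r \<theta> > 0"
    and der: "\<And>\<theta>. \<theta> \<in> {-pi..pi} \<Longrightarrow> (r has_real_derivative r' \<theta>) (at \<theta> within {-pi..pi})"
    and per: "r (- pi) = r pi"
  shows "((\<lambda>\<theta>. (of_real (r \<theta>) * cis \<theta>) powi e * (1 - \<i> * of_real (r' \<theta> / r \<theta>))) has_integral (if e = 0 then 2 * pi else 0)) {-pi..pi}"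
proof (cases "e = 0")
  case True
  have "((\<lambda>\<theta>. of_real \<theta> - \<i> * of_real (ln (r \<theta>))) has_vector_derivative (of_real 1 - \<i> * of_real (r' \<theta> / r \<theta>))) (at \<theta> within {-pi..pi})"
    if "\<theta> \<in> {-pi..pi}" for \<theta>
    by (rule derivative_intros der[OF that] pos[OF that] | (rule derivative_eq_intros der[OF that] pos[OF that] refl)+ | simp add: pos[OF that])+
  then have "((\<lambda>\<theta>. complex_of_real 1 - \<i> * of_real (r' \<theta> / r \<theta>)) has_integral
     (of_real pi - \<i> * of_real (ln (r pi))) - (of_real (- pi) - \<i> * of_real (ln (r (- pi))))) {-pi..pi}"
    by (intro fundamental_theorem_of_calculus) auto
  then show ?thesis using True per by simp
next
  case False
  define q where "q \<theta> = of_real (r \<theta>) * cis \<theta>" for \<theta>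
  have "((\<lambda>\<theta>. (q \<theta>) powi e / (\<i> * of_int e)) has_vector_derivative (q \<theta> powi e * (1 - \<i> * of_real (r' \<theta> / r \<theta>)))) (at \<theta> within {-pi..pi})"
    if \<theta>: "\<theta> \<in> {-pi..pi}" for \<theta>
  proof -
    have rp: "r \<theta> > 0" by (rule pos[OF \<theta>])
    have qn: "q \<theta> \<noteq> 0" using rp by (simp add: q_def)
    have c: "(cis has_vector_derivative \<i> * cis \<theta>) (at \<theta> within {-pi..pi})"
      unfolding has_vector_derivative_def by (rule has_derivative_cis[OF has_derivative_ident])
    have dq: "(q has_vector_derivative (of_real (r \<theta>) * (\<i> * cis \<theta>) + of_real (r' \<theta>) * cis \<theta>)) (at \<theta> within {-pi..pi})"
      unfolding q_def[abs_def] by (rule has_vector_derivative_mult[OF has_vector_derivative_of_real[OF der[OF \<theta>]] c])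
    have "((\<lambda>z. z powi e / (\<i> * of_int e)) has_field_derivative (of_int e * q \<theta> powi (e - 1) * 1 / (\<i> * of_int e))) (at (q \<theta>) within q ` {-pi..pi})"
      by (rule DERIV_cdivide DERIV_power_int DERIV_ident disjI2 qn)+
    from field_vector_diff_chain_within[OF dq this]
    have "((\<lambda>\<theta>. (q \<theta>) powi e / (\<i> * of_int e)) has_vector_derivative
        (of_real (r \<theta>) * (\<i> * cis \<theta>) + of_real (r' \<theta>) * cis \<theta>) * (of_int e * q \<theta> powi (e - 1) * 1 / (\<i> * of_int e))) (at \<theta> within {-pi..pi})"
      by (simp add: o_def)
    moreover have "(of_real (r \<theta>) * (\<i> * cis \<theta>) + of_real (r' \<theta>) * cis \<theta>) * (of_int e * q \<theta> powi (e - 1) * 1 / (\<i> * of_int e))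
       = q \<theta> powi e * (1 - \<i> * of_real (r' \<theta> / r \<theta>))"
    proof -
      have "q \<theta> powi e = q \<theta> powi (e - 1) * q \<theta>" using qn power_int_add_1[of "q \<theta>" "e - 1"] by simp
      moreover have "of_real (r \<theta>) * (\<i> * cis \<theta>) + of_real (r' \<theta>) * cis \<theta> = \<i> * (q \<theta> * (1 - \<i> * of_real (r' \<theta> / r \<theta>)))"
        using rp by (simp add: q_def field_simps)
      moreover have "\<i> * (u * t) * (of_int e * v * 1 / (\<i> * of_int e)) = v * u * t" for u t v :: complex
        using False by (simp add: field_simps)
      ultimately show ?thesis by (simp only:)
    qed
    ultimately show ?thesis by simp
  qed
  then have "((\<lambda>\<theta>. q \<theta> powi e * (1 - \<i> * of_real (r' \<theta> / r \<theta>))) has_integral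
     (q pi powi e / (\<i> * of_int e) - q (- pi) powi e / (\<i> * of_int e))) {-pi..pi}"
    by (intro fundamental_theorem_of_calculus) auto
  moreover have "q (- pi) = q pi" by (simp add: q_def per complex_eq_iff)
  ultimately show ?thesis using False unfolding q_def by simp
qed

context laurent_symbol begin

lemma laurent_power_expansion:
  assumes "z \<noteq> 0"
  shows "f z ^ k = (\<Sum>j\<le>degree (P 0 ^ k). coeff (P 0 ^ k) j * z powi (int j - int (m * k)))"
proof -
  let ?p = "P 0 ^ k"
  have "z ^ (m * k) * f z ^ k = poly (?p) z"
    using assms by (simp add: poly_power poly_shifted_poly power_mult_distrib power_mult)
  also have "\<dots> = (\<Sum>j\<le>degree (?p). coeff (?p) j * z ^ j)" by (rule poly_altdef)
  also have "\<dots> = z ^ (m * k) * (\<Sum>j\<le>degree (?p). coeff (?p) j * z powi (int j - int (m * k)))"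
  proof -
    have "z ^ (m * k) * z powi (int j - int (m * k)) = z ^ j" for j
      using assms by (simp add: power_int_diff del: of_nat_mult)
    then show ?thesis unfolding sum_distrib_left by (simp only: mult.left_commute[of "z ^ (m * k)"])
  qed
  finally show ?thesis using assms by simp
qed

text \<open>Termwise integration of the expansion of $f^k$. The unit circle is the case of
  constant radius 1, so it gives the same value as the curve.\<close>

lemma polar_curve_moment_has_integral:
  fixes r r' :: "real \<Rightarrow> real"
  assumes pos: "\<And>\<theta>. \<theta> \<in> {-pi..pi} \<Longrightarrow> r \<theta> > 0"
    and der: "\<And>\<theta>. \<theta> \<in> {-pi..pi} \<Longrightarrow> (r has_real_derivative r' \<theta>) (at \<theta> within {-pi..pi})"
    and per: "r (- pi) = r pi"
  shows "((\<lambda>\<theta>. f (of_real (r \<theta>) * cis \<theta>) ^ k * (1 - \<i> * of_real (r' \<theta> / r \<theta>))) has_integral (2 * pi * coeff (P 0 ^ k) (m * k))) {-pi..pi}"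
proof -
  let ?w = "\<lambda>\<theta>. 1 - \<i> * of_real (r' \<theta> / r \<theta>) :: complex"
  let ?p = "P 0 ^ k"
  let ?q = "\<lambda>\<theta>. of_real (r \<theta>) * cis \<theta>"
  have "((\<lambda>\<theta>. \<Sum>j\<le>degree (?p). coeff (?p) j * (?q \<theta> powi (int j - int (m * k)) * ?w \<theta>))
     has_integral (\<Sum>j\<le>degree (?p). coeff (?p) j * (if int j - int (m * k) = 0 then 2 * pi else 0))) {-pi..pi}"
    by (intro has_integral_sum has_integral_mult_right polar_power_has_integral assms) auto
  also have "(\<Sum>j\<le>degree (?p). coeff (?p) j * complex_of_real (if int j - int (m * k) = 0 then 2 * pi else 0)) = 2 * pi * coeff (?p) (m * k)"
  proof -
    have "(\<Sum>j\<le>degree (?p). coeff (?p) j * complex_of_real (if int j - int (m * k) = 0 then 2 * pi else 0))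
      = (\<Sum>j\<le>degree (?p). if j = m * k then 2 * pi * coeff (?p) (m * k) else 0)"
    proof (rule sum.cong[OF refl])
      fix j
      have "int j - int (m * k) = 0 \<longleftrightarrow> j = m * k" by linarith
      then show "coeff (?p) j * complex_of_real (if int j - int (m * k) = 0 then 2 * pi else 0)
        = (if j = m * k then 2 * pi * coeff (?p) (m * k) else 0)" by simp
    qed
    then show ?thesis by (auto simp: coeff_eq_0 not_le)
  qed
  finally have int: "((\<lambda>\<theta>. \<Sum>j\<le>degree (?p). coeff (?p) j * (?q \<theta> powi (int j - int (m * k)) * ?w \<theta>))
     has_integral (2 * pi * coeff (?p) (m * k))) {-pi..pi}" .
  have "(\<Sum>j\<le>degree (?p). coeff (?p) j * (?q \<theta> powi (int j - int (m * k)) * ?w \<theta>))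
      = f (?q \<theta>) ^ k * ?w \<theta>" if "\<theta> \<in> {-pi..pi}" for \<theta>
  proof -
    have "?q \<theta> \<noteq> 0" using pos[OF that] by simp
    from laurent_power_expansion[OF this, of k] show ?thesis by (simp only: sum_distrib_right mult.assoc)
  qed
  from has_integral_eq[OF this int] show ?thesis .
qed

text \<open>Compare the curve with the unit circle. The coefficient is real because those of $f$
  are, and so are the values of $f$ on the curve, so that the term with $r'/r$ is purely imaginary
  and disappears from the real part.\<close>

lemma moment_transfer:
  fixes r r' :: "real \<Rightarrow> real"
  assumes pos: "\<And>\<theta>. \<theta> \<in> {-pi..pi} \<Longrightarrow> r \<theta> > 0"
    and der: "\<And>\<theta>. \<theta> \<in> {-pi..pi} \<Longrightarrow> (r has_real_derivative r' \<theta>) (at \<theta> within {-pi..pi})"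
    and per: "r (- pi) = r pi"
    and g: "\<And>\<theta>. \<theta> \<in> {-pi..pi} \<Longrightarrow> f (of_real (r \<theta>) * cis \<theta>) = of_real (g \<theta>)"
  shows "symbol_coeff (\<lambda>z. f z ^ k) 0 = of_real (1 / (2 * pi) * integral {-pi..pi} (\<lambda>\<theta>. g \<theta> ^ k))"
proof -
  define \<beta> where "\<beta> = coeff (P 0 ^ k) (m * k)"
  have "\<beta> \<in> \<real>" unfolding \<beta>_def by (rule Reals_coeff_power) (auto simp: coeff_shifted_poly)
  then obtain \<beta>' where \<beta>': "\<beta> = of_real \<beta>'" by (rule Reals_cases)
  have "((\<lambda>\<theta>. f (of_real 1 * cis \<theta>) ^ k * (1 - \<i> * of_real (0 / 1))) has_integral (2 * pi * \<beta>)) {-pi..pi}"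
    unfolding \<beta>_def by (rule polar_curve_moment_has_integral) auto
  then have 1: "symbol_coeff (\<lambda>z. f z ^ k) 0 = \<beta>"
    unfolding symbol_coeff_def by (simp add: integral_unique)
  have "((\<lambda>\<theta>. f (of_real (r \<theta>) * cis \<theta>) ^ k * (1 - \<i> * of_real (r' \<theta> / r \<theta>))) has_integral (2 * pi * \<beta>)) {-pi..pi}"
    unfolding \<beta>_def by (rule polar_curve_moment_has_integral[OF pos der per])
  then have "((\<lambda>\<theta>. Re (f (of_real (r \<theta>) * cis \<theta>) ^ k * (1 - \<i> * of_real (r' \<theta> / r \<theta>)))) has_integral Re (2 * pi * \<beta>)) {-pi..pi}"
    by (rule has_integral_Re)
  then have int: "((\<lambda>\<theta>. Re (f (of_real (r \<theta>) * cis \<theta>) ^ k * (1 - \<i> * of_real (r' \<theta> / r \<theta>)))) has_integral (2 * pi * \<beta>')) {-pi..pi}"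
    by (simp add: \<beta>')
  have "Re (f (of_real (r \<theta>) * cis \<theta>) ^ k * (1 - \<i> * of_real (r' \<theta> / r \<theta>))) = g \<theta> ^ k"
    if "\<theta> \<in> {-pi..pi}" for \<theta>
    unfolding g[OF that] by (simp flip: of_real_power)
  from has_integral_eq[OF this int] have "((\<lambda>\<theta>. g \<theta> ^ k) has_integral (2 * pi * \<beta>')) {-pi..pi}" .
  then show ?thesis using 1 \<beta>' by (simp add: integral_unique)
qed

end


section \<open>Coincidence of the two densities of states\<close>

text \<open>Since $r$ is even, it depends on the angle only through its cosine, which is
  continuous across the negative real axis.\<close>

lemma radius_Arg_eq:
  assumes even: "\<And>\<theta>. \<theta> \<in> {-pi..pi} \<Longrightarrow> r (- \<theta>) = r \<theta>" and "w \<noteq> 0"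
  shows "r (Arg w) = r (arccos (Re w / norm w))"
proof -
  have "cis (Arg w) = sgn w" using cis_Arg[OF assms(2)] .
  then have c: "cos (Arg w) = Re w / norm w" by (metis Re_sgn cis.simps(1))
  have b: "- pi < Arg w" "Arg w \<le> pi" using Arg_bounded[of w] by auto
  show ?thesis
  proof (cases "Arg w \<ge> 0")
    case True
    then show ?thesis using b by (simp add: arccos_cos flip: c)
  next
    case False
    then have "arccos (Re w / norm w) = - Arg w" using b by (simp add: arccos_cos2 flip: c)
    then show ?thesis using even[of "Arg w"] b by simp
  qed
qed

lemma laurent_cnj: "laurent m a (cnj z) = cnj (laurent m a z)"
  by (simp add: laurent_def)

theorem theorem2p14:
  fixes m :: nat and a :: "int \<Rightarrow> real" and r :: "real \<Rightarrow> real"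
  assumes "m \<ge> 1"
    and "a (int m) \<noteq> 0" and "a (- int m) \<noteq> 0"
    and "C1_polar_radius r"
    and "Z_set m a = polar_curve r ` sphere 0 1"
    and "separated m a"
  shows "\<exists>\<mu>. is_DoS (toeplitz (laurent m a)) \<mu> \<and>
             is_DoS (toeplitz (laurent m a \<circ> polar_curve r)) \<mu>"
proof -
  obtain r' where pos: "\<And>\<theta>. \<theta> \<in> {-pi..pi} \<Longrightarrow> r \<theta> > 0"
    and even: "\<And>\<theta>. \<theta> \<in> {-pi..pi} \<Longrightarrow> r (- \<theta>) = r \<theta>"
    and der: "\<And>\<theta>. \<theta> \<in> {-pi..pi} \<Longrightarrow> (r has_real_derivative r' \<theta>) (at \<theta> within {-pi..pi})"
    using assms(4) unfolding C1_polar_radius_def by blast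
  have per: "r (- pi) = r pi" using even[of pi] by simp
  have contr: "continuous_on {-pi..pi} r" using der by (rule DERIV_continuous_on)
  define \<rho> where "\<rho> z = r (arccos (Re z / norm z))" for z :: complex
  have ratio: "-1 \<le> Re z / norm z \<and> Re z / norm z \<le> 1" for z :: complex
    using abs_Re_le_cmod[of z] by (cases "z = 0") (auto simp: field_simps abs_le_iff)
  have arccos_range: "arccos x \<in> {-pi..pi}" if "-1 \<le> x \<and> x \<le> 1" for x
    using arccos_bounded[of x] that pi_ge_zero by auto
  have \<rho>_pos: "\<rho> z > 0" for z unfolding \<rho>_def by (intro pos arccos_range ratio)
  have ray: "\<rho> (of_real t * z) = \<rho> z" if "t > 0" for t z
    using that by (simp add: \<rho>_def norm_mult)
  have cont_\<rho>: "continuous_on (- {0}) \<rho>"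
    unfolding \<rho>_def by (intro continuous_on_compose2[OF contr] continuous_intros) (use ratio arccos_range in auto)
  have pc: "polar_curve r w = of_real (\<rho> w) * w" if "w \<noteq> 0" for w
    unfolding polar_curve_def \<rho>_def using radius_Arg_eq[of r w, OF even that] by simp
  have Z: "Z_set m a = {z. z \<noteq> 0 \<and> norm z = \<rho> z}"
    unfolding assms(5)
  proof (intro equalityI subsetI)
    fix z assume "z \<in> polar_curve r ` sphere 0 1"
    then obtain w where w: "norm w = 1" "z = polar_curve r w" by auto
    then have "w \<noteq> 0" by auto
    then have "z = of_real (\<rho> w) * w" using pc w(2) by simp
    then show "z \<in> {z. z \<noteq> 0 \<and> norm z = \<rho> z}" 
      using w(1) \<open>w \<noteq> 0\<close> \<rho>_pos[of w] ray[of "\<rho> w" w] by (simp add: norm_mult less_imp_le)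
  next
    fix z assume z: "z \<in> {z. z \<noteq> 0 \<and> norm z = \<rho> z}"
    define w where "w = z / of_real (norm z)"
    have z0: "z \<noteq> 0" and nz: "norm z = \<rho> z" using z by auto
    have "w = of_real (1 / norm z) * z" by (simp add: w_def)
    then have "\<rho> w = \<rho> z" using ray[of "1 / norm z" z] z0 by simp
    moreover have w1: "norm w = 1" using z0 unfolding w_def norm_divide norm_of_real abs_norm_cancel
      by (intro divide_self) simp
    moreover have "z = of_real (norm z) * w" using z0 by (simp add: w_def)
    moreover have "polar_curve r w = of_real (\<rho> w) * w" using w1 by (intro pc) auto
    moreover note nz
    ultimately have "z = polar_curve r w" "w \<in> sphere 0 1" by simp_all
    then show "z \<in> polar_curve r ` sphere 0 1" by (rule image_eqI)
  qed
  interpret star_curve_symbol m a \<rho>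
    by unfold_locales (use assms cont_\<rho> \<rho>_pos ray Z in auto)
  define q where "q \<theta> = of_real (\<rho> (cis \<theta>)) * cis \<theta>" for \<theta>
  have q0: "q \<theta> \<noteq> 0" for \<theta> using \<rho>_pos[of "cis \<theta>"] by (simp add: q_def)
  have q\<gamma>: "norm (q \<theta>) = \<rho> (q \<theta>)" for \<theta>
    using \<rho>_pos[of "cis \<theta>"] ray[of "\<rho> (cis \<theta>)" "cis \<theta>"] by (simp add: q_def norm_mult)
  define g where "g \<theta> = Re (f (q \<theta>))" for \<theta>
  have fg: "f (q \<theta>) = of_real (g \<theta>)" for \<theta>
    using on_curve(1)[OF q0 q\<gamma>, of \<theta>] by (simp add: g_def)
  define b where "b = laurent m a \<circ> polar_curve r"
  have bg: "b (cis \<theta>) = of_real (g \<theta>)" for \<theta>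
    using pc[of "cis \<theta>"] fg[of \<theta>] by (simp add: b_def q_def)
  have cont_q: "continuous_on UNIV q"
    unfolding q_def by (intro continuous_intros continuous_on_compose2[OF cont_\<rho>]) auto
  have cont_g: "continuous_on UNIV g"
    unfolding g_def by (intro continuous_intros continuous_on_compose2[OF continuous_f cont_q]) (use q0 in auto)
  have q_polar: "q \<theta> = of_real (r \<theta>) * cis \<theta>" if "\<theta> \<in> {-pi..pi}" for \<theta>
  proof -
    have "r (arccos (cos \<theta>)) = r \<theta>"
      using that even[of \<theta>] arccos_cos[of \<theta>] arccos_cos2[of \<theta>] by (cases "\<theta> \<ge> 0") auto
    then show ?thesis by (simp add: q_def \<rho>_def)
  qed
  \<comment> \<open>The symbol is a continuous function of $\cos t$, because conjugation fixes the
    curve and commutes with $f$.\<close>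
  have g_even: "g \<theta> = g (arccos (cos \<theta>))" for \<theta>
  proof -
    define t where "t = arccos (cos \<theta>)"
    have ct: "cos t = cos \<theta>" by (simp add: t_def)
    then have "(sin t)\<^sup>2 = (sin \<theta>)\<^sup>2" by (simp add: sin_squared_eq)
    then have "sin t = sin \<theta> \<or> sin t = - sin \<theta>" by (simp add: power2_eq_iff)
    then have "cis t = cis \<theta> \<or> cis t = cnj (cis \<theta>)" using ct by (auto simp: complex_eq_iff)
    moreover have "\<rho> (cis t) = \<rho> (cis \<theta>)" using ct by (simp add: \<rho>_def)
    ultimately have "q t = q \<theta> \<or> q t = cnj (q \<theta>)" by (auto simp: q_def)
    then show ?thesis unfolding t_def[symmetric] by (auto simp: g_def laurent_cnj)
  qed
  have cb: "circle_continuous b" unfolding circle_continuous_def bg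
    by (intro continuous_intros continuous_on_subset[OF cont_g]) auto
  have cf: "circle_continuous f" by (rule trigsum_circle_continuous[OF trigsum_laurent])
  obtain M1 where M1: "M1 > 0" "\<And>\<theta>. \<theta> \<in> {-pi..pi} \<Longrightarrow> norm (f (cis \<theta>)) \<le> M1" using circle_continuous_bounded[OF cf] by blast
  obtain M2 where M2: "M2 > 0" "\<And>\<theta>. \<theta> \<in> {-pi..pi} \<Longrightarrow> norm (b (cis \<theta>)) \<le> M2" using circle_continuous_bounded[OF cb] by blast
  define M where "M = max M1 M2"
  have gM: "\<bar>g \<theta>\<bar> \<le> M" if "\<theta> \<in> {-pi..pi}" for \<theta> using M2(2)[OF that] by (simp add: bg M_def)
  have evf: "norm \<xi> \<le> M" if "eigenvalue (toeplitz f n) \<xi>" for n \<xi>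
    using l2_bounded_eigenvalue[OF toeplitz_carrier toeplitz_l2_bounded[OF cf M1(2,1)] that] by (simp add: M_def)
  have evb: "norm \<xi> \<le> M" if "eigenvalue (toeplitz b n) \<xi>" for n \<xi>
    using l2_bounded_eigenvalue[OF toeplitz_carrier toeplitz_l2_bounded[OF cb M2(2,1)] that] by (simp add: M_def)
  let ?\<mu> = "distr uniform_angle borel (\<lambda>\<theta>. complex_of_real (g \<theta>))"
  have "is_DoS (toeplitz f) ?\<mu>"
  proof (rule is_DoS_from_moments[OF toeplitz_carrier cont_g evf gM])
    show "\<forall>\<^sub>F n in sequentially. \<forall>\<xi>. eigenvalue (toeplitz f n) \<xi> \<longrightarrow> \<bar>Im \<xi>\<bar> < \<delta>" if "\<delta> > 0" for \<delta>
      using eigenvalues_approach_real[OF evf that] .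
    show "(\<lambda>n. mat_trace (toeplitz f n ^\<^sub>m k) / of_nat n) \<longlonglongrightarrow> of_real (1 / (2 * pi) * integral {-pi..pi} (\<lambda>\<theta>. g \<theta> ^ k))" for k
    proof -
      have "f (of_real (r \<theta>) * cis \<theta>) = of_real (g \<theta>)" if "\<theta> \<in> {-pi..pi}" for \<theta>
        using fg[of \<theta>] q_polar[OF that] by simp
      from moment_transfer[of r r' g, OF pos der per this]
      have "symbol_coeff (\<lambda>z. f z ^ k) 0 = of_real (1 / (2 * pi) * integral {-pi..pi} (\<lambda>\<theta>. g \<theta> ^ k))" .
      then show ?thesis using toeplitz_moment_trigsum[OF trigsum_laurent, of k] by simp
    qed
  qed
  moreover have "is_DoS (toeplitz b) ?\<mu>"
  proof (rule is_DoS_from_moments[OF toeplitz_carrier cont_g evb gM])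
    show "\<forall>\<^sub>F n in sequentially. \<forall>\<xi>. eigenvalue (toeplitz b n) \<xi> \<longrightarrow> \<bar>Im \<xi>\<bar> < \<delta>" if "\<delta> > 0" for \<delta>
    proof (rule always_eventually, intro allI impI)
      fix n \<xi> assume "eigenvalue (toeplitz b n) \<xi>"
      then have "\<xi> \<in> \<real>" by (rule toeplitz_real_eigenvalue[OF cb, rotated]) (simp add: bg)
      then show "\<bar>Im \<xi>\<bar> < \<delta>" using that by (simp add: complex_is_Real_iff)
    qed
    have "symbol_coeff (\<lambda>z. b z ^ k) 0 = of_real (1 / (2 * pi) * integral {-pi..pi} (\<lambda>\<theta>. g \<theta> ^ k))" for k
    proof -
      have "integral {-pi..pi} (\<lambda>\<theta>. complex_of_real (g \<theta> ^ k)) = of_real (integral {-pi..pi} (\<lambda>\<theta>. g \<theta> ^ k))"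
        by (intro integral_complex_of_real integrable_continuous_real continuous_intros continuous_on_subset[OF cont_g]) auto
      then show ?thesis unfolding symbol_coeff_def by (simp add: bg)
    qed
    moreover have "continuous_on {-1..1} (\<lambda>c. g (arccos c))"
      by (intro continuous_on_compose2[OF cont_g] continuous_intros) auto
    then have "(\<lambda>n. mat_trace (toeplitz b n ^\<^sub>m k) / of_nat n) \<longlonglongrightarrow> symbol_coeff (\<lambda>z. b z ^ k) 0" for k
      by (rule toeplitz_moment_even) (use bg g_even in metis)
    ultimately show "(\<lambda>n. mat_trace (toeplitz b n ^\<^sub>m k) / of_nat n) \<longlonglongrightarrow> of_real (1 / (2 * pi) * integral {-pi..pi} (\<lambda>\<theta>. g \<theta> ^ k))" for k
      by simp
  qed
  ultimately show ?thesis unfolding b_def by blast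
qed

end
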